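(* Let $(W,S,\mathbf c)$ be a Coxeter triple, with Coxeter graph $\Gamma$, and let $\kappa$ be a cut path of $\mathcal C^2_{\mathbf c}$. (i) For each edge $e=\{s_i,s_j\}$ of $\Gamma$ there exists a unique directed edge $e_\kappa=(\sigma,\tau)\in\kappa$ with $\{\mathsf g(\sigma),\mathsf g(\tau)\}=\{s_i,s_j\}$. (ii) If $s_j$ is a vertex of degree $2$ of $\Gamma$ with incident edges $e=\{s_i,s_j\}$ and $\tilde e=\{s_j,s_k\}$, there is a unique tile $T$ whose boundary contains the corresponding directed edges $e_\kappa$ and $\tilde e_\kappa$ from (i). (iii) If $s_r$ is a vertex of degree $3$ of $\Gamma$ with incident edges $e=\{s_{r-1},s_r\}$, $\tilde e=\{s_r,s_{r+1}\}$, $\bar e=\{s_r,s_n\}$ and corresponding directed edges $e_\kappa,\tilde e_\kappa,\bar e_\kappa$ of $\kappa$ from (i), there are two unique tiles $T_1,T_2$ such that $e_\kappa,\bar e_\kappa\in\partial T_1$, $\tilde e_\kappa,\bar e_\kappa\in\partial T_2$, and $\partial T_1\cap\partial T_2$ consists of two edges of $\mathcal C^2_{\mathbf c}$.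
   Context: $(W,S)$ is an irreducible finite Coxeter system of rank $n$, Coxeter number $h$, longest element $w_\circ$, Coxeter graph $\Gamma$ (vertices $S$, edge iff non-commuting); $\mathbf c$ is a reduced expression of a Coxeter element (product of all generators, each once). Label $S$ so that $s_1,\dots,s_p$ are successive vertices of a longest path in $\Gamma$ ($p=n-1$ in types $D_n,E_6,E_7,E_8$, else $p=n$); if $p=n-1$, $s_n$ is adjacent to $s_r$ with $r=n-2$ (type $D$) or $r=n-3$ (type $E$). Words $\mathbf u\sim\mathbf v$ if related by swaps of adjacent commuting letters. $\mathbf w_\circ^{\mathbf c}$ is the reduced expression of $w_\circ$ lexicographically first (as a sequence of positions) among subwords of $\mathbf c^\infty$ that are reduced expressions of $w_\circ$; $\psi(w)=w_\circ^{-1}ww_\circ$ letterwise. Natural partial order on letters of a word: $\sigma_r\preceq\sigma_s$ iff there are positions $r=i_1<\dots<i_q=s$ with non-commuting generators at consecutive chosen positions; $\mathsf g(\sigma)$ is the generator of letter $\sigma$; Hasse diagram $\mathcal G$ with edges $(\sigma,\tau)$ for $\tau$ covering $\sigma$. Identify letters of $\mathbf c^h\sim\mathbf w_\circ^{\mathbf c}\psi(\mathbf w_\circ^{\mathbf c})$ by matching $k$-th occurrences of each generator; $pr$ sends the letter at position $j$ of copy $hk+i$ ($0\le i<h$) in $\mathbf c^\infty$ to the letter at position $j$ of copy $i$ in $\mathbf c^h$. The $2$-cover $\mathcal C^2_{\mathbf c}$ is the directed graph on the letters of $\mathbf w_\circ^{\mathbf c}\psi(\mathbf w_\circ^{\mathbf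 c})$ with edges $(pr(\sigma),pr(\tau))$ for edges $(\sigma,\tau)$ of $\mathcal G_{\mathbf c^\infty}$. A cut path is a set of edges meeting every directed cycle of $\mathcal C^2_{\mathbf c}$ in exactly one edge. Embedding: draw $\mathcal G_{\mathbf c^\infty}$ in the plane with copy $1$ of $s_1$ at $(0,0)$, copy $1$ of $s_j$ ($2\le j\le p$) at $(x_{j-1}\pm1,y_{j-1}+1)$ with $+$ iff $s_{j-1}$ precedes $s_j$ in $\mathbf c$, copy $1$ of $s_n$ (if $p=n-1$) at $(x_r\pm1,y_r)$ with $+$ iff $s_r$ precedes $s_n$, copy $m+1$ = copy $m$ shifted by $2$ in $x$, straight edges; reducing $x$ modulo $2h$ gives a crossing-free drawing of $\mathcal C^2_{\mathbf c}$ on the cylinder $S^1\times\mathbb R$. A tile is a bounded connected component of the complement of this drawing in the cylinder; $\partial T$ is the boundary of its closure. *)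

theory Defs
  imports "HOL-Analysis.Analysis" "HOL-Algebra.Multiplicative_Group" "HOL-Algebra.Generated_Groups"
begin

section \<open>Coxeter systems\<close>

definition word_prod :: "('a, 'b) monoid_scheme \<Rightarrow> 'a list \<Rightarrow> 'a" where
  "word_prod G ws = foldr (\<lambda>a b. a \<otimes>\<^bsub>G\<^esub> b) ws \<one>\<^bsub>G\<^esub>"

definition coxeter_m :: "('a, 'b) monoid_scheme \<Rightarrow> 'a \<Rightarrow> 'a \<Rightarrow> nat" where
  "coxeter_m G s t = group.ord G (s \<otimes>\<^bsub>G\<^esub> t)"

text \<open>The congruence on words over \<open>S\<close> generated by the relations \<open>(s t)\<^bsup>m(s,t)\<^esup> = 1\<close>. An infinite
  order is represented by \<open>m(s,t) = 0\<close>, in which case the relation is void, as it should be. As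
  \<open>m(s,s) = 1\<close> for an involution \<open>s\<close>, letters are self-inverse modulo this congruence, so that words
  without formal inverses suffice to describe the presented group.\<close>

inductive coxeter_cong :: "('a, 'b) monoid_scheme \<Rightarrow> 'a set \<Rightarrow> 'a list \<Rightarrow> 'a list \<Rightarrow> bool"
  for G :: "('a, 'b) monoid_scheme" and S :: "'a set" where
  relation: "s \<in> S \<Longrightarrow> t \<in> S \<Longrightarrow> coxeter_cong G S (concat (replicate (coxeter_m G s t) [s, t])) []"
| refl: "u \<in> lists S \<Longrightarrow> coxeter_cong G S u u"
| sym: "coxeter_cong G S u v \<Longrightarrow> coxeter_cong G S v u"
| trans: "coxeter_cong G S u v \<Longrightarrow> coxeter_cong G S v w \<Longrightarrow> coxeter_cong G S u w"
| congr: "coxeter_cong G S u v \<Longrightarrow> x \<in> lists S \<Longrightarrow> y \<in> lists S \<Longrightarrow>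
    coxeter_cong G S (x @ u @ y) (x @ v @ y)"

text \<open>Bourbaki's definition: \<open>S\<close> generates the group, consists of elements of order 2, and the
  relations \<open>(s t)\<^bsup>m(s,t)\<^esup> = 1\<close> form a presentation.\<close>

definition coxeter_system :: "('a, 'b) monoid_scheme \<Rightarrow> 'a set \<Rightarrow> bool" where
  "coxeter_system G S \<longleftrightarrow>
     group G \<and> S \<subseteq> carrier G \<and> generate G S = carrier G \<and>
     (\<forall>s\<in>S. group.ord G s = 2) \<and>
     (\<forall>u\<in>lists S. \<forall>v\<in>lists S. word_prod G u = word_prod G v \<longrightarrow> coxeter_cong G S u v)"

definition noncomm :: "('a, 'b) monoid_scheme \<Rightarrow> 'a \<Rightarrow> 'a \<Rightarrow> bool" where
  "noncomm G s t \<longleftrightarrow> s \<otimes>\<^bsub>G\<^esub> t \<noteq> t \<otimes>\<^bsub>G\<^esub> s"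

definition coxeter_graph :: "('a, 'b) monoid_scheme \<Rightarrow> 'a set \<Rightarrow> 'a set set" where
  "coxeter_graph G S = {{s, t} | s t. s \<in> S \<and> t \<in> S \<and> noncomm G s t}"

definition incident_edges :: "('a, 'b) monoid_scheme \<Rightarrow> 'a set \<Rightarrow> 'a \<Rightarrow> 'a set set" where
  "incident_edges G S s = {e \<in> coxeter_graph G S. s \<in> e}"

definition vertex_degree :: "('a, 'b) monoid_scheme \<Rightarrow> 'a set \<Rightarrow> 'a \<Rightarrow> nat" where
  "vertex_degree G S s = card (incident_edges G S s)"

definition irreducible_system :: "('a, 'b) monoid_scheme \<Rightarrow> 'a set \<Rightarrow> bool" where
  "irreducible_system G S \<longleftrightarrow>
     S \<noteq> {} \<and> (\<forall>s\<in>S. \<forall>t\<in>S. (s, t) \<in> {(a, b). {a, b} \<in> coxeter_graph G S}\<^sup>*)"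

definition cox_length :: "('a, 'b) monoid_scheme \<Rightarrow> 'a set \<Rightarrow> 'a \<Rightarrow> nat" where
  "cox_length G S w = (LEAST k. \<exists>u\<in>lists S. word_prod G u = w \<and> length u = k)"

definition reduced_expression :: "('a, 'b) monoid_scheme \<Rightarrow> 'a set \<Rightarrow> 'a \<Rightarrow> 'a list \<Rightarrow> bool" where
  "reduced_expression G S w u \<longleftrightarrow>
     u \<in> lists S \<and> word_prod G u = w \<and> length u = cox_length G S w"

definition longest_element :: "('a, 'b) monoid_scheme \<Rightarrow> 'a set \<Rightarrow> 'a" where
  "longest_element G S =
     (THE w. w \<in> carrier G \<and> (\<forall>v\<in>carrier G. cox_length G S v \<le> cox_length G S w))"

definition coxeter_element :: "('a, 'b) monoid_scheme \<Rightarrow> 'a set \<Rightarrow> 'a \<Rightarrow> bool" where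
  "coxeter_element G S w \<longleftrightarrow> (\<exists>u. distinct u \<and> set u = S \<and> w = word_prod G u)"

definition coxeter_triple :: "('a, 'b) monoid_scheme \<Rightarrow> 'a set \<Rightarrow> 'a list \<Rightarrow> bool" where
  "coxeter_triple G S c \<longleftrightarrow>
     coxeter_system G S \<and> finite (carrier G) \<and> irreducible_system G S \<and>
     (\<exists>w. coxeter_element G S w \<and> reduced_expression G S w c)"

text \<open>The Coxeter number is the order of any Coxeter element; all of them are conjugate.\<close>

definition coxeter_number :: "('a, 'b) monoid_scheme \<Rightarrow> 'a list \<Rightarrow> nat" where
  "coxeter_number G c = group.ord G (word_prod G c)"

section \<open>Labelling of the generators\<close>

text \<open>Systems whose Coxeter graph is a path on \<open>n - 1\<close> vertices, with a further vertex attached to the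
  \<open>r\<close>-th one, and all of whose edges are labelled 3.\<close>

definition fork_system :: "('a, 'b) monoid_scheme \<Rightarrow> 'a set \<Rightarrow> nat \<Rightarrow> bool" where
  "fork_system G S r \<longleftrightarrow>
     (\<exists>t. bij_betw t {1..card S} S \<and>
        (\<forall>i j. 1 \<le> i \<and> i < j \<and> j \<le> card S \<longrightarrow>
           coxeter_m G (t i) (t j) =
             (if (j = i + 1 \<and> j < card S) \<or> (i = r \<and> j = card S) then 3 else 2)))"

definition type_D :: "('a, 'b) monoid_scheme \<Rightarrow> 'a set \<Rightarrow> bool" where
  "type_D G S \<longleftrightarrow> card S \<ge> 4 \<and> fork_system G S (card S - 2)"

definition type_E :: "('a, 'b) monoid_scheme \<Rightarrow> 'a set \<Rightarrow> bool" where
  "type_E G S \<longleftrightarrow> card S \<in> {6, 7, 8} \<and> fork_system G S (card S - 3)"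

definition path_length :: "('a, 'b) monoid_scheme \<Rightarrow> 'a set \<Rightarrow> nat" where
  "path_length G S = (if type_D G S \<or> type_E G S then card S - 1 else card S)"

definition branch_index :: "('a, 'b) monoid_scheme \<Rightarrow> 'a set \<Rightarrow> nat" where
  "branch_index G S = (if type_D G S then card S - 2 else card S - 3)"

definition graph_path :: "('a, 'b) monoid_scheme \<Rightarrow> 'a set \<Rightarrow> 'a list \<Rightarrow> bool" where
  "graph_path G S vs \<longleftrightarrow>
     vs \<in> lists S \<and> distinct vs \<and> successively (\<lambda>a b. {a, b} \<in> coxeter_graph G S) vs"

definition longest_path :: "('a, 'b) monoid_scheme \<Rightarrow> 'a set \<Rightarrow> 'a list \<Rightarrow> bool" where
  "longest_path G S vs \<longleftrightarrow>
     graph_path G S vs \<and> (\<forall>us. graph_path G S us \<longrightarrow> length us \<le> length vs)"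

definition coxeter_labelling :: "('a, 'b) monoid_scheme \<Rightarrow> 'a set \<Rightarrow> (nat \<Rightarrow> 'a) \<Rightarrow> bool" where
  "coxeter_labelling G S s \<longleftrightarrow>
     bij_betw s {1..card S} S \<and>
     longest_path G S (map s [1..<Suc (path_length G S)]) \<and>
     (type_D G S \<or> type_E G S \<longrightarrow> {s (branch_index G S), s (card S)} \<in> coxeter_graph G S)"

section \<open>Letters, the natural partial order and the 2-cover\<close>

text \<open>A letter of a word is encoded as a pair \<open>(s, k)\<close>: the occurrence of the generator \<open>s\<close> that is
  preceded by exactly \<open>k\<close> others. Thus \<open>fst\<close> gives the generator of a letter, and the
  identification of the letters of two words by matching \<open>k\<close>-th occurrences is equality of
  encodings. As every generator occurs exactly once in \<open>c\<close>, the letters of the \<open>m\<close>-th copy of \<open>c\<close>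
  in \<open>c\<^sup>\<infinity>\<close>, counting from 0, are the pairs \<open>(s, m)\<close>.\<close>

type_synonym 'a letter = "'a \<times> nat"

definition letter :: "(nat \<Rightarrow> 'a) \<Rightarrow> nat \<Rightarrow> 'a letter" where
  "letter u i = (u i, card {j. j < i \<and> u j = u i})"

definition letters :: "'a list \<Rightarrow> 'a letter set" where
  "letters u = letter (\<lambda>i. u ! i) ` {..<length u}"

definition inf_word :: "'a list \<Rightarrow> nat \<Rightarrow> 'a" where
  "inf_word c i = c ! (i mod length c)"

definition natural_le :: "('a, 'b) monoid_scheme \<Rightarrow> (nat \<Rightarrow> 'a) \<Rightarrow> nat \<Rightarrow> nat \<Rightarrow> bool" where
  "natural_le G u i j \<longleftrightarrow>
     (\<exists>ks. ks \<noteq> [] \<and> hd ks = i \<and> last ks = j \<and>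
        successively (\<lambda>a b. a < b \<and> noncomm G (u a) (u b)) ks)"

definition natural_covers :: "('a, 'b) monoid_scheme \<Rightarrow> (nat \<Rightarrow> 'a) \<Rightarrow> nat \<Rightarrow> nat \<Rightarrow> bool" where
  "natural_covers G u i j \<longleftrightarrow>
     natural_le G u i j \<and> i \<noteq> j \<and>
     \<not> (\<exists>k. k \<noteq> i \<and> k \<noteq> j \<and> natural_le G u i k \<and> natural_le G u k j)"

definition hasse_edges :: "('a, 'b) monoid_scheme \<Rightarrow> (nat \<Rightarrow> 'a) \<Rightarrow> ('a letter \<times> 'a letter) set" where
  "hasse_edges G u = {(letter u i, letter u j) | i j. natural_covers G u i j}"

definition sorting_positions :: "('a, 'b) monoid_scheme \<Rightarrow> 'a set \<Rightarrow> 'a list \<Rightarrow> nat list \<Rightarrow> bool" where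
  "sorting_positions G S c ps \<longleftrightarrow>
     sorted_wrt (<) ps \<and> reduced_expression G S (longest_element G S) (map (inf_word c) ps)"

definition sorting_word :: "('a, 'b) monoid_scheme \<Rightarrow> 'a set \<Rightarrow> 'a list \<Rightarrow> 'a list" where
  "sorting_word G S c =
     map (inf_word c)
       (THE ps. sorting_positions G S c ps \<and>
          (\<forall>qs. sorting_positions G S c qs \<longrightarrow> qs = ps \<or> (ps, qs) \<in> lexord less_than))"

definition psi :: "('a, 'b) monoid_scheme \<Rightarrow> 'a set \<Rightarrow> 'a \<Rightarrow> 'a" where
  "psi G S w =
     inv\<^bsub>G\<^esub> (longest_element G S) \<otimes>\<^bsub>G\<^esub> w \<otimes>\<^bsub>G\<^esub> longest_element G S"

definition pr :: "nat \<Rightarrow> 'a letter \<Rightarrow> 'a letter" where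
  "pr h \<sigma> = (fst \<sigma>, snd \<sigma> mod h)"

text \<open>A directed graph is given by its vertices and its edges.\<close>

type_synonym 'v dgraph = "'v set \<times> ('v \<times> 'v) set"

definition two_cover :: "('a, 'b) monoid_scheme \<Rightarrow> 'a set \<Rightarrow> 'a list \<Rightarrow> 'a letter dgraph" where
  "two_cover G S c =
     (letters (sorting_word G S c @ map (psi G S) (sorting_word G S c)),
      map_prod (pr (coxeter_number G c)) (pr (coxeter_number G c)) ` hasse_edges G (inf_word c))"

definition cycle_edges :: "'v list \<Rightarrow> ('v \<times> 'v) set" where
  "cycle_edges vs = {(vs ! i, vs ! (Suc i mod length vs)) | i. i < length vs}"

definition directed_cycle :: "'v dgraph \<Rightarrow> 'v list \<Rightarrow> bool" where
  "directed_cycle D vs \<longleftrightarrow> vs \<noteq> [] \<and> distinct vs \<and> cycle_edges vs \<subseteq> snd D"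

definition cut_path :: "'v dgraph \<Rightarrow> ('v \<times> 'v) set \<Rightarrow> bool" where
  "cut_path D \<kappa> \<longleftrightarrow>
     \<kappa> \<subseteq> snd D \<and> (\<forall>vs. directed_cycle D vs \<longrightarrow> (\<exists>!\<epsilon>. \<epsilon> \<in> \<kappa> \<and> \<epsilon> \<in> cycle_edges vs))"

text \<open>An edge \<open>\<epsilon>\<close> of the 2-cover lies over the edge \<open>e\<close> of the Coxeter graph; \<open>cut_edge \<kappa> e\<close> is the
  edge of \<open>\<kappa>\<close> over \<open>e\<close>, if it is unique.\<close>

definition lies_over :: "'a letter \<times> 'a letter \<Rightarrow> 'a set \<Rightarrow> bool" where
  "lies_over \<epsilon> e \<longleftrightarrow> {fst (fst \<epsilon>), fst (snd \<epsilon>)} = e"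

definition cut_edge :: "('a letter \<times> 'a letter) set \<Rightarrow> 'a set \<Rightarrow> 'a letter \<times> 'a letter" where
  "cut_edge \<kappa> e = (THE \<epsilon>. \<epsilon> \<in> \<kappa> \<and> lies_over \<epsilon> e)"

section \<open>The drawing on the cylinder and its tiles\<close>

definition precedes :: "'a list \<Rightarrow> 'a \<Rightarrow> 'a \<Rightarrow> bool" where
  "precedes c a b \<longleftrightarrow> (\<exists>i j. i < j \<and> j < length c \<and> c ! i = a \<and> c ! j = b)"

definition step :: "'a list \<Rightarrow> 'a \<Rightarrow> 'a \<Rightarrow> real" where
  "step c a b = (if precedes c a b then 1 else - 1)"

text \<open>The first copy of \<open>s\<^sub>j\<close>, \<open>1 \<le> j \<le> p\<close>; the value at 0 is a dummy.\<close>

fun path_point :: "'a list \<Rightarrow> (nat \<Rightarrow> 'a) \<Rightarrow> nat \<Rightarrow> real \<times> real" where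
  "path_point c s 0 = (0, 0)"
| "path_point c s (Suc 0) = (0, 0)"
| "path_point c s (Suc (Suc j)) =
     path_point c s (Suc j) + (step c (s (Suc j)) (s (Suc (Suc j))), 1)"

definition first_copy_point ::
  "('a, 'b) monoid_scheme \<Rightarrow> 'a set \<Rightarrow> 'a list \<Rightarrow> (nat \<Rightarrow> 'a) \<Rightarrow> nat \<Rightarrow> real \<times> real" where
  "first_copy_point G S c s j =
     (if j \<le> path_length G S then path_point c s j
      else path_point c s (branch_index G S) + (step c (s (branch_index G S)) (s j), 0))"

definition letter_point ::
  "('a, 'b) monoid_scheme \<Rightarrow> 'a set \<Rightarrow> 'a list \<Rightarrow> (nat \<Rightarrow> 'a) \<Rightarrow> 'a letter \<Rightarrow> real \<times> real" where
  "letter_point G S c s \<sigma> =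
     first_copy_point G S c s (the_inv_into {1..card S} s (fst \<sigma>)) + (2 * real (snd \<sigma>), 0)"

definition letter_segment ::
  "('a, 'b) monoid_scheme \<Rightarrow> 'a set \<Rightarrow> 'a list \<Rightarrow> (nat \<Rightarrow> 'a) \<Rightarrow> 'a letter \<times> 'a letter
     \<Rightarrow> (real \<times> real) set" where
  "letter_segment G S c s \<epsilon> =
     closed_segment (letter_point G S c s (fst \<epsilon>)) (letter_point G S c s (snd \<epsilon>))"

definition cylinder :: "(complex \<times> real) set" where
  "cylinder = sphere 0 1 \<times> UNIV"

text \<open>Two points of the plane have the same image iff they agree up to adding a multiple of \<open>2h\<close> to
  the first coordinate.\<close>

definition wrap :: "nat \<Rightarrow> real \<times> real \<Rightarrow> complex \<times> real" where
  "wrap h z = (cis (pi * fst z / real h), snd z)"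

definition drawing ::
  "('a, 'b) monoid_scheme \<Rightarrow> 'a set \<Rightarrow> 'a list \<Rightarrow> (nat \<Rightarrow> 'a) \<Rightarrow> (complex \<times> real) set" where
  "drawing G S c s =
     wrap (coxeter_number G c) `
       (letter_point G S c s ` range (letter (inf_word c)) \<union>
        (\<Union>\<epsilon>\<in>hasse_edges G (inf_word c). letter_segment G S c s \<epsilon>))"

text \<open>The arc representing an edge of the 2-cover. All edges of the Hasse diagram of \<open>c\<^sup>\<infinity>\<close> that
  project to the given edge have the same image on the cylinder.\<close>

definition edge_arc ::
  "('a, 'b) monoid_scheme \<Rightarrow> 'a set \<Rightarrow> 'a list \<Rightarrow> (nat \<Rightarrow> 'a) \<Rightarrow> 'a letter \<times> 'a letter
     \<Rightarrow> (complex \<times> real) set" where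
  "edge_arc G S c s \<epsilon> =
     wrap (coxeter_number G c) `
       (\<Union>\<eta>\<in>{\<eta> \<in> hasse_edges G (inf_word c).
              map_prod (pr (coxeter_number G c)) (pr (coxeter_number G c)) \<eta> = \<epsilon>}.
          letter_segment G S c s \<eta>)"

definition tile ::
  "('a, 'b) monoid_scheme \<Rightarrow> 'a set \<Rightarrow> 'a list \<Rightarrow> (nat \<Rightarrow> 'a) \<Rightarrow> (complex \<times> real) set \<Rightarrow> bool" where
  "tile G S c s T \<longleftrightarrow> T \<in> components (cylinder - drawing G S c s) \<and> bounded T"

text \<open>The boundary is taken in the cylinder, not in the ambient space.\<close>

definition tile_boundary :: "(complex \<times> real) set \<Rightarrow> (complex \<times> real) set" where
  "tile_boundary T = top_of_set cylinder frontier_of closure T"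

end

theory Submission
  imports Defs
begin

text \<open>
  Give the letter \<open>(s\<^sub>j, m)\<close> the abscissa of its point in the plane. Then the edges of the Hasse
  diagram are exactly the pairs of letters of non-commuting generators whose abscissas differ by
  1. So all edges of the 2-cover over an edge \<open>{s\<^sub>i, s\<^sub>j}\<close> of the Coxeter graph form one zigzag
  cycle, of which a cut path contains exactly one edge. If \<open>s\<^sub>j\<close> has further neighbours, this
  cycle can be rerouted through one of them between two consecutive copies of \<open>s\<^sub>j\<close>; hence all
  edges of the cut path around \<open>s\<^sub>j\<close> lie between the same two copies, that is, on the boundary of
  the same diamond, which the edges at \<open>s\<^sub>n\<close> divide into two triangles if \<open>s\<^sub>j\<close> is the branch
  vertex.

  Such abscissas exist because the Coxeter graph of a finite group has no cycles. For this, and to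
  see that a reduced word of a Coxeter element contains every generator once, the group acts on
  the functions on \<open>S\<close> by a reflection representation whose Cartan matrix need not be symmetric:
  only products of opposite entries are prescribed, so the two entries at one edge of a cycle can
  be scaled by 2 and 1/2, and then the product of the generators around the cycle acts with
  infinite order.
\<close>

section \<open>A deformed reflection representation\<close>

text \<open>On a tree the factors 2 and 1/2 could be removed by rescaling the simple roots on one
  side of the edge; around a cycle they cannot, and one tour then doubles a coordinate. Acyclicity,
  applied to the labelled path and to that path closed up by the remaining vertex, determines the
  Coxeter graph from the labelling.

  The delicate half of (ii) and (iii) is uniqueness: a tile is a component of the complement of an
  infinite drawing wrapped up, known only through arcs in its boundary. Tiles are not enumerated. A
  tile is compared with the horizontal circle at the height of \<open>s j\<close>. Away from the
  branch vertex, a tile touching an edge below and one above must cross that circle, whose points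
  off the drawing all lie in diamonds. At the branch vertex the circle belongs to the drawing, so
  the tile stays on one side.

  The boundary is the frontier of the closure, so existence needs points outside the closed cell
  near each rim point, although the cell might meet its own translates on the cylinder. Either half
  of a block may hold the cut edge; uniqueness sees only that its midpoint has horizontal distance
  1/2 from the centre of the block.\<close>

definition reflect :: "'a set \<Rightarrow> ('a \<Rightarrow> 'a \<Rightarrow> real) \<Rightarrow> 'a \<Rightarrow> ('a \<Rightarrow> real) \<Rightarrow> 'a \<Rightarrow> real" where
  "reflect S a s v = v(s := (\<Sum>t\<in>S - {s}. a s t * v t) - v s)"

text \<open>Vectors are given by coordinates in the basis of simple roots; \<open>s\<close> sends
  the root of \<open>t\<close> to itself plus \<open>a s t\<close> times the root of
  \<open>s\<close>. With \<open>foldr\<close> the last letter acts first, so this is a left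
  action.\<close>

definition word_act :: "'a set \<Rightarrow> ('a \<Rightarrow> 'a \<Rightarrow> real) \<Rightarrow> 'a list \<Rightarrow> ('a \<Rightarrow> real) \<Rightarrow> 'a \<Rightarrow> real" where
  "word_act S a u = foldr (reflect S a) u"

lemma word_act_Nil [simp]: "word_act S a [] v = v"
  by (simp add: word_act_def)

lemma word_act_Cons [simp]: "word_act S a (s # u) v = reflect S a s (word_act S a u v)"
  by (simp add: word_act_def)

lemma word_act_append: "word_act S a (u @ w) v = word_act S a u (word_act S a w v)"
  by (simp add: word_act_def)

lemma word_act_replicate: "word_act S a (concat (replicate k u)) v = (word_act S a u ^^ k) v"
  by (induction k) (simp_all add: word_act_append)

lemma reflect_other [simp]: "t \<noteq> s \<Longrightarrow> reflect S a s v t = v t"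
  by (simp add: reflect_def)

lemma reflect_same: "reflect S a s v s = (\<Sum>t\<in>S - {s}. a s t * v t) - v s"
  by (simp add: reflect_def)

lemma reflect_reflect [simp]: "reflect S a s (reflect S a s v) = v"
proof -
  have "(\<Sum>t\<in>S - {s}. a s t * reflect S a s v t) = (\<Sum>t\<in>S - {s}. a s t * v t)"
    by (intro sum.cong) auto
  then show ?thesis
    by (auto simp: fun_eq_iff reflect_def)
qed

lemma word_act_notin: "s \<notin> set u \<Longrightarrow> word_act S a u v s = v s"
  by (induction u) auto

lemma word_act_rev: "word_act S a u (word_act S a (rev u) v) = v"
proof (induction u arbitrary: v)
  case (Cons s u)
  then show ?case
    by (simp add: word_act_append)
qed simp

section \<open>Rank two: products of two reflections as rotations of finite order\<close>

lemma chebyshev_recurrence_solution: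
  fixes z :: "nat \<Rightarrow> real"
  assumes rec: "\<And>k. z (Suc (Suc k)) = 2 * cos \<theta> * z (Suc k) - z k"
  shows "sin \<theta> * z k = sin (real k * \<theta>) * z 1 - sin ((real k - 1) * \<theta>) * z 0"
proof (induction k rule: less_induct)
  case (less k)
  show ?case
  proof (cases k)
    case 0
    then show ?thesis by simp
  next
    case (Suc l)
    show ?thesis
    proof (cases l)
      case 0
      then show ?thesis using Suc by simp
    next
      case (Suc j)
      with \<open>k = Suc l\<close> have k: "k = Suc (Suc j)" by simp
      have trig: "sin (x + \<theta>) = 2 * cos \<theta> * sin x - sin (x - \<theta>)" for x :: real
        by (simp add: sin_add sin_diff)
      have 1: "sin \<theta> * z (Suc j) = sin (real (Suc j) * \<theta>) * z 1 - sin (real j * \<theta>) * z 0"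
        using less.IH[of "Suc j"] k by simp
      have 2: "sin \<theta> * z j = sin (real j * \<theta>) * z 1 - sin ((real j - 1) * \<theta>) * z 0"
        using less.IH[of j] k by simp
      have "sin \<theta> * z k = 2 * cos \<theta> * (sin \<theta> * z (Suc j)) - sin \<theta> * z j"
        by (simp add: k rec algebra_simps)
      also have "\<dots> = (2 * cos \<theta> * sin (real (Suc j) * \<theta>) - sin (real j * \<theta>)) * z 1
          - (2 * cos \<theta> * sin (real j * \<theta>) - sin ((real j - 1) * \<theta>)) * z 0"
        unfolding 1 2 by (simp add: algebra_simps)
      also have "\<dots> = sin (real k * \<theta>) * z 1 - sin ((real k - 1) * \<theta>) * z 0"
      proof -
        have "real (Suc j) * \<theta> + \<theta> = real k * \<theta>" "real (Suc j) * \<theta> - \<theta> = real j * \<theta>"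
          "real j * \<theta> + \<theta> = (real k - 1) * \<theta>" "real j * \<theta> - \<theta> = (real j - 1) * \<theta>"
          by (simp_all add: k algebra_simps)
        then show ?thesis
          using trig[of "real (Suc j) * \<theta>"] trig[of "real j * \<theta>"] by simp
      qed
      finally show ?thesis .
    qed
  qed
qed

text \<open>The recurrence is that of the powers of a matrix with determinant 1 and trace
  \<open>2 * cos \<theta>\<close>. Its solution carries the factor \<open>sin \<theta>\<close>,
  which \<open>m \<ge> 3\<close> makes positive and hence cancellable.\<close>

lemma chebyshev_recurrence_periodic:
  fixes z :: "nat \<Rightarrow> real"
  assumes rec: "\<And>k. z (Suc (Suc k)) = 2 * cos (2 * pi / real m) * z (Suc k) - z k" and m: "m \<ge> 3"
  shows "z m = z 0"
proof -
  define \<theta> where "\<theta> = 2 * pi / real m"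
  have "0 < \<theta>" "\<theta> < pi"
    using m by (simp_all add: \<theta>_def field_simps)
  then have "sin \<theta> > 0" by (rule sin_gt_zero)
  have "real m * \<theta> = 2 * pi"
    using m by (simp add: \<theta>_def)
  then have "(real m - 1) * \<theta> = 2 * pi - \<theta>"
    by (simp add: algebra_simps)
  then have "sin \<theta> * z m = sin \<theta> * z 0"
    using chebyshev_recurrence_solution[of z \<theta> m] rec \<open>real m * \<theta> = 2 * pi\<close>
    by (simp add: \<theta>_def[symmetric] sin_diff)
  then show ?thesis
    using \<open>sin \<theta> > 0\<close> by simp
qed

text \<open>An affine map of the plane whose linear part is a rotation by \<open>2 \<pi> / m\<close> in a suitable basis;
  it has a fixed point as \<open>a * b \<noteq> 4\<close>.\<close>

lemma dihedral_orbit_periodic: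
  fixes P Q :: "nat \<Rightarrow> real"
  assumes Q: "\<And>k. Q (Suc k) = b * P k + B - Q k"
    and P: "\<And>k. P (Suc k) = a * Q (Suc k) + A - P k"
    and ab: "a * b = (2 * cos (pi / real m))\<^sup>2" and m: "m \<ge> 3"
  shows "P m = P 0 \<and> Q m = Q 0"
proof -
  have "0 < pi / real m" "pi / real m < pi"
    using m by (simp_all add: field_simps)
  then have "sin (pi / real m) > 0" by (rule sin_gt_zero)
  moreover have "4 - a * b = 4 * (sin (pi / real m))\<^sup>2"
    unfolding ab by (simp add: power_mult_distrib sin_squared_eq)
  ultimately have D: "4 - a * b \<noteq> 0" by simp
  \<comment> \<open>The fixed point of both affine reflections; \<open>4 - a * b\<close> is the
    determinant of the linear system \<open>pq\<close>.\<close>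
  define p where "p = (2 * A + a * B) / (4 - a * b)"
  define q where "q = (2 * B + b * A) / (4 - a * b)"
  have pq: "2 * p = a * q + A" "2 * q = b * p + B"
    using D by (simp_all add: p_def q_def divide_simps) (simp_all add: algebra_simps)
  \<comment> \<open>The trace of the linear part of the composed map is
    \<open>a * b - 2\<close>.\<close>
  have cos2: "2 * cos (2 * pi / real m) = a * b - 2"
    using cos_double_cos[of "pi / real m"] ab by (simp add: power2_eq_square)
  define x where "x k = P k - p" for k
  define y where "y k = Q k - q" for k
  have y: "y (Suc k) = b * x k - y k" for k
    using pq(2) by (simp add: y_def x_def Q algebra_simps)
  have x: "x (Suc k) = a * y (Suc k) - x k" for k
  proof -
    have "x (Suc k) = a * Q (Suc k) + A - P k - p"
      by (simp add: x_def P)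
    then show ?thesis
      using pq(1) by (simp add: y_def x_def algebra_simps)
  qed
  have "x (Suc (Suc k)) = 2 * cos (2 * pi / real m) * x (Suc k) - x k" for k
    unfolding cos2 x[of "Suc k"] y[of "Suc k"] x[of k] by (simp add: algebra_simps)
  then have "x m = x 0"
    using m by (rule chebyshev_recurrence_periodic)
  moreover have "y (Suc (Suc k)) = 2 * cos (2 * pi / real m) * y (Suc k) - y k" for k
    unfolding cos2 y[of "Suc k"] x[of k] y[of k] by (simp add: algebra_simps)
  then have "y m = y 0"
    using m by (rule chebyshev_recurrence_periodic)
  ultimately show ?thesis
    by (simp add: x_def y_def)
qed

text \<open>Only the coordinates \<open>s\<close> and \<open>t\<close> move; all others enter as the
  constants \<open>A\<close> and \<open>B\<close>, which makes the planar map affine. For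
  \<open>m = 2\<close> a vanishing product alone would leave room for a nontrivial unipotent square,
  so both entries have to vanish.\<close>

lemma reflect_pair_periodic:
  fixes a :: "'a \<Rightarrow> 'a \<Rightarrow> real"
  assumes fin: "finite S" and st: "s \<in> S" "t \<in> S" "s \<noteq> t"
    and ab: "a s t * a t s = (2 * cos (pi / real m))\<^sup>2"
    and m: "m \<ge> 3 \<or> m = 2 \<and> a s t = 0 \<and> a t s = 0"
  shows "(word_act S a [s, t] ^^ m) v = v"
proof -
  define w where "w k = (word_act S a [s, t] ^^ k) v" for k
  have w_Suc: "w (Suc k) = reflect S a s (reflect S a t (w k))" for k
    by (simp add: w_def)
  have w_other: "w k u = v u" if "u \<noteq> s" "u \<noteq> t" for k u
    using that by (induction k) (simp_all add: w_Suc, simp add: w_def)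
  define A where "A = (\<Sum>u\<in>S - {s, t}. a s u * v u)"
  define B where "B = (\<Sum>u\<in>S - {s, t}. a t u * v u)"
  have split: "(\<Sum>u\<in>S - {x}. f u) = f y + (\<Sum>u\<in>S - {x, y}. f u)"
    if "y \<in> S" "y \<noteq> x" for x y and f :: "'a \<Rightarrow> real"
    using that fin sum.remove[of "S - {x}" y f] by (simp flip: Diff_insert2)
  have split_s: "(\<Sum>u\<in>S - {s}. a s u * f u) = a s t * f t + (\<Sum>u\<in>S - {s, t}. a s u * f u)" for f
    using st by (intro split) auto
  have split_t: "(\<Sum>u\<in>S - {t}. a t u * f u) = a t s * f s + (\<Sum>u\<in>S - {s, t}. a t u * f u)" for f
    using st split[of s t] by (simp add: insert_commute)
  have B: "(\<Sum>u\<in>S - {s, t}. a t u * w k u) = B" for k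
    unfolding B_def by (rule sum.cong) (simp_all add: w_other)
  have Q: "w (Suc k) t = a t s * w k s + B - w k t" for k
    using st B[of k] by (simp add: w_Suc reflect_same split_t)
  have P: "w (Suc k) s = a s t * w (Suc k) t + A - w k s" for k
  proof -
    have "(\<Sum>u\<in>S - {s, t}. a s u * reflect S a t (w k) u) = A"
      unfolding A_def by (rule sum.cong) (simp_all add: w_other)
    then show ?thesis
      using st by (simp add: w_Suc reflect_same split_s)
  qed
  have "w m s = w 0 s \<and> w m t = w 0 t"
  proof (cases "m \<ge> 3")
    case True
    show ?thesis
      by (rule dihedral_orbit_periodic[of "\<lambda>k. w k t" "a t s" "\<lambda>k. w k s" B "a s t" A, OF Q P ab
          True])
  next
    case False
    with m have m2: "m = Suc (Suc 0)" and a0: "a s t = 0" "a t s = 0" by auto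
    show ?thesis
      using Q P unfolding m2 a0 by simp
  qed
  then have "w m u = v u" for u
    using w_other[of u m] by (cases "u = s \<or> u = t") (auto simp: w_def)
  then show ?thesis
    by (auto simp: w_def)
qed

section \<open>Finite Coxeter systems\<close>

locale finite_coxeter_system = group G for G :: "('a, 'b) monoid_scheme" (structure) +
  fixes S :: "'a set"
  assumes cox: "coxeter_system G S" and fin_carrier: "finite (carrier G)"
begin

section \<open>Words, products and orders of pairs of generators\<close>

lemma S_carrier: "S \<subseteq> carrier G"
  using cox by (simp add: coxeter_system_def)

lemma finite_S: "finite S"
  using S_carrier fin_carrier finite_subset by blast

lemma word_prod_Nil [simp]: "word_prod G [] = \<one>"
  by (simp add: word_prod_def)

lemma word_prod_Cons [simp]: "word_prod G (a # u) = a \<otimes> word_prod G u"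
  by (simp add: word_prod_def)

lemma word_prod_closed [simp]: "u \<in> lists S \<Longrightarrow> word_prod G u \<in> carrier G"
  using S_carrier by (induction u) auto

lemma word_prod_append:
  "u \<in> lists S \<Longrightarrow> w \<in> lists S \<Longrightarrow> word_prod G (u @ w) = word_prod G u \<otimes> word_prod G w"
  using S_carrier by (induction u) (auto simp: m_assoc subset_iff)

lemma word_prod_replicate:
  "u \<in> lists S \<Longrightarrow> word_prod G (concat (replicate k u)) = word_prod G u [^] k"
proof (induction k)
  case (Suc k)
  have "concat (replicate k u) \<in> lists S"
    using Suc.prems by auto
  with Suc show ?case
    using nat_pow_Suc2[of "word_prod G u" k] by (simp add: word_prod_append)
qed simp

lemma involution: "s \<in> S \<Longrightarrow> s \<otimes> s = \<one>"
proof -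
  assume s: "s \<in> S"
  then have "s \<in> carrier G" "ord s = 2"
    using S_carrier cox by (auto simp: coxeter_system_def)
  then show "s \<otimes> s = \<one>"
    using pow_ord_eq_1[of s] by (simp add: numeral_2_eq_2)
qed

lemma coxeter_m_pos: "s \<in> S \<Longrightarrow> t \<in> S \<Longrightarrow> coxeter_m G s t > 0"
  using ord_ge_1[OF fin_carrier, of "s \<otimes> t"] S_carrier by (force simp: coxeter_m_def)

lemma coxeter_m_commute: "s \<in> S \<Longrightarrow> t \<in> S \<Longrightarrow> coxeter_m G s t = coxeter_m G t s"
proof -
  assume st: "s \<in> S" "t \<in> S"
  then have c: "s \<in> carrier G" "t \<in> carrier G" using S_carrier by auto
  have "inv (s \<otimes> t) = t \<otimes> s"
    using c st involution[of s] involution[of t] inv_equality[of s s] inv_equality[of t t]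
    by (simp add: inv_mult_group)
  then show ?thesis
    using c ord_inv[of "s \<otimes> t"] by (simp add: coxeter_m_def)
qed

lemma coxeter_m_eq_1_iff: "s \<in> S \<Longrightarrow> t \<in> S \<Longrightarrow> coxeter_m G s t = 1 \<longleftrightarrow> s = t"
proof -
  assume st: "s \<in> S" "t \<in> S"
  then have c: "s \<in> carrier G" "t \<in> carrier G" using S_carrier by auto
  have "s \<otimes> t = \<one> \<longleftrightarrow> s = t"
    using c st involution[of s] involution[of t] inv_equality[of s t] inv_equality[of t t] by auto
  then show ?thesis
    using c ord_eq_1[of "s \<otimes> t"] by (simp add: coxeter_m_def)
qed

lemma noncomm_iff_coxeter_m: "s \<in> S \<Longrightarrow> t \<in> S \<Longrightarrow> noncomm G s t \<longleftrightarrow> coxeter_m G s t \<ge> 3"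
proof -
  assume st: "s \<in> S" "t \<in> S"
  then have c: "s \<in> carrier G" "t \<in> carrier G" using S_carrier by auto
  have "s \<otimes> t = t \<otimes> s \<longleftrightarrow> (s \<otimes> t) \<otimes> (s \<otimes> t) = \<one>"
  proof -
    have "inv (s \<otimes> t) = t \<otimes> s"
      using c st involution[of s] involution[of t] inv_equality[of s s] inv_equality[of t t]
    by (simp add: inv_mult_group)
    then show ?thesis
      using c by (metis inv_equality m_closed r_inv)
  qed
  also have "\<dots> \<longleftrightarrow> (s \<otimes> t) [^] (2 :: nat) = \<one>"
    using c by (simp add: numeral_2_eq_2)
  also have "\<dots> \<longleftrightarrow> coxeter_m G s t dvd 2"
    using c by (simp add: pow_eq_id coxeter_m_def)
  also have "\<dots> \<longleftrightarrow> \<not> coxeter_m G s t \<ge> 3"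
  proof -
    have "m dvd 2 \<longleftrightarrow> m < 3" if "m > 0" for m :: nat
    proof
      assume "m dvd 2"
      then have "m \<le> 2" by (rule dvd_imp_le) simp
      then show "m < 3" by simp
    next
      assume "m < 3"
      then have "m = 1 \<or> m = 2" using that by auto
      then show "m dvd 2" by auto
    qed
    then show ?thesis
      using coxeter_m_pos[OF st] by auto
  qed
  finally show ?thesis
    by (auto simp: noncomm_def)
qed

lemma noncomm_sym: "noncomm G s t \<longleftrightarrow> noncomm G t s"
  by (auto simp: noncomm_def)

lemma coxeter_graph_iff: "{s, t} \<in> coxeter_graph G S \<longleftrightarrow> s \<in> S \<and> t \<in> S \<and> noncomm G s t"
  by (auto simp: coxeter_graph_def doubleton_eq_iff noncomm_def)

text \<open>The numbers \<open>a s t\<close> are the negatives of the entries of a Cartan matrix. It need not be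
  symmetric: only the products \<open>a s t * a t s\<close> are prescribed.\<close>

definition cartan :: "('a \<Rightarrow> 'a \<Rightarrow> real) \<Rightarrow> bool" where
  "cartan a \<longleftrightarrow> (\<forall>s\<in>S. \<forall>t\<in>S. s \<noteq> t \<longrightarrow>
     a s t * a t s = (2 * cos (pi / real (coxeter_m G s t)))\<^sup>2 \<and>
     (coxeter_m G s t = 2 \<longrightarrow> a s t = 0))"

lemma word_act_cong:
  assumes a: "cartan a" and uw: "coxeter_cong G S u w"
  shows "word_act S a u v = word_act S a w v"
  using uw
proof (induction arbitrary: v)
  case (relation s t)
  show ?case
  proof (cases "s = t")
    case True
    then have "coxeter_m G s t = 1"
      using relation coxeter_m_eq_1_iff by simp
    then show ?thesis using True by simp
  next
    case False
    then have "coxeter_m G s t \<noteq> 1"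
      using relation coxeter_m_eq_1_iff by simp
    then have "coxeter_m G s t \<ge> 3 \<or> coxeter_m G s t = 2"
      using coxeter_m_pos[OF relation] by linarith
    then have "(word_act S a [s, t] ^^ coxeter_m G s t) v = v"
      using a relation False finite_S coxeter_m_commute[OF relation]
      unfolding cartan_def by (intro reflect_pair_periodic) auto
    then show ?thesis
      by (simp only: word_act_replicate word_act_Nil)
  qed
qed (simp_all add: word_act_append)

text \<open>The presentation clause of \<open>coxeter_system\<close> enters here: it turns an action
  of words into one of group elements.\<close>

lemma word_act_eq:
  assumes "cartan a" "u \<in> lists S" "w \<in> lists S" "word_prod G u = word_prod G w"
  shows "word_act S a u v = word_act S a w v"
  using assms cox word_act_cong unfolding coxeter_system_def by blast

text \<open>Without the first factor this is the symmetric matrix of the geometric representation.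
  Since 2 and 1/2 multiply to 1, the products prescribed by \<open>cartan\<close> are
  unaffected.\<close>

definition twisted_cartan :: "'a \<Rightarrow> 'a \<Rightarrow> 'a \<Rightarrow> 'a \<Rightarrow> real" where
  "twisted_cartan p q s t =
     (if s = p \<and> t = q then 2 else if s = q \<and> t = p then 1 / 2 else 1) *
     (2 * cos (pi / real (coxeter_m G s t)))"

lemma cartan_twisted: "p \<noteq> q \<Longrightarrow> cartan (twisted_cartan p q)"
  by (auto simp: cartan_def twisted_cartan_def power2_eq_square coxeter_m_commute)

lemma two_cos_ge_0: "m \<ge> 2 \<Longrightarrow> 2 * cos (pi / real m) \<ge> 0"
proof -
  assume "m \<ge> 2"
  then have "pi / real m \<le> pi / 2" "pi / real m \<ge> 0"
    by (simp_all add: field_simps)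
  then show ?thesis
    using pi_gt_zero by (intro mult_nonneg_nonneg cos_ge_zero) linarith+
qed

lemma two_cos_ge_1: "m \<ge> 3 \<Longrightarrow> 2 * cos (pi / real m) \<ge> 1"
proof -
  assume "m \<ge> 3"
  then have "cos (pi / 3) \<le> cos (pi / real m)"
    by (intro cos_monotone_0_pi_le) (auto simp: field_simps)
  then show ?thesis by (simp add: cos_60)
qed

lemma twisted_cartan_nonneg:
  assumes "s \<in> S" "t \<in> S" "s \<noteq> t"
  shows "twisted_cartan p q s t \<ge> 0"
proof -
  have "coxeter_m G s t \<ge> 2"
    using assms coxeter_m_pos[of s t] coxeter_m_eq_1_iff[of s t] by linarith
  then show ?thesis
    unfolding twisted_cartan_def by (intro mult_nonneg_nonneg two_cos_ge_0) auto
qed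

lemma twisted_cartan_ge:
  assumes "s \<in> S" "t \<in> S" "noncomm G s t"
  shows "twisted_cartan p q s t \<ge>
    (if s = p \<and> t = q then 2 else if s = q \<and> t = p then 1 / 2 else 1)"
proof -
  have "2 * cos (pi / real (coxeter_m G s t)) \<ge> 1"
    using assms by (intro two_cos_ge_1) (simp add: noncomm_iff_coxeter_m)
  then have "x \<le> x * (2 * cos (pi / real (coxeter_m G s t)))" if "x \<ge> 0" for x :: real
    using that mult_left_mono[of 1 _ x] by simp
  then show ?thesis
    unfolding twisted_cartan_def by simp
qed

text \<open>A word avoiding \<open>s\<close> fixes the \<open>s\<close>-coordinate of every vector.
  But \<open>u\<close> contains \<open>s\<close> just once, and on the preimage \<open>v\<close> of
  the simple root of \<open>s\<close> under \<open>u2\<close> it changes that coordinate from 1 to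
  -1.\<close>

lemma word_support:
  assumes u: "distinct u" "set u = S" and c: "c \<in> lists S" and eq: "word_prod G c = word_prod G u"
  shows "set c = S"
proof (rule ccontr)
  assume "set c \<noteq> S"
  then obtain s where s: "s \<in> S" "s \<notin> set c"
    using c by auto
  obtain u1 u2 where u12: "u = u1 @ s # u2"
    using s u split_list[of s u] by auto
  then have notin: "s \<notin> set u1" "s \<notin> set u2"
    using u by auto
  define a :: "'a \<Rightarrow> 'a \<Rightarrow> real" where "a s t = 2 * cos (pi / real (coxeter_m G s t))" for s t
  have a: "cartan a"
    by (auto simp: cartan_def a_def power2_eq_square coxeter_m_commute)
  define \<alpha> :: "'a \<Rightarrow> real" where "\<alpha> t = (if t = s then 1 else 0)" for t
  define v where "v = word_act S a (rev u2) \<alpha>"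
  have "word_act S a c v s = word_act S a u v s"
    using word_act_eq[OF a c _ eq, of v] u by (simp add: in_lists_conv_set)
  moreover have "word_act S a c v s = 1"
    using s notin by (simp add: word_act_notin v_def \<alpha>_def)
  moreover have "word_act S a u v s = - 1"
  proof -
    have "word_act S a u v s = reflect S a s (word_act S a u2 v) s"
      using notin by (simp add: u12 word_act_append word_act_notin)
    also have "word_act S a u2 v = \<alpha>"
      by (simp add: v_def word_act_rev)
    also have "reflect S a s \<alpha> s = - 1"
      by (simp add: reflect_same \<alpha>_def)
    finally show ?thesis .
  qed
  ultimately show False by simp
qed

text \<open>A priori \<open>c\<close> is just some reduced word of the Coxeter element. It uses all
  of \<open>S\<close> by \<open>word_support\<close>, and being no longer than \<open>card S\<close>
  it cannot repeat a letter.\<close>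

lemma coxeter_word:
  assumes w: "coxeter_element G S w" and c: "reduced_expression G S w c"
  shows "distinct c" "set c = S"
proof -
  obtain u where u: "distinct u" "set u = S" "w = word_prod G u"
    using w by (auto simp: coxeter_element_def)
  have c': "c \<in> lists S" "word_prod G c = word_prod G u" "length c = cox_length G S w"
    using c u by (auto simp: reduced_expression_def)
  show "set c = S"
    using word_support[OF u(1,2) c'(1,2)] .
  have "cox_length G S w \<le> length u"
    unfolding cox_length_def using u by (intro Least_le) auto
  also have "length u = card S"
    using u distinct_card by fastforce
  finally have "length c \<le> card (set c)"
    using c' \<open>set c = S\<close> by simp
  then show "distinct c"
    using card_length[of c] by (intro card_distinct) linarith
qed

text \<open>Updating the coordinates once around a cycle preserves that they are nonnegative and
  increase along the cycle, and the twist makes the last one double. So the product of the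
  generators around a cycle has infinite order.\<close>

lemma cycle_round:
  assumes vs: "graph_path G S vs" "length vs = Suc L" "L \<ge> 2"
    and closed: "{vs ! 0, vs ! L} \<in> coxeter_graph G S"
    and a: "a = twisted_cartan (vs ! 0) (vs ! L)"
    and f0: "\<And>t. f t \<ge> 0" and mono: "\<And>i. i < L \<Longrightarrow> f (vs ! i) \<le> f (vs ! Suc i)"
    and g: "g = word_act S a (rev vs) f"
  shows "(\<forall>t. g t \<ge> 0) \<and> (\<forall>i<L. g (vs ! i) \<le> g (vs ! Suc i)) \<and> g (vs ! L) \<ge> 2 * f (vs ! L)"
proof -
  have dist: "distinct vs" and edge: "\<And>i. i < L \<Longrightarrow> noncomm G (vs ! i) (vs ! Suc i)"
    using vs(1,2) by (auto simp: graph_path_def successively_conv_nth coxeter_graph_iff)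
  have inS: "vs ! i \<in> S" if "i \<le> L" for i
    using vs(1,2) that nth_mem[of i vs] by (auto simp: graph_path_def)
  have ne: "vs ! i = vs ! j \<longleftrightarrow> i = j" if "i \<le> L" "j \<le> L" for i j
    using that dist vs(2) by (simp add: nth_eq_iff_index_eq)
  have closed': "noncomm G (vs ! 0) (vs ! L)"
    using closed by (simp add: coxeter_graph_iff)
  \<comment> \<open>State after reflecting at the first \<open>k\<close> vertices of the cycle;
    \<open>rev\<close> appears because the last letter acts first.\<close>
  define e where "e k = word_act S a (rev (take k vs)) f" for k
  have e0: "e 0 = f" by (simp add: e_def)
  have eS: "e (Suc k) = reflect S a (vs ! k) (e k)" if "k \<le> L" for k
    using that vs(2) by (simp add: e_def take_Suc_conv_app_nth)
  have e_later: "e k (vs ! i) = f (vs ! i)" if "k \<le> i" "i \<le> L" for k i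
    using that
  proof (induction k)
    case (Suc k)
    then show ?case using ne[of i k] by (simp add: eS)
  qed (simp add: e0)
  have lower: "(\<Sum>t\<in>S - {s}. a s t * h t) \<ge> a s t1 * h t1 + a s t2 * h t2"
    if "s \<in> S" "t1 \<in> S" "t2 \<in> S" "t1 \<noteq> s" "t2 \<noteq> s" "t1 \<noteq> t2" "\<And>t. h t \<ge> 0" for s t1 t2 h
  proof -
    have "(\<Sum>t\<in>{t1, t2}. a s t * h t) \<le> (\<Sum>t\<in>S - {s}. a s t * h t)"
      using that finite_S twisted_cartan_nonneg[of s] by (intro sum_mono2) (auto simp: a)
    then show ?thesis using that by simp
  qed
  \<comment> \<open>The neighbour \<open>vs ! L\<close> enters with the doubled weight, while the
    neighbour \<open>vs ! 1\<close> makes up for the subtracted old value at \<open>vs ! 0\<close>.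
    As \<open>L \<ge> 2\<close>, these are different neighbours.\<close>
  have first: "e 1 (vs ! 0) \<ge> 2 * f (vs ! L)"
  proof -
    have "a (vs ! 0) (vs ! 1) \<ge> 1"
      using twisted_cartan_ge[OF inS[of 0] inS[of 1], of "vs ! 0" "vs ! L"] edge[of 0] ne[of 1 L]
        ne[of 0 1] vs(3) by (auto simp: a)
    then have "a (vs ! 0) (vs ! 1) * f (vs ! 1) \<ge> f (vs ! 1)"
      using f0[of "vs ! 1"] by (simp add: mult_le_cancel_right1)
    moreover have "a (vs ! 0) (vs ! L) \<ge> 2"
      using twisted_cartan_ge[OF inS[of 0] inS[of L], of "vs ! 0" "vs ! L"] closed' by (auto simp:
          a)
    then have "a (vs ! 0) (vs ! L) * f (vs ! L) \<ge> 2 * f (vs ! L)"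
      using f0[of "vs ! L"] by (intro mult_right_mono) auto
    moreover have "f (vs ! 0) \<le> f (vs ! 1)"
      using mono[of 0] vs(3) by simp
    moreover have "(\<Sum>t\<in>S - {vs ! 0}. a (vs ! 0) t * f t) \<ge>
        a (vs ! 0) (vs ! 1) * f (vs ! 1) + a (vs ! 0) (vs ! L) * f (vs ! L)"
      using vs(3) by (intro lower f0) (simp_all add: inS ne)
    ultimately show ?thesis
      using eS[of 0] by (simp add: e0 reflect_same)
  qed
  have inv: "(\<forall>t. e (Suc k) t \<ge> 0) \<and> (\<forall>i<k. e (Suc k) (vs ! i) \<le> e (Suc k) (vs ! Suc i)) \<and>
      e (Suc k) (vs ! 0) \<ge> 2 * f (vs ! L)" if "k \<le> L" for k
    using that
  proof (induction k)
    case 0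
    have "e (Suc 0) t \<ge> 0" for t
      using first f0[of "vs ! L"] f0[of t] by (cases "t = vs ! 0") (simp_all add: eS e0)
    then show ?case using first by simp
  next
    case (Suc k)
    then have IH: "\<And>t. e (Suc k) t \<ge> 0" "\<And>i. i < k \<Longrightarrow> e (Suc k) (vs ! i) \<le> e (Suc k) (vs ! Suc i)"
      "e (Suc k) (vs ! 0) \<ge> 2 * f (vs ! L)"
      by auto
    let ?s = "vs ! Suc k"
    have prev: "a ?s (vs ! k) * e (Suc k) (vs ! k) \<ge> e (Suc k) (vs ! k)"
    proof -
      have "a ?s (vs ! k) \<ge> 1"
        using twisted_cartan_ge[OF inS[of "Suc k"] inS[of k], of "vs ! 0" "vs ! L"] edge[of k]
          ne[of "Suc k" L] ne[of k 0] ne[of "Suc k" 0] Suc.prems vs(3)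
        by (auto simp: a noncomm_sym)
      then show ?thesis
        using IH(1)[of "vs ! k"] by (simp add: mult_le_cancel_right1)
    qed
    \<comment> \<open>The new value is at least the new value of the predecessor plus the old value
      of the successor minus the old value here; monotonicity of \<open>f\<close> bounds the last
      difference below by 0.\<close>
    have step: "e (Suc (Suc k)) ?s \<ge> e (Suc k) (vs ! k)"
    proof (cases "Suc k = L")
      \<comment> \<open>At the last vertex the successor is \<open>vs ! 0\<close>: its weight may be
        only 1/2, but its value is already at least \<open>2 * f (vs ! L)\<close>.\<close>
      case True
      have "a ?s (vs ! 0) \<ge> 1 / 2"
        using twisted_cartan_ge[OF inS[of L] inS[of 0], of "vs ! 0" "vs ! L"] closed' True ne[of 0
            L]
        by (auto simp: a noncomm_sym split: if_splits)
      then have "a ?s (vs ! 0) * e (Suc k) (vs ! 0) \<ge> 1 / 2 * (2 * f (vs ! L))"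
        using IH(3) f0[of "vs ! L"] by (intro mult_mono) auto
      moreover have "(\<Sum>t\<in>S - {?s}. a ?s t * e (Suc k) t) \<ge>
          a ?s (vs ! k) * e (Suc k) (vs ! k) + a ?s (vs ! 0) * e (Suc k) (vs ! 0)"
        using Suc.prems vs(3) True by (intro lower IH(1)) (simp_all add: inS ne)
      ultimately show ?thesis
        using prev True e_later[of "Suc k" "Suc k"] Suc.prems by (simp add: eS reflect_same)
    next
      case False
      with Suc.prems have k2: "Suc (Suc k) \<le> L" by simp
      have "a ?s (vs ! Suc (Suc k)) \<ge> 1"
        using twisted_cartan_ge[OF inS[of "Suc k"] inS[of "Suc (Suc k)"], of "vs ! 0" "vs ! L"]
          edge[of "Suc k"] ne[of "Suc k" L] ne[of "Suc k" 0] k2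
        by (auto simp: a)
      then have "a ?s (vs ! Suc (Suc k)) * e (Suc k) (vs ! Suc (Suc k)) \<ge> f (vs ! Suc (Suc k))"
        using IH(1)[of "vs ! Suc (Suc k)"] e_later[of "Suc k" "Suc (Suc k)"] k2
        by (simp add: mult_le_cancel_right1)
      moreover have "(\<Sum>t\<in>S - {?s}. a ?s t * e (Suc k) t) \<ge>
          a ?s (vs ! k) * e (Suc k) (vs ! k)
          + a ?s (vs ! Suc (Suc k)) * e (Suc k) (vs ! Suc (Suc k))"
        using k2 by (intro lower IH(1)) (simp_all add: inS ne)
      moreover have "f ?s \<le> f (vs ! Suc (Suc k))"
        using mono[of "Suc k"] k2 by simp
      ultimately show ?thesis
        using prev e_later[of "Suc k" "Suc k"] Suc.prems by (simp add: eS reflect_same)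
    qed
    have same: "e (Suc (Suc k)) t = e (Suc k) t" if "t \<noteq> ?s" for t
      using that Suc.prems by (simp add: eS)
    have "e (Suc (Suc k)) t \<ge> 0" for t
      using step IH(1)[of t] IH(1)[of "vs ! k"] same[of t] by (cases "t = ?s") auto
    moreover have "e (Suc (Suc k)) (vs ! i) \<le> e (Suc (Suc k)) (vs ! Suc i)" if "i < Suc k" for i
      using that step IH(2)[of i] same ne[of i "Suc k"] ne[of "Suc i" "Suc k"] Suc.prems
      by (cases "i = k") auto
    moreover have "e (Suc (Suc k)) (vs ! 0) \<ge> 2 * f (vs ! L)"
      using IH(3) same ne[of 0 "Suc k"] Suc.prems by auto
    ultimately show ?case by blast
  qed
  have "e (Suc L) = g"
    using vs(2) by (simp add: e_def g)
  with inv[of L] have *: "\<forall>t. g t \<ge> 0" "\<forall>i<L. g (vs ! i) \<le> g (vs ! Suc i)" "g (vs ! 0) \<ge> 2 * f (vs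
      ! L)"
    by auto
  have "g (vs ! 0) \<le> g (vs ! i)" if "i \<le> L" for i
    using that *(2) by (induction i) (auto intro: order_trans)
  then have "g (vs ! 0) \<le> g (vs ! L)" by simp
  then show ?thesis
    using * by auto
qed

lemma coxeter_graph_acyclic:
  assumes vs: "graph_path G S vs" "length vs \<ge> 3"
  shows "{hd vs, last vs} \<notin> coxeter_graph G S"
proof
  assume closed: "{hd vs, last vs} \<in> coxeter_graph G S"
  obtain L where L: "length vs = Suc L" "L \<ge> 2"
    using vs(2) by (cases "length vs") auto
  have hl: "hd vs = vs ! 0" "last vs = vs ! L"
    using L by (auto simp: hd_conv_nth last_conv_nth simp flip: length_greater_0_conv)
  have vsS: "vs \<in> lists S" "distinct vs"
    using vs by (auto simp: graph_path_def)
  have ne: "vs ! i = vs ! j \<longleftrightarrow> i = j" if "i \<le> L" "j \<le> L" for i j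
    using that vsS L by (simp add: nth_eq_iff_index_eq)
  define a where "a = twisted_cartan (vs ! 0) (vs ! L)"
  \<comment> \<open>The simple root of the last vertex is nonnegative and nondecreasing along the
    path, so \<open>cycle_round\<close> can start from it. After \<open>N\<close> rounds its last
    coordinate would be both 1 and at least \<open>2 ^ N\<close>.\<close>
  define f :: "'a \<Rightarrow> real" where "f t = (if t = vs ! L then 1 else 0)" for t
  have a: "cartan a"
    unfolding a_def using ne[of 0 L] L by (intro cartan_twisted) simp
  let ?F = "word_act S a (rev vs)"
  have growth: "(\<forall>t. (?F ^^ k) f t \<ge> 0) \<and> (\<forall>i<L. (?F ^^ k) f (vs ! i) \<le> (?F ^^ k) f (vs ! Suc i)) \<and>
      (?F ^^ k) f (vs ! L) \<ge> 2 ^ k" for k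
  proof (induction k)
    case 0
    then show ?case by (auto simp: f_def ne)
  next
    case (Suc k)
    have *: "(\<forall>t. (?F ^^ Suc k) f t \<ge> 0) \<and>
        (\<forall>i<L. (?F ^^ Suc k) f (vs ! i) \<le> (?F ^^ Suc k) f (vs ! Suc i)) \<and>
        (?F ^^ Suc k) f (vs ! L) \<ge> 2 * (?F ^^ k) f (vs ! L)"
      using Suc closed vs L by (intro cycle_round) (auto simp: hl a_def)
    with Suc have "2 * 2 ^ k \<le> (?F ^^ Suc k) f (vs ! L)" by linarith
    then show ?case using * unfolding power_Suc by blast
  qed
  define N where "N = ord (word_prod G (rev vs))"
  have revS: "rev vs \<in> lists S"
    using vsS by auto
  have "N \<ge> 1"
    unfolding N_def using revS by (intro ord_ge_1[OF fin_carrier]) simp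
  have "word_prod G (concat (replicate N (rev vs))) = word_prod G []"
    using revS by (simp add: word_prod_replicate N_def)
  moreover have "concat (replicate N (rev vs)) \<in> lists S"
    using revS by (auto split: if_splits)
  ultimately have "word_act S a (concat (replicate N (rev vs))) f = word_act S a [] f"
    using a by (intro word_act_eq) auto
  then have "(?F ^^ N) f = f"
    by (simp only: word_act_replicate word_act_Nil)
  then have "(2 :: real) ^ N \<le> 1"
    using growth[of N] by (simp add: f_def)
  moreover have "(2 :: real) ^ N \<ge> 2 ^ 1"
    using \<open>N \<ge> 1\<close> by (intro power_increasing) auto
  ultimately show False by simp
qed

end

section \<open>Cut paths of the 2-cover\<close>

lemma precedes_iff:
  assumes "distinct c" "i < length c" "j < length c"
  shows "precedes c (c ! i) (c ! j) \<longleftrightarrow> i < j"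
  using assms by (auto simp: precedes_def nth_eq_iff_index_eq)

text \<open>As \<open>c\<close> has no repetitions, the earlier occurrences of a generator are the
  positions of the same residue, one in each earlier copy.\<close>

lemma letter_inf_word:
  assumes c: "distinct c" "c \<noteq> []"
  shows "letter (inf_word c) i = (c ! (i mod length c), i div length c)"
proof -
  let ?n = "length c"
  have n: "?n > 0" using c by simp
  have "{j. j < i \<and> inf_word c j = inf_word c i} = (\<lambda>k. k * ?n + i mod ?n) ` {..<i div ?n}"
  proof (intro Set.set_eqI iffI)
    fix j assume "j \<in> {j. j < i \<and> inf_word c j = inf_word c i}"
    then have j: "j < i" "c ! (j mod ?n) = c ! (i mod ?n)"
      by (auto simp: inf_word_def)
    then have m: "j mod ?n = i mod ?n"
      using c n by (simp add: nth_eq_iff_index_eq)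
    have "\<not> i div ?n \<le> j div ?n"
    proof
      assume "i div ?n \<le> j div ?n"
      then have "i div ?n * ?n + i mod ?n \<le> j div ?n * ?n + j mod ?n"
        unfolding m by (intro add_right_mono mult_le_mono1)
      then show False using j by (simp add: div_mult_mod_eq)
    qed
    moreover have "j = j div ?n * ?n + i mod ?n"
      using m div_mult_mod_eq[of j ?n] by simp
    ultimately show "j \<in> (\<lambda>k. k * ?n + i mod ?n) ` {..<i div ?n}"
      by (intro image_eqI[of _ _ "j div ?n"]) auto
  next
    fix j assume "j \<in> (\<lambda>k. k * ?n + i mod ?n) ` {..<i div ?n}"
    then obtain k where k: "k < i div ?n" "j = k * ?n + i mod ?n" by auto
    then have "k * ?n < i div ?n * ?n" using n by simp
    then have "j < i"
      using k div_mult_mod_eq[of i ?n] by linarith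
    then show "j \<in> {j. j < i \<and> inf_word c j = inf_word c i}"
      using k by (simp add: inf_word_def)
  qed
  moreover have "inj_on (\<lambda>k. k * ?n + i mod ?n) {..<i div ?n}"
    using n by (auto simp: inj_on_def)
  ultimately show ?thesis
    by (simp add: letter_def card_image) (simp add: inf_word_def)
qed

text \<open>The list runs through \<open>u 0\<close>, \<open>w 0\<close>, \<open>u 1\<close>,
  \<open>w 1\<close> and so on. Indexing by parity lets the vertices \<open>w m\<close> be chosen
  independently for each \<open>m\<close>, as rerouting requires; only the last edge uses the
  reduction modulo \<open>h\<close>.\<close>

lemma doubled_index_cycle:
  assumes "h > 0"
  shows "cycle_edges (map (\<lambda>i. if even i then u (i div 2) else w (i div 2)) [0..<2 * h]) =
    (\<Union>m\<in>{..<h}. {(u m, w m), (w m, u (Suc m mod h))})"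
    (is "cycle_edges ?vs = _")
proof -
  have nth: "?vs ! i = (if even i then u (i div 2) else w (i div 2))" if "i < 2 * h" for i
    using that by simp
  have out: "(?vs ! (2 * m), ?vs ! (Suc (2 * m) mod (2 * h))) = (u m, w m)" if "m < h" for m
    using that by (simp add: nth)
  have ret: "(?vs ! Suc (2 * m), ?vs ! (Suc (Suc (2 * m)) mod (2 * h))) = (w m, u (Suc m mod h))"
    if "m < h" for m
  proof (cases "Suc m = h")
    case True
    then have "Suc (Suc (2 * m)) = 2 * h" by simp
    then have "Suc (Suc (2 * m)) mod (2 * h) = 0" by simp
    then show ?thesis using True that assms by (simp add: nth)
  next
    case False
    with that have "Suc m < h" by simp
    then have "Suc (Suc (2 * m)) mod (2 * h) = 2 * Suc m" by simp
    then show ?thesis using that \<open>Suc m < h\<close> by (simp add: nth)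
  qed
  show ?thesis
  proof (intro equalityI subsetI)
    fix \<epsilon> assume "\<epsilon> \<in> cycle_edges ?vs"
    then obtain i where i: "i < 2 * h" "\<epsilon> = (?vs ! i, ?vs ! (Suc i mod (2 * h)))"
      by (auto simp: cycle_edges_def)
    have "i div 2 < h" using i by linarith
    have "i = 2 * (i div 2) \<or> i = Suc (2 * (i div 2))" by presburger
    then have "\<epsilon> = (u (i div 2), w (i div 2)) \<or> \<epsilon> = (w (i div 2), u (Suc (i div 2) mod h))"
    proof
      assume "i = 2 * (i div 2)"
      then have "\<epsilon> = (?vs ! (2 * (i div 2)), ?vs ! (Suc (2 * (i div 2)) mod (2 * h)))"
        using i(2) by (simp only:)
      then show ?thesis unfolding out[OF \<open>i div 2 < h\<close>] ..
    next
      assume "i = Suc (2 * (i div 2))"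
      then have "\<epsilon> = (?vs ! Suc (2 * (i div 2)), ?vs ! (Suc (Suc (2 * (i div 2))) mod (2 * h)))"
        using i(2) by (simp only:)
      then show ?thesis unfolding ret[OF \<open>i div 2 < h\<close>] ..
    qed
    then show "\<epsilon> \<in> (\<Union>m\<in>{..<h}. {(u m, w m), (w m, u (Suc m mod h))})"
      using \<open>i div 2 < h\<close> by blast
  next
    fix \<epsilon> assume "\<epsilon> \<in> (\<Union>m\<in>{..<h}. {(u m, w m), (w m, u (Suc m mod h))})"
    then obtain m where m: "m < h" "\<epsilon> = (u m, w m) \<or> \<epsilon> = (w m, u (Suc m mod h))" by auto
    then have "\<exists>i<2 * h. \<epsilon> = (?vs ! i, ?vs ! (Suc i mod (2 * h)))"
    proof (elim disjE)
      assume "\<epsilon> = (u m, w m)"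
      then show ?thesis
        using m(1) unfolding out[OF m(1), symmetric] by (intro exI[of _ "2 * m"]) simp
    next
      assume "\<epsilon> = (w m, u (Suc m mod h))"
      then show ?thesis
        using m(1) unfolding ret[OF m(1), symmetric] by (intro exI[of _ "Suc (2 * m)"]) simp
    qed
    then show "\<epsilon> \<in> cycle_edges ?vs"
      by (auto simp: cycle_edges_def)
  qed
qed

text \<open>The letter \<open>(a, m)\<close> has abscissa \<open>x a + 2 m\<close>. Existence of such a function \<open>x\<close> expresses
  that the Coxeter graph has no cycles obstructing a planar drawing with edges of horizontal
  extent 1.\<close>

locale coxeter_heap =
  fixes G :: "('a, 'b) monoid_scheme" and S :: "'a set" and c :: "'a list" and x :: "'a \<Rightarrow> int"
  assumes c: "distinct c" "set c = S" "c \<noteq> []"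
    and x: "\<And>a b. a \<in> S \<Longrightarrow> b \<in> S \<Longrightarrow> noncomm G a b \<Longrightarrow> x b = x a + (if precedes c a b then 1 else - 1)"
    and h: "coxeter_number G c > 0"
begin

abbreviation "h \<equiv> coxeter_number G c"

definition adj :: "'a \<Rightarrow> 'a \<Rightarrow> bool" where
  "adj a b \<longleftrightarrow> a \<in> S \<and> b \<in> S \<and> noncomm G a b"

lemma adj_sym: "adj a b \<Longrightarrow> adj b a"
  by (auto simp: adj_def noncomm_def)

lemma adj_irrefl: "adj a b \<Longrightarrow> a \<noteq> b"
  by (auto simp: adj_def noncomm_def)

lemma adj_coxeter_graph: "{a, b} \<in> coxeter_graph G S \<longleftrightarrow> adj a b"
  by (auto simp: coxeter_graph_def adj_def noncomm_def doubleton_eq_iff)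

definition abscissa :: "nat \<Rightarrow> int" where
  "abscissa i = x (c ! (i mod length c)) + 2 * int (i div length c)"

text \<open>Inside one copy of \<open>c\<close> the sign of the difference of \<open>x\<close>
  records the order of the letters; between different copies the shift by 2 outweighs that
  difference of 1.\<close>

lemma noncomm_position_less_iff:
  assumes "noncomm G (inf_word c i) (inf_word c j)"
  shows "i < j \<longleftrightarrow> abscissa i < abscissa j"
proof -
  let ?n = "length c"
  have n: "?n > 0" using c by simp
  have lt: "i mod ?n < ?n" "j mod ?n < ?n" using n by auto
  have xx: "x (c ! (j mod ?n)) = x (c ! (i mod ?n)) + (if i mod ?n < j mod ?n then 1 else - 1)"
    using assms lt c precedes_iff[OF c(1) lt] x[of "c ! (i mod ?n)" "c ! (j mod ?n)"]
    by (auto simp: inf_word_def)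
  have ne: "i mod ?n \<noteq> j mod ?n"
    using assms by (auto simp: inf_word_def noncomm_def)
  have lex: "k < l" if "k div ?n < l div ?n" for k l
    using that div_le_mono[of l k ?n] by (meson not_le)
  consider "i div ?n < j div ?n" | "i div ?n = j div ?n" | "j div ?n < i div ?n" by linarith
  then show ?thesis
  proof cases
    case 2
    have "i < j \<longleftrightarrow> i mod ?n < j mod ?n"
      using 2 div_mult_mod_eq[of i ?n] div_mult_mod_eq[of j ?n]
      by (metis nat_add_left_cancel_less)
    then show ?thesis
      using 2 xx ne by (auto simp: abscissa_def)
  next
    case 1
    then show ?thesis
      using xx lex[OF 1] by (simp add: abscissa_def)
  next
    case 3
    then show ?thesis
      using xx lex[OF 3] by (simp add: abscissa_def)
  qed
qed

text \<open>Serves to raise a positive gap different from 1 to at least 3, which leaves room for two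
  intermediate letters.\<close>

lemma abscissa_parity:
  assumes "noncomm G (inf_word c i) (inf_word c j)"
  shows "odd (abscissa j - abscissa i)"
proof -
  have n: "length c > 0" using c by simp
  then have "x (c ! (j mod length c)) - x (c ! (i mod length c)) \<in> {1, - 1}"
    using assms c x[of "c ! (i mod length c)" "c ! (j mod length c)"]
    by (auto simp: inf_word_def split: if_splits)
  moreover have "abscissa j - abscissa i = (x (c ! (j mod length c)) - x (c ! (i mod length c)))
      + 2 * (int (j div length c) - int (i div length c))"
    by (simp add: abscissa_def algebra_simps)
  moreover have "odd (d + 2 * e)" if "d \<in> {1, - 1}" for d e :: int
    using that by auto
  ultimately show ?thesis by metis
qed

lemma chain_abscissa:
  assumes "successively (\<lambda>a b. a < b \<and> noncomm G (inf_word c a) (inf_word c b)) ks" "ks \<noteq> []"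
  shows "abscissa (last ks) \<ge> abscissa (hd ks) + int (length ks) - 1 \<and> hd ks \<le> last ks"
  using assms
proof (induction ks rule: induct_list012)
  case (3 k l ks)
  then have "k < l" "noncomm G (inf_word c k) (inf_word c l)" by auto
  then have "abscissa k < abscissa l"
    using noncomm_position_less_iff by blast
  with 3 \<open>k < l\<close> show ?case by auto
qed auto

lemma natural_le_abscissa:
  assumes "natural_le G (inf_word c) i j"
  shows "i = j \<or> i < j \<and> abscissa i < abscissa j"
proof -
  obtain ks where ks: "ks \<noteq> []" "hd ks = i" "last ks = j"
    "successively (\<lambda>a b. a < b \<and> noncomm G (inf_word c a) (inf_word c b)) ks"
    using assms by (auto simp: natural_le_def)
  then obtain k ks' where ks': "ks = k # ks'" by (cases ks) auto
  show ?thesis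
  proof (cases ks')
    case Nil
    then show ?thesis using ks ks' by auto
  next
    case (Cons l ks'')
    then have "i < l" "l \<le> j"
      using ks ks' chain_abscissa[of ks'] by auto
    then show ?thesis
      using chain_abscissa[OF ks(4,1)] ks ks' Cons by auto
  qed
qed

lemma natural_le_step:
  assumes "noncomm G (inf_word c i) (inf_word c j)" "abscissa i < abscissa j"
  shows "natural_le G (inf_word c) i j"
  using assms noncomm_position_less_iff[OF assms(1)]
  unfolding natural_le_def by (intro exI[of _ "[i, j]"]) auto

lemma natural_le_trans:
  assumes "natural_le G u i j" "natural_le G u j k"
  shows "natural_le G u i k"
proof -
  obtain ks where ks: "ks \<noteq> []" "hd ks = i" "last ks = j"
      "successively (\<lambda>a b. a < b \<and> noncomm G (u a) (u b)) ks"
    using assms(1) unfolding natural_le_def by blast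
  obtain ls where ls: "ls \<noteq> []" "hd ls = j" "last ls = k"
      "successively (\<lambda>a b. a < b \<and> noncomm G (u a) (u b)) ls"
    using assms(2) unfolding natural_le_def by blast
  show ?thesis
  proof (cases "tl ls")
    case Nil
    then have "j = k" using ls by (cases ls) auto
    then show ?thesis using assms by simp
  next
    case (Cons l ls')
    then have "ls = j # l # ls'" using ls by (cases ls) auto
    then show ?thesis
      unfolding natural_le_def using ks ls Cons
      by (intro exI[of _ "ks @ tl ls"]) (auto simp: successively_append_iff)
  qed
qed

lemma position_exists:
  assumes "a \<in> S"
  obtains i where "c ! (i mod length c) = a" "i div length c = m"
proof -
  obtain k where "k < length c" "c ! k = a"
    using assms c by (metis in_set_conv_nth)
  then show thesis
    by (intro that[of "m * length c + k"]) (auto simp: div_add1_eq)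
qed

text \<open>A cover is a single step of a chain. A gap of 3 or more admits intermediate letters
  built from the two generators themselves; a gap of 1 admits none, because every step of a chain
  raises the integer abscissa.\<close>

lemma natural_covers_iff:
  "natural_covers G (inf_word c) i j \<longleftrightarrow>
     noncomm G (inf_word c i) (inf_word c j) \<and> abscissa j = abscissa i + 1"
proof
  assume cov: "natural_covers G (inf_word c) i j"
  then obtain ks where ks: "ks \<noteq> []" "hd ks = i" "last ks = j"
      "successively (\<lambda>a b. a < b \<and> noncomm G (inf_word c a) (inf_word c b)) ks" and ij: "i \<noteq> j"
    by (auto simp: natural_covers_def natural_le_def)
  obtain k ks' where "ks = i # k # ks'"
    using ks ij by (cases ks rule: remdups_adj.cases) auto
  note ks = ks[unfolded this]
  have ik: "i < k" "noncomm G (inf_word c i) (inf_word c k)" using ks by auto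
  have le: "natural_le G (inf_word c) i k"
    using ik by (intro natural_le_step) (auto simp: noncomm_position_less_iff[symmetric])
  have "natural_le G (inf_word c) k j"
    unfolding natural_le_def using ks by (intro exI[of _ "k # ks'"]) auto
  with le ik cov have "k = j"
    by (auto simp: natural_covers_def)
  with ik have ij: "i < j" "noncomm G (inf_word c i) (inf_word c j)" by auto
  then have lt: "abscissa i < abscissa j"
    using noncomm_position_less_iff by blast
  have "abscissa j = abscissa i + 1"
  proof (rule ccontr)
    assume "abscissa j \<noteq> abscissa i + 1"
    moreover have "odd (abscissa j - abscissa i)"
      using ij by (intro abscissa_parity)
    ultimately have ge: "abscissa j \<ge> abscissa i + 3"
      using lt by presburger
    let ?a = "c ! (i mod length c)" and ?b = "c ! (j mod length c)"
    have S: "?a \<in> S" "?b \<in> S" using c by auto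
    have nc: "noncomm G ?a ?b" using ij by (simp add: inf_word_def)
    \<comment> \<open>\<open>k\<close> is the next copy of the generator at \<open>i\<close>, and
      \<open>l\<close> the letter of the other generator between the two copies, giving the chain
      \<open>i\<close>, \<open>l\<close>, \<open>k\<close>, \<open>j\<close>.\<close>
    obtain k where k: "c ! (k mod length c) = ?a" "k div length c = Suc (i div length c)"
      using position_exists[OF S(1)] .
    obtain l where l: "c ! (l mod length c) = ?b"
        "l div length c = i div length c + (if precedes c ?a ?b then 0 else 1)"
      using position_exists[OF S(2)] .
    have al: "abscissa l = abscissa i + 1" and ak: "abscissa k = abscissa i + 2"
      using k l x[OF S nc] by (auto simp: abscissa_def)
    have "natural_le G (inf_word c) i l"
      using al nc l by (intro natural_le_step) (auto simp: inf_word_def)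
    moreover have "natural_le G (inf_word c) l k"
      using al ak nc l k by (intro natural_le_step) (auto simp: inf_word_def noncomm_def)
    ultimately have "natural_le G (inf_word c) i k"
      by (rule natural_le_trans)
    moreover have "natural_le G (inf_word c) k j"
      using ak ge nc k by (intro natural_le_step) (auto simp: inf_word_def)
    moreover have "k \<noteq> i" "k \<noteq> j"
      using ak ge by auto
    ultimately show False
      using cov by (auto simp: natural_covers_def)
  qed
  with ij show "noncomm G (inf_word c i) (inf_word c j) \<and> abscissa j = abscissa i + 1" by simp
next
  assume *: "noncomm G (inf_word c i) (inf_word c j) \<and> abscissa j = abscissa i + 1"
  then have "natural_le G (inf_word c) i j" "i \<noteq> j"
    by (auto intro: natural_le_step)
  moreover have False if "k \<noteq> i" "k \<noteq> j" "natural_le G (inf_word c) i k" "natural_le G (inf_word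
      c) k j" for k
    using natural_le_abscissa[OF that(3)] natural_le_abscissa[OF that(4)] that(1,2) * by auto
  ultimately show "natural_covers G (inf_word c) i j"
    by (auto simp: natural_covers_def)
qed

text \<open>This replaces positions in the infinite word by generators and copy numbers, the form in
  which edges are projected and drawn.\<close>

lemma hasse_edges_eq:
  "hasse_edges G (inf_word c) =
     {((a, m), (b, k)) | a b m k. adj a b \<and> x b + 2 * int k = x a + 2 * int m + 1}"
proof (intro Set.set_eqI iffI)
  fix \<eta> assume "\<eta> \<in> hasse_edges G (inf_word c)"
  then obtain i j where ij: "natural_covers G (inf_word c) i j"
      "\<eta> = (letter (inf_word c) i, letter (inf_word c) j)"
    by (auto simp: hasse_edges_def)
  then have "adj (c ! (i mod length c)) (c ! (j mod length c))"
    using c by (auto simp: natural_covers_iff adj_def inf_word_def)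
  with ij show "\<eta> \<in> {((a, m), (b, k)) | a b m k. adj a b \<and> x b + 2 * int k = x a + 2 * int m + 1}"
    using c by (auto simp: natural_covers_iff letter_inf_word abscissa_def)
next
  fix \<eta> assume "\<eta> \<in> {((a, m), (b, k)) | a b m k. adj a b \<and> x b + 2 * int k = x a + 2 * int m + 1}"
  then obtain a b m k where \<eta>: "\<eta> = ((a, m), (b, k))" "adj a b" "x b + 2 * int k = x a + 2 * int m
      + 1"
    by auto
  obtain i where i: "c ! (i mod length c) = a" "i div length c = m"
    using position_exists[of a m] \<eta> by (auto simp: adj_def)
  obtain j where j: "c ! (j mod length c) = b" "j div length c = k"
    using position_exists[of b k] \<eta> by (auto simp: adj_def)
  have "natural_covers G (inf_word c) i j"
    using \<eta> i j by (auto simp: natural_covers_iff inf_word_def adj_def abscissa_def)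
  moreover have "\<eta> = (letter (inf_word c) i, letter (inf_word c) j)"
    using \<eta> i j c by (simp add: letter_inf_word)
  ultimately show "\<eta> \<in> hasse_edges G (inf_word c)"
    by (auto simp: hasse_edges_def)
qed

text \<open>Between the letters \<open>(a, m)\<close> and \<open>(a, m + 1)\<close> there is exactly one letter of each neighbour
  \<open>b\<close> of \<open>a\<close>, namely \<open>(b, m + offset a b)\<close>.\<close>

definition offset :: "'a \<Rightarrow> 'a \<Rightarrow> nat" where
  "offset a b = (if precedes c a b then 0 else 1)"

definition out_edge :: "'a \<Rightarrow> 'a \<Rightarrow> nat \<Rightarrow> 'a letter \<times> 'a letter" where
  "out_edge a b m = ((a, m), (b, m + offset a b))"

text \<open>The index is the copy of \<open>a\<close> before the neighbour, not the one that the
  edge enters. Thus the out-edges and in-edges with the same \<open>m\<close> surround the same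
  block between \<open>(a, m)\<close> and \<open>(a, m + 1)\<close>.\<close>

definition in_edge :: "'a \<Rightarrow> 'a \<Rightarrow> nat \<Rightarrow> 'a letter \<times> 'a letter" where
  "in_edge a b m = ((b, m + offset a b), (a, Suc m))"

definition proj :: "'a letter \<times> 'a letter \<Rightarrow> 'a letter \<times> 'a letter" where
  "proj = map_prod (pr h) (pr h)"

section \<open>Zigzag cycles of the 2-cover around one generator\<close>

lemma offset: "adj a b \<Longrightarrow> x b + 2 * int (offset a b) = x a + 1"
  using x[of a b] by (auto simp: adj_def offset_def)

lemma out_edge_hasse: "adj a b \<Longrightarrow> out_edge a b m \<in> hasse_edges G (inf_word c)"
  using offset[of a b] by (auto simp: hasse_edges_eq out_edge_def)

lemma in_edge_hasse: "adj a b \<Longrightarrow> in_edge a b m \<in> hasse_edges G (inf_word c)"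
  using offset[of a b] adj_sym[of a b] by (auto simp: hasse_edges_eq in_edge_def)

lemma two_cover_edges: "snd (two_cover G S c) = proj ` hasse_edges G (inf_word c)"
  by (simp add: two_cover_def proj_def)

lemma proj_out_edge: "proj (out_edge a b m) = ((a, m mod h), (b, (m + offset a b) mod h))"
  by (simp add: proj_def out_edge_def pr_def)

lemma proj_in_edge: "proj (in_edge a b m) = ((b, (m + offset a b) mod h), (a, Suc m mod h))"
  by (simp add: proj_def in_edge_def pr_def)

lemma edges_over:
  assumes ab: "adj a b" and \<epsilon>: "\<epsilon> \<in> snd (two_cover G S c)" "lies_over \<epsilon> {a, b}"
  shows "\<exists>m<h. \<epsilon> = proj (out_edge a b m) \<or> \<epsilon> = proj (in_edge a b m)"
proof -
  obtain a' b' m k where \<eta>: "\<epsilon> = proj ((a', m), (b', k))" "adj a' b'" "x b' + 2 * int k = x a' + 2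
      * int m + 1"
    using \<epsilon>(1) unfolding two_cover_edges hasse_edges_eq by blast
  have \<epsilon>': "\<epsilon> = ((a', m mod h), (b', k mod h))"
    using \<eta> by (simp add: proj_def pr_def)
  have "{a', b'} = {a, b}"
    using \<epsilon>(2) \<epsilon>' by (simp add: lies_over_def)
  then consider "a' = a" "b' = b" | "a' = b" "b' = a"
    by (auto simp: doubleton_eq_iff)
  then show ?thesis
  proof cases
    case 1
    then have "k = m + offset a b"
      using \<eta> offset[OF ab] by simp
    then have "\<epsilon> = proj (out_edge a b (m mod h))"
      using 1 \<epsilon>' by (simp add: proj_out_edge mod_simps)
    then show ?thesis using h by (intro exI[of _ "m mod h"]) simp
  next
    case 2
    then have k: "k + offset a b = Suc m"
      using \<eta> offset[OF ab] by simp
    \<comment> \<open>The block is \<open>k - 1\<close> modulo \<open>h\<close>; adding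
      \<open>h\<close> first avoids truncated subtraction when \<open>k = 0\<close>.\<close>
    define l where "l = k + h - 1"
    have l: "Suc l = k + h" "l + offset a b = m + h"
      using h k by (auto simp: l_def)
    have "\<epsilon> = proj (in_edge a b (l mod h))"
    proof -
      have "(l mod h + offset a b) mod h = m mod h" "Suc (l mod h) mod h = k mod h"
        using l by (simp_all add: mod_simps)
      then show ?thesis
        using 2 \<epsilon>' by (simp add: proj_in_edge)
    qed
    then show ?thesis using h by (intro exI[of _ "l mod h"]) simp
  qed
qed

lemma add_mod_inj: "m < h \<Longrightarrow> k < h \<Longrightarrow> (m + d) mod h = (k + d) mod h \<Longrightarrow> m = (k :: nat)"
proof -
  assume mk: "m < h" "k < h" and "(m + d) mod h = (k + d) mod h"
  then have "(int m + int d) mod int h = (int k + int d) mod int h"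
    by (simp flip: of_nat_add zmod_int)
  then have "int m mod int h = int k mod int h"
    by (simp add: mod_eq_dvd_iff)
  with mk show "m = k" by simp
qed

lemma proj_edge_inj:
  assumes "adj a b" "m < h" "k < h"
    "\<epsilon> = proj (out_edge a b m) \<or> \<epsilon> = proj (in_edge a b m)"
    "\<epsilon> = proj (out_edge a b k) \<or> \<epsilon> = proj (in_edge a b k)"
  shows "m = k"
  using assms adj_irrefl[OF assms(1)] add_mod_inj[of m k "offset a b"]
  by (auto simp: proj_out_edge proj_in_edge)

text \<open>\<open>f m\<close> selects the neighbour through which the cycle passes in block
  \<open>m\<close>: a constant \<open>f\<close> gives the zigzag over one edge, a change at one
  value a detour. The cycle is simple even for varying \<open>f\<close>, since two equal letters of
  neighbours have the same generator, hence the same offset and the same block.\<close>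

lemma zigzag_cycle:
  assumes f: "\<And>m. adj a (f m)" and cut: "cut_path (two_cover G S c) \<kappa>"
  shows "\<exists>!\<epsilon>. \<epsilon> \<in> \<kappa> \<and> (\<exists>m<h. \<epsilon> = proj (out_edge a (f m) m) \<or> \<epsilon> = proj (in_edge a (f m) m))"
proof -
  define u :: "nat \<Rightarrow> 'a letter" where "u m = (a, m)" for m
  define w where "w m = (f m, (m + offset a (f m)) mod h)" for m
  define vs where "vs = map (\<lambda>i. if even i then u (i div 2) else w (i div 2)) [0..<2 * h]"
  have edges: "cycle_edges vs =
      {\<epsilon>. \<exists>m<h. \<epsilon> = proj (out_edge a (f m) m) \<or> \<epsilon> = proj (in_edge a (f m) m)}"
    unfolding vs_def doubled_index_cycle[OF h]
    by (auto simp: proj_out_edge proj_in_edge u_def w_def)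
  have uw: "u m \<noteq> w k" for m k
    using adj_irrefl[OF f[of k]] by (auto simp: u_def w_def)
  have w_inj: "m = k" if "w m = w k" "m < h" "k < h" for m k
    using that add_mod_inj[of m k "offset a (f m)"] by (auto simp: w_def)
  have "distinct vs"
  proof -
    have "inj_on (\<lambda>i. if even i then u (i div 2) else w (i div 2)) {0..<2 * h}"
    proof (rule inj_onI)
      fix i j
      assume ij: "i \<in> {0..<2 * h}" "j \<in> {0..<2 * h}"
        "(if even i then u (i div 2) else w (i div 2)) = (if even j then u (j div 2) else w (j div
            2))"
      then have "i div 2 < h" "j div 2 < h" by auto
      have par: "even i \<longleftrightarrow> even j"
        using ij(3) uw uw[symmetric] by (auto split: if_splits)
      moreover have "i div 2 = j div 2"
        using ij(3) par w_inj[of "i div 2" "j div 2"] \<open>i div 2 < h\<close> \<open>j div 2 < h\<close>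
        by (auto simp: u_def split: if_splits)
      ultimately show "i = j"
        by (metis dvd_mult_div_cancel odd_two_times_div_two_succ)
    qed
    then show ?thesis by (simp add: vs_def distinct_map)
  qed
  moreover have "vs \<noteq> []" using h by (simp add: vs_def)
  moreover have "cycle_edges vs \<subseteq> snd (two_cover G S c)"
    using f out_edge_hasse in_edge_hasse by (auto simp: edges two_cover_edges)
  ultimately have "directed_cycle (two_cover G S c) vs"
    by (simp add: directed_cycle_def)
  then have "\<exists>!\<epsilon>. \<epsilon> \<in> \<kappa> \<and> \<epsilon> \<in> cycle_edges vs"
    using cut unfolding cut_path_def by blast
  then show ?thesis
    unfolding edges mem_Collect_eq .
qed

lemma proj_lies_over: "lies_over (proj (out_edge a b m)) {a, b}" "lies_over (proj (in_edge a b m))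
    {a, b}"
  by (auto simp: lies_over_def proj_out_edge proj_in_edge)

lemma cut_edge_unique:
  assumes ab: "adj a b" and cut: "cut_path (two_cover G S c) \<kappa>"
  shows "\<exists>!\<epsilon>. \<epsilon> \<in> \<kappa> \<and> lies_over \<epsilon> {a, b}"
proof -
  have sub: "\<kappa> \<subseteq> snd (two_cover G S c)"
    using cut by (simp add: cut_path_def)
  have "\<epsilon> \<in> \<kappa> \<and> lies_over \<epsilon> {a, b} \<longleftrightarrow>
      \<epsilon> \<in> \<kappa> \<and> (\<exists>m<h. \<epsilon> = proj (out_edge a b m) \<or> \<epsilon> = proj (in_edge a b m))" for \<epsilon>
    using edges_over[OF ab, of \<epsilon>] sub proj_lies_over[of a b] by auto
  then show ?thesis
    using zigzag_cycle[of a "\<lambda>_. b", OF ab cut] by simp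
qed

lemma cut_edge_props:
  assumes "adj a b" "cut_path (two_cover G S c) \<kappa>"
  shows "cut_edge \<kappa> {a, b} \<in> \<kappa>" "lies_over (cut_edge \<kappa> {a, b}) {a, b}"
  using theI'[OF cut_edge_unique[OF assms]] by (simp_all add: cut_edge_def)

lemma cut_edge_eqI:
  assumes "adj a b" "cut_path (two_cover G S c) \<kappa>" "\<epsilon> \<in> \<kappa>" "lies_over \<epsilon> {a, b}"
  shows "cut_edge \<kappa> {a, b} = \<epsilon>"
  unfolding cut_edge_def using assms by (intro the1_equality cut_edge_unique) auto

text \<open>Rerouting the zigzag over \<open>{a, b}\<close> through another neighbour of \<open>a\<close> in the block that
  contains the cut edge avoids that edge, so the new detour has to be cut.\<close>

lemma cut_edges_same_block:
  assumes ab: "adj a b" and cut: "cut_path (two_cover G S c) \<kappa>"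
  obtains m where "m < h" "\<And>d. adj a d \<Longrightarrow>
    cut_edge \<kappa> {a, d} = proj (out_edge a d m) \<or> cut_edge \<kappa> {a, d} = proj (in_edge a d m)"
proof -
  have sub: "\<kappa> \<subseteq> snd (two_cover G S c)"
    using cut by (simp add: cut_path_def)
  note \<epsilon> = cut_edge_props[OF ab cut]
  obtain m where m: "m < h" "cut_edge \<kappa> {a, b} = proj (out_edge a b m) \<or> cut_edge \<kappa> {a, b} = proj
      (in_edge a b m)"
    using edges_over[OF ab _ \<epsilon>(2)] \<epsilon>(1) sub by auto
  have "cut_edge \<kappa> {a, d} = proj (out_edge a d m) \<or> cut_edge \<kappa> {a, d} = proj (in_edge a d m)" if
      ad: "adj a d" for d
  proof -
    define f where "f k = (if k = m then d else b)" for k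
    have "adj a (f k)" for k
      using ab ad by (simp add: f_def)
    then obtain \<epsilon>' k where \<epsilon>': "\<epsilon>' \<in> \<kappa>" "k < h"
        "\<epsilon>' = proj (out_edge a (f k) k) \<or> \<epsilon>' = proj (in_edge a (f k) k)"
      using zigzag_cycle[of a f, OF _ cut] by blast
    have "k = m"
    proof (rule ccontr)
      assume "k \<noteq> m"
      then have k: "\<epsilon>' = proj (out_edge a b k) \<or> \<epsilon>' = proj (in_edge a b k)"
        using \<epsilon>'(3) by (simp add: f_def)
      then have "lies_over \<epsilon>' {a, b}"
        using proj_lies_over by auto
      then have "cut_edge \<kappa> {a, b} = \<epsilon>'"
        using \<epsilon>'(1) by (intro cut_edge_eqI ab cut)
      with k m proj_edge_inj[OF ab m(1) \<epsilon>'(2)] have "m = k" by blast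
      with \<open>k \<noteq> m\<close> show False by simp
    qed
    then have d: "\<epsilon>' = proj (out_edge a d m) \<or> \<epsilon>' = proj (in_edge a d m)"
      using \<epsilon>'(3) by (simp add: f_def)
    then have "cut_edge \<kappa> {a, d} = \<epsilon>'"
      using \<epsilon>'(1) proj_lies_over by (intro cut_edge_eqI ad cut) auto
    with d show ?thesis by simp
  qed
  with m(1) show thesis by (rule that)
qed

end

section \<open>Cells on the cylinder\<close>

lemma wrap_eq_iff:
  assumes "h > 0"
  shows "wrap h z = wrap h w \<longleftrightarrow> snd z = snd w \<and> (\<exists>k :: int. fst z = fst w + 2 * real h * of_int k)"
proof -
  have "cis a = cis b \<longleftrightarrow> (\<exists>k :: int. a = b + 2 * pi * of_int k)" for a b
    using sin_cos_eq_iff[of a b] by (auto simp: complex_eq_iff)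
  moreover have "pi * fst z / real h = pi * fst w / real h + 2 * pi * of_int k \<longleftrightarrow>
      fst z = fst w + 2 * real h * of_int k" for k :: int
  proof -
    have "pi * fst z / real h = pi * fst w / real h + 2 * pi * of_int k \<longleftrightarrow>
        pi * fst z = pi * (fst w + 2 * real h * of_int k)"
      using assms by (simp add: field_simps)
    then show ?thesis by simp
  qed
  ultimately show ?thesis
    by (auto simp: wrap_def)
qed

lemma wrap_in_cylinder [simp]: "wrap h z \<in> cylinder"
  by (simp add: wrap_def cylinder_def)

lemma snd_wrap [simp]: "snd (wrap h z) = snd z"
  by (simp add: wrap_def)

lemma wrap_surj:
  assumes "h > 0" "w \<in> cylinder"
  obtains z where "w = wrap h z"
proof -
  have n: "norm (fst w) = 1"
    using assms by (auto simp: cylinder_def)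
  then have "fst w = cis (Arg (fst w))"
    using rcis_cmod_Arg[of "fst w"] by (simp add: rcis_def)
  then have "w = wrap h (Arg (fst w) * real h / pi, snd w)"
    using assms(1) by (simp add: wrap_def prod_eq_iff)
  then show thesis by (rule that)
qed

lemma continuous_on_wrap: "continuous_on A (wrap h)"
  unfolding wrap_def by (cases "h = 0") (auto intro!: continuous_intros)

text \<open>The map \<open>(z, y) \<mapsto> exp y * z\<close> identifies the cylinder with the punctured plane and turns the
  wrapping into the complex exponential, which is open.\<close>

lemma openin_wrap:
  assumes h: "h > 0" and R: "open R"
  shows "openin (top_of_set cylinder) (wrap h ` R)"
proof -
  define \<Phi> :: "complex \<times> real \<Rightarrow> complex" where "\<Phi> w = of_real (exp (snd w)) * fst w" for w
  \<comment> \<open>Inverse of the linear map sending \<open>(X, Y)\<close> to the complex number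
    with real part \<open>Y\<close> and imaginary part \<open>pi * X / h\<close>, so that
    \<open>\<Phi>\<close> after \<open>wrap\<close> is the exponential of that number.\<close>
  define g :: "complex \<Rightarrow> real \<times> real" where "g z = (Im z * real h / pi, Re z)" for z
  have "open (g -` R)"
    using R unfolding g_def by (intro open_vimage continuous_intros) auto
  then have E: "open (exp ` (g -` R))"
    using covering_space_open_map[OF covering_space_exp_punctured_plane, of "g -` R"]
      openin_open_trans by (auto simp: openin_open_eq)
  have \<Phi>_wrap: "\<Phi> (wrap h z) = exp (Complex (snd z) (pi * fst z / real h))" for z
    by (simp add: \<Phi>_def wrap_def exp_eq_polar)
  have inj: "v = w" if "\<Phi> v = \<Phi> w" "v \<in> cylinder" "w \<in> cylinder" for v w
  proof -
    have "norm (\<Phi> z) = exp (snd z)" if "z \<in> cylinder" for z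
      using that by (auto simp: \<Phi>_def cylinder_def norm_mult)
    then have "exp (snd v) = exp (snd w)" using that by metis
    then have snd: "snd v = snd w" by simp
    moreover have "fst v = fst w" using that(1) snd by (simp add: \<Phi>_def)
    ultimately show ?thesis by (simp add: prod_eq_iff)
  qed
  have "wrap h ` R = cylinder \<inter> \<Phi> -` (exp ` (g -` R))"
  proof (intro equalityI subsetI)
    fix w assume "w \<in> wrap h ` R"
    then obtain z where z: "z \<in> R" "w = wrap h z" by auto
    have "g (Complex (snd z) (pi * fst z / real h)) = z"
      using h by (simp add: g_def prod_eq_iff)
    then show "w \<in> cylinder \<inter> \<Phi> -` (exp ` (g -` R))"
      using z \<Phi>_wrap[of z] by auto
  next
    fix w assume w: "w \<in> cylinder \<inter> \<Phi> -` (exp ` (g -` R))"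
    then obtain \<zeta> where \<zeta>: "g \<zeta> \<in> R" "\<Phi> w = exp \<zeta>" by blast
    have "\<Phi> (wrap h (g \<zeta>)) = exp \<zeta>"
      using h by (simp add: \<Phi>_wrap) (simp add: g_def)
    then have "w = wrap h (g \<zeta>)"
      using \<zeta> w by (intro inj) auto
    then show "w \<in> wrap h ` R" using \<zeta> by auto
  qed
  moreover have "open (\<Phi> -` (exp ` (g -` R)))"
    using E unfolding \<Phi>_def by (intro open_vimage continuous_intros) auto
  ultimately show ?thesis
    by (auto simp: openin_open)
qed

text \<open>Inside any connected \<open>d\<close> that contains the image of \<open>R\<close> and
  avoids \<open>D\<close>, this image is open by \<open>openin_wrap\<close> and also closed: it is
  the trace on \<open>d\<close> of the compact image of \<open>K\<close>, whose excess over the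
  image of \<open>R\<close> lies in \<open>D\<close>.\<close>

lemma wrap_component:
  assumes h: "h > 0" and R: "open R" "connected R" "R \<noteq> {}" and K: "compact K" "R \<subseteq> K"
    and disj: "wrap h ` R \<inter> D = {}" and bd: "wrap h ` (K - R) \<subseteq> D"
  shows "wrap h ` R \<in> components (cylinder - D)"
  unfolding in_components_maximal
proof (intro conjI allI impI)
  show "wrap h ` R \<noteq> {}" using R by simp
  show "wrap h ` R \<subseteq> cylinder - D" using disj by auto
  show "connected (wrap h ` R)"
    using R(2) by (intro connected_continuous_image continuous_on_wrap)
  fix d assume "d \<noteq> {} \<and> wrap h ` R \<subseteq> d \<and> d \<subseteq> cylinder - D \<and> connected d"
  then have d: "wrap h ` R \<subseteq> d" "d \<subseteq> cylinder - D" "connected d" by auto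
  have "openin (top_of_set d) (wrap h ` R)"
    using d by (intro openin_subset_trans[OF openin_wrap[OF h R(1)]]) auto
  moreover have "closedin (top_of_set d) (wrap h ` R)"
  proof -
    have "closed (wrap h ` K)"
      using K(1) by (intro compact_imp_closed compact_continuous_image continuous_on_wrap)
    moreover have "wrap h ` R = d \<inter> wrap h ` K"
      using d K(2) bd by blast
    ultimately show ?thesis
      by (simp add: closedin_closed_Int)
  qed
  ultimately show "d = wrap h ` R"
    using d(3) R(3) unfolding connected_clopen by blast
qed

text \<open>The uniqueness proofs and the intersection of the two triangles take from a tile
  boundary only this inclusion.\<close>

lemma tile_boundary_subset_closure: "tile_boundary T \<subseteq> closure T"
proof -
  have "tile_boundary T \<subseteq> top_of_set cylinder closure_of closure T"
    by (auto simp: tile_boundary_def frontier_of_def)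
  also have "\<dots> \<subseteq> closure (closure T)"
    by (metis closure_of_subtopology_subset euclidean_closure_of)
  finally show ?thesis by simp
qed

text \<open>With \<open>l = -1\<close> and \<open>u = 1\<close> the cell is a full diamond; the cells with \<open>l = 0\<close> or \<open>u = 0\<close> are
  the triangles into which its horizontal diagonal divides it.\<close>

definition cell :: "real \<Rightarrow> real \<Rightarrow> real \<Rightarrow> real \<Rightarrow> (real \<times> real) set" where
  "cell p q l u = {z. \<bar>fst z - p\<bar> + \<bar>snd z - q\<bar> < 1 \<and> l < snd z - q \<and> snd z - q < u}"

definition closed_cell :: "real \<Rightarrow> real \<Rightarrow> real \<Rightarrow> real \<Rightarrow> (real \<times> real) set" where
  "closed_cell p q l u = {z. \<bar>fst z - p\<bar> + \<bar>snd z - q\<bar> \<le> 1 \<and> l \<le> snd z - q \<and> snd z - q \<le> u}"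

lemma cell_subset: "cell p q l u \<subseteq> closed_cell p q l u"
  by (auto simp: cell_def closed_cell_def)

lemma open_cell: "open (cell p q l u)"
  unfolding cell_def by (intro open_Collect_conj open_Collect_less continuous_intros)

lemma compact_closed_cell: "compact (closed_cell p q l u)"
proof -
  have "closed (closed_cell p q l u)"
    unfolding closed_cell_def by (intro closed_Collect_conj closed_Collect_le continuous_intros)
  moreover have "closed_cell p q l u \<subseteq> {p - 1..p + 1} \<times> {q - 1..q + 1}"
    by (auto simp: closed_cell_def)
  ultimately show ?thesis
    by (metis bounded_Times bounded_closed_interval bounded_subset compact_eq_bounded_closed)
qed

context
  fixes p q l u :: real
  assumes lu: "- 1 \<le> l" "l \<le> 0" "0 \<le> u" "u \<le> 1" "l < u"
begin

lemma cell_centre: "(p, q + (l + u) / 2) \<in> cell p q l u"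
  using lu by (auto simp: cell_def)

text \<open>The cell is starlike about the point halfway between its vertical bounds. As
  \<open>l + u\<close> lies between -1 and 1, that point has 1-norm distance at most 1/2 from
  \<open>(p, q)\<close>. The same contraction yields connectedness and the closure of the
  cell.\<close>

lemma closed_cell_shrink:
  assumes z: "z \<in> closed_cell p q l u" and t: "0 < t" "t \<le> 1"
  shows "(1 - t) *\<^sub>R z + t *\<^sub>R (p, q + (l + u) / 2) \<in> cell p q l u" (is "?w \<in> _")
proof -
  have f: "fst ?w - p = (1 - t) * (fst z - p)"
    by (simp add: algebra_simps)
  have s: "snd ?w - q = (1 - t) * (snd z - q) + t * ((l + u) / 2)"
    by (simp add: algebra_simps)
  have "\<bar>fst ?w - p\<bar> + \<bar>snd ?w - q\<bar> \<le> \<bar>(1 - t) * (fst z - p)\<bar> + (\<bar>(1 - t) * (snd z - q)\<bar> + \<bar>t *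
      ((l + u) / 2)\<bar>)"
    unfolding f s by (intro add_left_mono abs_triangle_ineq)
  also have "\<dots> = (1 - t) * (\<bar>fst z - p\<bar> + \<bar>snd z - q\<bar>) + t * \<bar>(l + u) / 2\<bar>"
    using t unfolding abs_mult by (simp add: distrib_left)
  also have "\<dots> \<le> (1 - t) * 1 + t * (1 / 2)"
  proof (intro add_mono mult_left_mono)
    show "\<bar>(l + u) / 2\<bar> \<le> 1 / 2" using lu by (auto simp: abs_le_iff)
  qed (use z t in \<open>auto simp: closed_cell_def\<close>)
  also have "\<dots> < 1" using t by simp
  finally have 1: "\<bar>fst ?w - p\<bar> + \<bar>snd ?w - q\<bar> < 1" .
  have "(1 - t) * l + t * l < (1 - t) * (snd z - q) + t * ((l + u) / 2)"
    using z t lu by (intro add_le_less_mono mult_left_mono mult_strict_left_mono)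
      (auto simp: closed_cell_def)
  then have 2: "l < snd ?w - q" unfolding s by (simp add: algebra_simps)
  have "(1 - t) * (snd z - q) + t * ((l + u) / 2) < (1 - t) * u + t * u"
    using z t lu by (intro add_le_less_mono mult_left_mono mult_strict_left_mono)
      (auto simp: closed_cell_def)
  then have 3: "snd ?w - q < u" unfolding s by (simp add: algebra_simps)
  show ?thesis
    using 1 2 3 by (simp add: cell_def)
qed

lemma connected_cell: "connected (cell p q l u)"
proof (rule starlike_imp_connected)
  show "starlike (cell p q l u)"
    unfolding starlike_def
  proof (intro bexI ballI subsetI)
    fix z w assume z: "z \<in> cell p q l u" and w: "w \<in> closed_segment (p, q + (l + u) / 2) z"
    then obtain t where t: "0 \<le> t" "t \<le> 1" "w = (1 - t) *\<^sub>R (p, q + (l + u) / 2) + t *\<^sub>R z"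
      by (auto simp: closed_segment_def)
    show "w \<in> cell p q l u"
    proof (cases "t = 1")
      case True
      then show ?thesis using t z by (simp flip: zero_prod_def)
    next
      case False
      then show ?thesis
        using closed_cell_shrink[of z "1 - t"] z cell_subset[of p q l u] t
        by (auto simp: add.commute)
    qed
  qed (rule cell_centre)
qed

lemma closed_cell_subset_closure: "closed_cell p q l u \<subseteq> closure (cell p q l u)"
proof
  fix z assume z: "z \<in> closed_cell p q l u"
  define t where "t n = inverse (real (Suc n))" for n
  have "(\<lambda>n. (1 - t n) *\<^sub>R z + t n *\<^sub>R (p, q + (l + u) / 2)) \<longlonglongrightarrow> (1 - 0) *\<^sub>R z + 0 *\<^sub>R (p, q + (l +
      u) / 2)"
    unfolding t_def by (intro tendsto_intros LIMSEQ_inverse_real_of_nat)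
  then have "(\<lambda>n. (1 - t n) *\<^sub>R z + t n *\<^sub>R (p, q + (l + u) / 2)) \<longlonglongrightarrow> z"
    by (simp flip: zero_prod_def)
  moreover have "(1 - t n) *\<^sub>R z + t n *\<^sub>R (p, q + (l + u) / 2) \<in> cell p q l u" for n
    using z by (intro closed_cell_shrink) (auto simp: t_def inverse_le_1_iff)
  ultimately show "z \<in> closure (cell p q l u)"
    unfolding closure_sequential
    by (intro exI[of _ "\<lambda>n. (1 - t n) *\<^sub>R z + t n *\<^sub>R (p, q + (l + u) / 2)"]) auto
qed

lemma closure_wrap_cell: "closure (wrap h ` cell p q l u) = wrap h ` closed_cell p q l u"
proof
  have "closed (wrap h ` closed_cell p q l u)"
    by (intro compact_imp_closed compact_continuous_image continuous_on_wrap compact_closed_cell)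
  then show "closure (wrap h ` cell p q l u) \<subseteq> wrap h ` closed_cell p q l u"
    using cell_subset by (intro closure_minimal image_mono)
  have "wrap h ` closure (cell p q l u) \<subseteq> closure (wrap h ` cell p q l u)"
    by (intro image_closure_subset continuous_on_wrap closed_closure closure_subset)
  then show "wrap h ` closed_cell p q l u \<subseteq> closure (wrap h ` cell p q l u)"
    using closed_cell_subset_closure by blast
qed

lemma wrap_cell_tile:
  assumes "h > 0" "wrap h ` cell p q l u \<inter> D = {}" "wrap h ` (closed_cell p q l u - cell p q l u)
      \<subseteq> D"
  shows "wrap h ` cell p q l u \<in> components (cylinder - D)" "bounded (wrap h ` cell p q l u)"
proof -
  show "wrap h ` cell p q l u \<in> components (cylinder - D)"
    using cell_centre assms
    by (intro wrap_component[OF _ open_cell connected_cell _ compact_closed_cell cell_subset]) auto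
  have "compact (wrap h ` closed_cell p q l u)"
    by (intro compact_continuous_image continuous_on_wrap compact_closed_cell)
  then show "bounded (wrap h ` cell p q l u)"
    using cell_subset by (meson bounded_subset compact_imp_bounded image_mono)
qed

text \<open>A point on the rim leaves the closed cell when it is moved vertically outwards; as the cell
  has width at most 2, it does not enter a translate of the cell by a multiple of \<open>2h\<close> either.\<close>

lemma rim_leaves:
  assumes h: "h > 0" and z: "z \<in> closed_cell p q l u" "z \<notin> cell p q l u"
  obtains d where "\<And>t. t > 0 \<Longrightarrow> wrap h (fst z, snd z + d * t) \<notin> wrap h ` closed_cell p q l u"
proof -
  have far: "\<bar>fst z - p\<bar> \<le> \<bar>fst w - p\<bar>" and sndw: "snd w = y"
    if w: "wrap h (fst z, y) = wrap h w" for w y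
  proof -
    obtain k :: int where k: "fst z = fst w + 2 * real h * of_int k"
      and y: "snd w = y"
      using w wrap_eq_iff[OF h, of "(fst z, y)" w] by auto
    show "snd w = y" by (rule y)
    have z1: "\<bar>fst z - p\<bar> \<le> 1" using z by (auto simp: closed_cell_def)
    show "\<bar>fst z - p\<bar> \<le> \<bar>fst w - p\<bar>"
    proof (cases "k = 0")
      case True
      then show ?thesis using k by simp
    next
      case False
      then have "\<bar>real_of_int k\<bar> \<ge> 1" by linarith
      then have "real h * \<bar>real_of_int k\<bar> \<ge> 1 * 1"
        using h by (intro mult_mono) auto
      then have "\<bar>2 * real h * of_int k\<bar> \<ge> 2"
        by (simp add: abs_mult)
      then show ?thesis using k z1 by linarith
    qed
  qed
  \<comment> \<open>One case for each kind of side. The escape is upwards from the top or an upper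
    slanted side, downwards from the others.\<close>
  consider "snd z - q = u" | "snd z - q = l"
    | "\<bar>fst z - p\<bar> + \<bar>snd z - q\<bar> = 1" "snd z \<ge> q" | "\<bar>fst z - p\<bar> + \<bar>snd z - q\<bar> = 1" "snd z \<le> q"
    using z by (auto simp: cell_def closed_cell_def) fastforce
  then show thesis
  proof cases
    case 1
    have "wrap h (fst z, snd z + 1 * t) \<notin> wrap h ` closed_cell p q l u" if "t > 0" for t
      using 1 that by (auto simp: closed_cell_def dest!: sndw)
    then show thesis by (rule that)
  next
    case 2
    have "wrap h (fst z, snd z + (- 1) * t) \<notin> wrap h ` closed_cell p q l u" if "t > 0" for t
      using 2 that by (auto simp: closed_cell_def dest!: sndw)
    then show thesis by (rule that)
  next
    case 3
    have "wrap h (fst z, snd z + 1 * t) \<notin> wrap h ` closed_cell p q l u" if "t > 0" for t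
    proof
      assume "wrap h (fst z, snd z + 1 * t) \<in> wrap h ` closed_cell p q l u"
      then obtain w where w: "w \<in> closed_cell p q l u" "wrap h (fst z, snd z + 1 * t) = wrap h w"
        by auto
      then show False
        using 3 that far[OF w(2)] sndw[OF w(2)] by (auto simp: closed_cell_def)
    qed
    then show thesis by (rule that)
  next
    case 4
    have "wrap h (fst z, snd z + (- 1) * t) \<notin> wrap h ` closed_cell p q l u" if "t > 0" for t
    proof
      assume "wrap h (fst z, snd z + (- 1) * t) \<in> wrap h ` closed_cell p q l u"
      then obtain w where w: "w \<in> closed_cell p q l u" "wrap h (fst z, snd z + (- 1) * t) = wrap h
          w"
        by auto
      then show False
        using 4 that far[OF w(2)] sndw[OF w(2)] by (auto simp: closed_cell_def)
    qed
    then show thesis by (rule that)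
  qed
qed

text \<open>An arc with the tile on both sides would lie in the interior of the closure and drop out
  of the frontier. The vertical escape of \<open>rim_leaves\<close> shows that no neighbourhood of a
  rim point stays in the closed cell.\<close>

lemma rim_subset_tile_boundary:
  assumes h: "h > 0"
  shows "wrap h ` (closed_cell p q l u - cell p q l u) \<subseteq> tile_boundary (wrap h ` cell p q l u)"
proof
  fix w assume "w \<in> wrap h ` (closed_cell p q l u - cell p q l u)"
  then obtain z where z: "z \<in> closed_cell p q l u" "z \<notin> cell p q l u" "w = wrap h z" by auto
  let ?K = "wrap h ` closed_cell p q l u"
  obtain d where d: "\<And>t. t > 0 \<Longrightarrow> wrap h (fst z, snd z + d * t) \<notin> ?K"
    using rim_leaves[OF h z(1,2)] by blast
  have "w \<in> top_of_set cylinder closure_of ?K"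
    using closure_of_subset[of ?K "top_of_set cylinder"] z by (auto simp: image_subset_iff)
  moreover have "w \<notin> top_of_set cylinder interior_of ?K"
  proof
    assume "w \<in> top_of_set cylinder interior_of ?K"
    then obtain T where T: "openin (top_of_set cylinder) T" "w \<in> T" "T \<subseteq> ?K"
      by (auto simp: interior_of_def)
    then obtain U where U: "open U" "T = cylinder \<inter> U" by (auto simp: openin_open)
    define g where "g t = wrap h (fst z, snd z + d * t)" for t
    have "open (g -` U)"
      unfolding g_def wrap_def fst_conv snd_conv
      using h by (intro open_vimage[OF U(1)] continuous_intros) auto
    moreover have "0 \<in> g -` U"
      using T U z by (auto simp: g_def)
    ultimately obtain e where e: "e > 0" "ball 0 e \<subseteq> g -` U"
      using open_contains_ball by blast
    then have "g (e / 2) \<in> U" by (auto simp: subset_iff)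
    then have "g (e / 2) \<in> ?K"
      using T U by (auto simp: g_def)
    then show False
      using d[of "e / 2"] e by (simp add: g_def)
  qed
  ultimately show "w \<in> tile_boundary (wrap h ` cell p q l u)"
    by (simp add: tile_boundary_def frontier_of_def closure_wrap_cell)
qed

end

text \<open>With horizontal extent 1, the abscissa itself is the parameter of the segment.\<close>

lemma mem_unit_segment_iff:
  fixes a a' b b' :: real
  assumes "a' = a + 1"
  shows "z \<in> closed_segment (a, b) (a', b') \<longleftrightarrow>
     a \<le> fst z \<and> fst z \<le> a' \<and> snd z = b + (fst z - a) * (b' - b)"
proof
  assume "z \<in> closed_segment (a, b) (a', b')"
  then obtain t where "0 \<le> t" "t \<le> 1" "z = (1 - t) *\<^sub>R (a, b) + t *\<^sub>R (a + 1, b')"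
    using assms by (auto simp: closed_segment_def)
  then show "a \<le> fst z \<and> fst z \<le> a' \<and> snd z = b + (fst z - a) * (b' - b)"
    using assms by (simp add: left_diff_distrib right_diff_distrib distrib_left)
next
  assume *: "a \<le> fst z \<and> fst z \<le> a' \<and> snd z = b + (fst z - a) * (b' - b)"
  then have "z = (1 - (fst z - a)) *\<^sub>R (a, b) + (fst z - a) *\<^sub>R (a + 1, b')"
    by (auto simp: prod_eq_iff algebra_simps)
  then show "z \<in> closed_segment (a, b) (a', b')"
    unfolding closed_segment_def using * assms by (auto intro!: exI[of _ "fst z - a"])
qed

section \<open>The drawing of the 2-cover\<close>

text \<open>First coordinate of \<open>path_point\<close>, kept as an integer so that parity makes
  sense; the value at 0 is again a dummy.\<close>

fun path_abscissa :: "'a list \<Rightarrow> (nat \<Rightarrow> 'a) \<Rightarrow> nat \<Rightarrow> int" where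
  "path_abscissa c s 0 = 0"
| "path_abscissa c s (Suc 0) = 0"
| "path_abscissa c s (Suc (Suc j)) =
     path_abscissa c s (Suc j) + (if precedes c (s (Suc j)) (s (Suc (Suc j))) then 1 else - 1)"

definition index_abscissa ::
  "('a, 'b) monoid_scheme \<Rightarrow> 'a set \<Rightarrow> 'a list \<Rightarrow> (nat \<Rightarrow> 'a) \<Rightarrow> nat \<Rightarrow> int" where
  "index_abscissa G S c s j =
     (if j \<le> path_length G S then path_abscissa c s j
      else path_abscissa c s (branch_index G S)
        + (if precedes c (s (branch_index G S)) (s j) then 1 else - 1))"

definition gen_abscissa ::
  "('a, 'b) monoid_scheme \<Rightarrow> 'a set \<Rightarrow> 'a list \<Rightarrow> (nat \<Rightarrow> 'a) \<Rightarrow> 'a \<Rightarrow> int" where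
  "gen_abscissa G S c s a = index_abscissa G S c s (the_inv_into {1..card S} s a)"

lemma path_point_eq: "path_point c s (Suc j) = (of_int (path_abscissa c s (Suc j)), real j)"
proof (induction j)
  case (Suc j)
  then show ?case by (simp add: step_def)
qed simp

text \<open>Vertex \<open>Suc j\<close> is drawn at height \<open>j\<close>, so the coordinates of
  path vertices have even sum; this aligns the diagonal edges with the lines of
  \<open>grid\<close>.\<close>

lemma path_abscissa_parity: "even (path_abscissa c s (Suc j) + int j)"
proof (induction j)
  case (Suc j)
  then show ?case by (auto simp: add.commute)
qed simp

text \<open>Isolates the combinatorial input of the geometry: the Coxeter graph is a path, possibly
  with one more vertex attached at an interior vertex of the path.\<close>

locale coxeter_drawing =
  fixes G :: "('a, 'b) monoid_scheme" and S :: "'a set" and c :: "'a list" and s :: "nat \<Rightarrow> 'a"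
  assumes c_word: "distinct c" "set c = S" and S_ne: "S \<noteq> {}" and h_pos: "coxeter_number G c > 0"
    and bij: "bij_betw s {1..card S} S"
    and branch: "path_length G S = card S \<or>
      Suc (path_length G S) = card S \<and> 2 \<le> branch_index G S \<and> branch_index G S < path_length G S"
    and noncomm_iff: "\<And>i j. 1 \<le> i \<Longrightarrow> i < j \<Longrightarrow> j \<le> card S \<Longrightarrow> noncomm G (s i) (s j) \<longleftrightarrow>
      (j = Suc i \<and> j \<le> path_length G S) \<or>
      (i = branch_index G S \<and> j = card S \<and> path_length G S < card S)"
begin

abbreviation "n \<equiv> card S"
abbreviation "p \<equiv> path_length G S"
abbreviation "b \<equiv> branch_index G S"
abbreviation "x \<equiv> gen_abscissa G S c s"

lemma s_inj: "i \<in> {1..n} \<Longrightarrow> j \<in> {1..n} \<Longrightarrow> s i = s j \<longleftrightarrow> i = j"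
  using bij unfolding bij_betw_def inj_on_def by blast

lemma s_in: "i \<in> {1..n} \<Longrightarrow> s i \<in> S"
  using bij unfolding bij_betw_def by blast

lemma s_surj: "a \<in> S \<Longrightarrow> \<exists>i\<in>{1..n}. a = s i"
  using bij unfolding bij_betw_def by blast

lemma p_le: "p \<le> n" "p < n \<Longrightarrow> Suc p = n \<and> 2 \<le> b \<and> b < p"
  using branch by auto

lemma index_eq: "j \<in> {1..n} \<Longrightarrow> the_inv_into {1..n} s (s j) = j"
  using bij unfolding bij_betw_def by (intro the_inv_into_f_f) blast+

lemma gen_abscissa_s: "j \<in> {1..n} \<Longrightarrow> x (s j) = index_abscissa G S c s j"
  unfolding gen_abscissa_def by (simp only: index_eq)

lemma gen_abscissa_step:
  assumes "1 \<le> i" "i < j" "j \<le> n" "noncomm G (s i) (s j)"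
  shows "x (s j) = x (s i) + (if precedes c (s i) (s j) then 1 else - 1)"
proof -
  have "index_abscissa G S c s j = index_abscissa G S c s i + (if precedes c (s i) (s j) then 1
      else - 1)"
  proof (cases "j \<le> p")
    case True
    then have "j = Suc i" using assms noncomm_iff[of i j] p_le by auto
    moreover obtain i' where "i = Suc i'" using assms by (cases i) auto
    ultimately show ?thesis using True by (simp add: index_abscissa_def)
  next
    case False
    then have "i = b" "p < n" using assms noncomm_iff[of i j] by auto
    then show ?thesis using False p_le by (simp add: index_abscissa_def)
  qed
  then show ?thesis
    using assms by (simp add: gen_abscissa_s)
qed

lemma precedes_antisym:
  assumes "a \<in> S" "d \<in> S" "a \<noteq> d"
  shows "precedes c d a \<longleftrightarrow> \<not> precedes c a d"
proof -
  obtain i where i: "i < length c" "a = c ! i"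
    using assms c_word by (metis in_set_conv_nth)
  obtain j where j: "j < length c" "d = c ! j"
    using assms c_word by (metis in_set_conv_nth)
  show ?thesis
    using i j assms(3) c_word by (auto simp: precedes_iff not_less le_less)
qed

sublocale coxeter_heap G S c x
proof
  show "distinct c" "set c = S" "c \<noteq> []" "coxeter_number G c > 0"
    using c_word S_ne h_pos by auto
  fix a d assume ad: "a \<in> S" "d \<in> S" "noncomm G a d"
  then obtain i j where ij: "i \<in> {1..n}" "a = s i" "j \<in> {1..n}" "d = s j"
    using s_surj by blast
  have "a \<noteq> d" using ad by (auto simp: noncomm_def)
  then consider "i < j" | "j < i" using ij by fastforce
  then show "x d = x a + (if precedes c a d then 1 else - 1)"
  proof cases
    case 1
    then show ?thesis using gen_abscissa_step[of i j] ij ad by auto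
  next
    case 2
    have "noncomm G d a" using ad by (auto simp: noncomm_def)
    then have "x a = x d + (if precedes c d a then 1 else - 1)"
      using 2 gen_abscissa_step[of j i] ij by auto
    then show ?thesis
      using precedes_antisym[OF ad(1,2) \<open>a \<noteq> d\<close>] by auto
  qed
qed

lemma adj_iff:
  assumes "i \<in> {1..n}" "j \<in> {1..n}"
  shows "adj (s j) (s i) \<longleftrightarrow>
    (i = Suc j \<and> i \<le> p) \<or> (j = Suc i \<and> j \<le> p) \<or> (p < n \<and> (j = b \<and> i = n \<or> j = n \<and> i = b))"
proof -
  have bn: "p < n \<Longrightarrow> b < n" using p_le by auto
  consider "i = j" | "i < j" | "j < i" by linarith
  then show ?thesis
  proof cases
    case 1
    then show ?thesis using bn adj_irrefl by auto
  next
    case 2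
    then have "adj (s j) (s i) \<longleftrightarrow> noncomm G (s i) (s j)"
      using assms s_in by (auto simp: adj_def noncomm_def)
    then show ?thesis using 2 assms noncomm_iff[of i j] bn by auto
  next
    case 3
    then have "adj (s j) (s i) \<longleftrightarrow> noncomm G (s j) (s i)"
      using assms s_in by (auto simp: adj_def)
    then show ?thesis using 3 assms noncomm_iff[of j i] bn by auto
  qed
qed

definition height :: "nat \<Rightarrow> real" where
  "height j = (if j \<le> p then real j - 1 else real b - 1)"

lemma letter_point_s:
  assumes "j \<in> {1..n}"
  shows "letter_point G S c s (s j, m) = (of_int (x (s j)) + 2 * real m, height j)"
proof -
  have "first_copy_point G S c s j = (of_int (index_abscissa G S c s j), height j)"
  proof (cases "j \<le> p")
    case True
    then show ?thesis
      using assms path_point_eq[of c s "j - 1"]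
      by (simp add: first_copy_point_def index_abscissa_def height_def)
  next
    case False
    then have "2 \<le> b" "b < p" using assms p_le by auto
    then show ?thesis
      using False path_point_eq[of c s "b - 1"]
      by (simp add: first_copy_point_def index_abscissa_def height_def step_def)
  qed
  then show ?thesis
    using assms unfolding letter_point_def fst_conv snd_conv index_eq[OF assms]
    by (simp add: gen_abscissa_s)
qed

lemma gen_abscissa_parity:
  assumes "j \<in> {1..p}"
  shows "\<exists>k :: int. of_int (x (s j)) + (real j - 1) = 2 * of_int k"
    "\<exists>k :: int. of_int (x (s j)) - (real j - 1) = 2 * of_int k"
proof -
  obtain i where j: "j = Suc i" using assms by (cases j) auto
  have xj: "x (s j) = path_abscissa c s (Suc i)"
    using assms p_le gen_abscissa_s[of j] by (simp add: index_abscissa_def j)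
  obtain k where k: "x (s j) + int i = 2 * k"
    using path_abscissa_parity[of c s i] unfolding xj by (elim evenE)
  then have "real_of_int (x (s j)) + real i = 2 * of_int k"
    by (metis of_int_add of_int_mult of_int_numeral of_int_of_nat_eq)
  then show "\<exists>k :: int. of_int (x (s j)) + (real j - 1) = 2 * of_int k"
    "\<exists>k :: int. of_int (x (s j)) - (real j - 1) = 2 * of_int k"
    using j by (auto intro: exI[of _ k] exI[of _ "k - int i"])
qed

lemma out_segment:
  assumes "i \<in> {1..n}" "j \<in> {1..n}" "adj (s j) (s i)"
  shows "letter_segment G S c s (out_edge (s j) (s i) m) =
    closed_segment (of_int (x (s j)) + 2 * real m, height j)
      (of_int (x (s j)) + 2 * real m + 1, height i)"
proof -
  have "real_of_int (x (s i)) + 2 * real (offset (s j) (s i)) = of_int (x (s j)) + 1"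
    using offset[OF assms(3)] by linarith
  then show ?thesis
    using assms by (simp add: letter_segment_def out_edge_def letter_point_s algebra_simps)
qed

lemma in_segment:
  assumes "i \<in> {1..n}" "j \<in> {1..n}" "adj (s j) (s i)"
  shows "letter_segment G S c s (in_edge (s j) (s i) m) =
    closed_segment (of_int (x (s j)) + 2 * real m + 1, height i)
      (of_int (x (s j)) + 2 * real m + 2, height j)"
proof -
  have "real_of_int (x (s i)) + 2 * real (offset (s j) (s i)) = of_int (x (s j)) + 1"
    using offset[OF assms(3)] by linarith
  then show ?thesis
    using assms by (simp add: letter_segment_def in_edge_def letter_point_s algebra_simps)
qed

text \<open>The union in \<open>edge_arc\<close> runs over all lifts. Equal residues of the sources
  give a shift by \<open>h * q\<close> copies, and the abscissa equation forces the same shift on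
  the targets; so the lifts are translates by \<open>2 * h * q\<close>, which \<open>wrap\<close>
  does not see.\<close>

lemma edge_arc_proj:
  assumes \<eta>: "\<eta> \<in> hasse_edges G (inf_word c)"
  shows "edge_arc G S c s (proj \<eta>) = wrap h ` letter_segment G S c s \<eta>"
proof -
  obtain a d m k where ad: "\<eta> = ((a, m), (d, k))" "adj a d" "x d + 2 * int k = x a + 2 * int m + 1"
    using \<eta> unfolding hasse_edges_eq by blast
  have "wrap h ` letter_segment G S c s \<eta>' = wrap h ` letter_segment G S c s \<eta>"
    if \<eta>': "\<eta>' \<in> hasse_edges G (inf_word c)" "proj \<eta>' = proj \<eta>" for \<eta>'
  proof -
    obtain a' d' m' k' where ad': "\<eta>' = ((a', m'), (d', k'))"
        "x d' + 2 * int k' = x a' + 2 * int m' + 1"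
      using \<eta>'(1) unfolding hasse_edges_eq by blast
    have same: "a' = a" "d' = d" "m' mod h = m mod h"
      using \<eta>'(2) ad ad' by (auto simp: proj_def pr_def)
    then have "int h dvd int m' - int m"
      by (simp add: mod_eq_dvd_iff[symmetric] flip: zmod_int)
    then obtain q where q: "int m' - int m = int h * q" by (elim dvdE)
    have q': "int k' - int k = int h * q"
      using q same ad(3) ad'(2) by simp
    define v :: "real \<times> real" where "v = (2 * real h * of_int q, 0)"
    have qr: "real m' = real m + real h * of_int q" "real k' = real k + real h * of_int q"
      using arg_cong[OF q, of real_of_int] arg_cong[OF q', of real_of_int] by auto
    have "letter_point G S c s (a', m') = v + letter_point G S c s (a, m)"
      "letter_point G S c s (d', k') = v + letter_point G S c s (d, k)"
      using same qr by (simp_all add: letter_point_def v_def prod_eq_iff)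
    then have "letter_segment G S c s \<eta>' = (\<lambda>z. v + z) ` letter_segment G S c s \<eta>"
      unfolding letter_segment_def ad(1) ad'(1) fst_conv snd_conv
      by (simp only: closed_segment_translation)
    moreover have "wrap h (v + z) = wrap h z" for z
      by (subst wrap_eq_iff[OF h]) (auto simp: v_def)
    ultimately show ?thesis by (simp add: image_image)
  qed
  then show ?thesis
    using \<eta> unfolding edge_arc_def proj_def[symmetric] by blast
qed

lemma edge_arc_subset_drawing:
  "\<eta> \<in> hasse_edges G (inf_word c) \<Longrightarrow> wrap h ` letter_segment G S c s \<eta> \<subseteq> drawing G S c s"
  by (auto simp: drawing_def)

lemma letter_in_drawing: "a \<in> S \<Longrightarrow> wrap h (letter_point G S c s (a, m)) \<in> drawing G S c s"
proof -
  assume "a \<in> S"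
  then obtain i where "c ! (i mod length c) = a" "i div length c = m"
    using position_exists by blast
  then have "(a, m) = letter (inf_word c) i"
    using c by (simp add: letter_inf_word)
  then show ?thesis by (auto simp: drawing_def)
qed

text \<open>All diagonal edges lie on lines on which one of \<open>X + Y\<close> and \<open>X - Y\<close> is a constant even
  integer.\<close>

definition grid :: "(real \<times> real) set" where
  "grid = {z. (\<exists>k :: int. fst z + snd z = 2 * of_int k) \<or>
     (\<exists>k :: int. fst z - snd z = 2 * of_int k) \<or>
     p < n \<and> snd z = real b - 1}"

lemma grid_shift: "(\<xi> + 2 * of_int k, y) \<in> grid \<longleftrightarrow> (\<xi>, y) \<in> grid" for k :: int
proof -
  have "(\<xi> + 2 * of_int k, y) \<in> grid" if "(\<xi>, y) \<in> grid" for \<xi> y and k :: int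
  proof -
    have "\<exists>l :: int. \<xi> + 2 * of_int k + y = 2 * of_int l" if "\<xi> + y = 2 * of_int m" for m :: int
      using that by (intro exI[of _ "m + k"]) simp
    moreover have "\<exists>l :: int. \<xi> + 2 * of_int k - y = 2 * of_int l" if "\<xi> - y = 2 * of_int m" for m
        :: int
      using that by (intro exI[of _ "m + k"]) simp
    ultimately show ?thesis using that by (auto simp: grid_def)
  qed
  from this[of \<xi> y k] this[of "\<xi> + 2 * of_int k" y "- k"] show ?thesis by auto
qed

lemma letter_point_grid:
  assumes "a \<in> S"
  shows "letter_point G S c s (a, m) \<in> grid"
proof -
  obtain j where j: "j \<in> {1..n}" "a = s j" using s_surj assms by blast
  have "(of_int (x (s j)), height j) \<in> grid"
  proof (cases "j \<le> p")
    case True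
    then show ?thesis using gen_abscissa_parity(1)[of j] j by (auto simp: grid_def height_def)
  next
    case False
    then show ?thesis using j by (auto simp: grid_def height_def)
  qed
  then show ?thesis
    using grid_shift[of "of_int (x (s j))" "int m" "height j"] j by (simp add: letter_point_s)
qed

lemma out_segment_grid:
  assumes ij: "i \<in> {1..n}" "j \<in> {1..n}" "adj (s j) (s i)"
    and z: "z \<in> letter_segment G S c s (out_edge (s j) (s i) m)"
  shows "z \<in> grid"
proof -
  let ?X = "of_int (x (s j)) + 2 * real m"
  have seg: "snd z = height j + (fst z - ?X) * (height i - height j)"
    using z unfolding out_segment[OF ij] by (simp add: mem_unit_segment_iff)
  consider "i = Suc j" "i \<le> p" | "j = Suc i" "j \<le> p" | "p < n" "height i = real b - 1" "height j =
      real b - 1"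
    using ij adj_iff[OF ij(1,2)] p_le by (auto simp: height_def)
  then show ?thesis
  proof cases
    case 1
    then obtain k :: int where "of_int (x (s j)) - (real j - 1) = 2 * of_int k"
      using gen_abscissa_parity(2)[of j] ij by auto
    then have "fst z - snd z = 2 * of_int (k + int m)"
      using seg 1 by (simp add: height_def)
    then show ?thesis unfolding grid_def by blast
  next
    case 2
    then obtain k :: int where "of_int (x (s j)) + (real j - 1) = 2 * of_int k"
      using gen_abscissa_parity(1)[of j] ij by auto
    then have "fst z + snd z = 2 * of_int (k + int m)"
      using seg 2 by (simp add: height_def)
    then show ?thesis unfolding grid_def by blast
  next
    case 3
    then show ?thesis using seg by (auto simp: grid_def)
  qed
qed

text \<open>Every edge is an out-edge of its source, so \<open>out_segment_grid\<close> covers the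
  whole drawing.\<close>

lemma hasse_edge_is_out_edge:
  assumes "\<eta> \<in> hasse_edges G (inf_word c)"
  obtains i j m where "i \<in> {1..n}" "j \<in> {1..n}" "adj (s j) (s i)" "\<eta> = out_edge (s j) (s i) m"
proof -
  obtain a d m k where ad: "\<eta> = ((a, m), (d, k))" "adj a d" "x d + 2 * int k = x a + 2 * int m + 1"
    using assms unfolding hasse_edges_eq by blast
  then have "k = m + offset a d" using offset[OF ad(2)] by simp
  moreover obtain i j where "i \<in> {1..n}" "j \<in> {1..n}" "a = s j" "d = s i"
    using ad(2) s_surj unfolding adj_def by metis
  ultimately show thesis
    using that ad by (auto simp: out_edge_def)
qed

text \<open>The grid has period 2, hence \<open>2 * h\<close>, so it contains the full preimage of
  the drawing. Disjointness of a cell from the drawing thus becomes a check against three families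
  of lines.\<close>

lemma wrap_drawing_grid:
  assumes "wrap h z \<in> drawing G S c s"
  shows "z \<in> grid"
proof -
  obtain w where w: "w \<in> grid" "wrap h z = wrap h w"
  proof -
    consider \<sigma> where "\<sigma> \<in> range (letter (inf_word c))" "wrap h z = wrap h (letter_point G S c s \<sigma>)"
      | \<eta> w where "\<eta> \<in> hasse_edges G (inf_word c)" "w \<in> letter_segment G S c s \<eta>" "wrap h z = wrap
          h w"
      using assms unfolding drawing_def by blast
    then show thesis
    proof cases
      case 1
      then obtain i where "\<sigma> = (c ! (i mod length c), i div length c)"
        using c by (auto simp: letter_inf_word)
      moreover have "c ! (i mod length c) \<in> S" using c by auto
      ultimately show thesis
        using 1 letter_point_grid that by blast
    next
      case 2
      then show thesis
        using hasse_edge_is_out_edge[OF 2(1)] out_segment_grid that by metis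
    qed
  qed
  then obtain k :: int where k: "fst z = fst w + 2 * real h * of_int k" "snd z = snd w"
    using wrap_eq_iff[OF h] by auto
  then have "z = (fst w + 2 * of_int (int h * k), snd w)"
    by (simp add: prod_eq_iff)
  then show ?thesis
    using w(1) grid_shift[of "fst w" "int h * k" "snd w"] by simp
qed

lemma between_even: "2 * real_of_int k < 2 * of_int l \<Longrightarrow> 2 * of_int l < 2 * real_of_int k + 2 \<Longrightarrow>
    False"
proof -
  assume "2 * real_of_int k < 2 * of_int l" "2 * of_int l < 2 * real_of_int k + 2"
  then have "k < l" "l < k + 1" by linarith+
  then show False by simp
qed

text \<open>The cells around an interior vertex \<open>j\<close> of the path: the full diamonds, unless \<open>j\<close> is the
  branch vertex, whose horizontal edges cut them into triangles.\<close>

definition cell_type :: "nat \<Rightarrow> real \<Rightarrow> real \<Rightarrow> bool" where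
  "cell_type j l u \<longleftrightarrow>
     (if p < n \<and> j = b then l = - 1 \<and> u = 0 \<or> l = 0 \<and> u = 1 else l = - 1 \<and> u = 1)"

text \<open>Centred halfway between the copies \<open>(s j, m)\<close> and
  \<open>(s j, m + 1)\<close>.\<close>

definition tile_cell :: "nat \<Rightarrow> nat \<Rightarrow> real \<Rightarrow> real \<Rightarrow> (real \<times> real) set" where
  "tile_cell j m l u = cell (of_int (x (s j)) + 2 * real m + 1) (real j - 1) l u"

definition closed_tile_cell :: "nat \<Rightarrow> nat \<Rightarrow> real \<Rightarrow> real \<Rightarrow> (real \<times> real) set" where
  "closed_tile_cell j m l u = closed_cell (of_int (x (s j)) + 2 * real m + 1) (real j - 1) l u"

lemma cell_type_bounds:
  "cell_type j l u \<Longrightarrow> - 1 \<le> l \<and> l \<le> 0 \<and> 0 \<le> u \<and> u \<le> 1 \<and> l < u"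
  by (auto simp: cell_type_def split: if_splits)

section \<open>Diamonds and triangles at an interior vertex of the path\<close>

context
  fixes j :: nat
  assumes j: "2 \<le> j" "j < p"
begin

lemma j_range: "j \<in> {1..n}" "j - 1 \<in> {1..n}" "Suc j \<in> {1..n}"
  using j p_le by auto

lemma j_adj: "adj (s j) (s (j - 1))" "adj (s j) (s (Suc j))" "p < n \<Longrightarrow> j = b \<Longrightarrow> adj (s j) (s n)"
proof -
  have "Suc (j - 1) = j" "Suc j \<le> p" "j \<le> p" using j by auto
  then show "adj (s j) (s (j - 1))" "adj (s j) (s (Suc j))"
    using j_range by (simp_all add: adj_iff)
  assume "p < n" "j = b"
  then show "adj (s j) (s n)"
    using j_range by (subst adj_iff) auto
qed

lemma j_height: "height j = real j - 1" "height (j - Suc 0) = real j - 2" "height (Suc j) = real j"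
    "p < n \<Longrightarrow> j = b \<Longrightarrow> height n = real j - 1"
  using j p_le by (auto simp: height_def)

text \<open>On the open diamond both \<open>X + Y\<close> and \<open>X - Y\<close> lie strictly
  between consecutive even integers. Heights of vertices being integers, a horizontal grid line can
  enter only if it is the level of \<open>j\<close> itself, that is \<open>b = j\<close>, and then
  the triangles exclude it.\<close>

lemma tile_cell_grid:
  assumes lu: "cell_type j l u" and z: "z \<in> tile_cell j m l u"
  shows "z \<notin> grid"
proof
  assume g: "z \<in> grid"
  let ?X = "of_int (x (s j)) + 2 * real m"
  have z': "\<bar>fst z - (?X + 1)\<bar> + \<bar>snd z - (real j - 1)\<bar> < 1" "l < snd z - (real j - 1)" "snd z -
      (real j - 1) < u"
    using z by (auto simp: tile_cell_def cell_def)
  have jp: "j \<in> {1..p}" using j by auto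
  obtain k :: int where k: "of_int (x (s j)) + (real j - 1) = 2 * of_int k"
    using gen_abscissa_parity(1)[OF jp] by auto
  obtain k' :: int where k': "of_int (x (s j)) - (real j - 1) = 2 * of_int k'"
    using gen_abscissa_parity(2)[OF jp] by auto
  consider i :: int where "fst z + snd z = 2 * of_int i" | i :: int where "fst z - snd z = 2 *
      of_int i"
    | "p < n" "snd z = real b - 1"
    using g by (auto simp: grid_def)
  then show False
  proof cases
    case 1
    have "2 * real_of_int (k + int m) < 2 * of_int i" "2 * of_int i < 2 * real_of_int (k + int m)
        + 2"
      using 1 z'(1) k by auto
    then show False by (rule between_even)
  next
    case 2
    have "2 * real_of_int (k' + int m) < 2 * of_int i" "2 * of_int i < 2 * real_of_int (k' + int
        m) + 2"
      using 2 z'(1) k' by auto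
    then show False by (rule between_even)
  next
    case 3
    then have "\<bar>real b - real j\<bar> < 1" using z'(1) by auto
    then have "b = j" by linarith
    then show False
      using 3 z' lu by (auto simp: cell_type_def)
  qed
qed

lemma tile_cell_disjoint:
  assumes "cell_type j l u"
  shows "wrap h ` tile_cell j m l u \<inter> drawing G S c s = {}"
proof (rule ccontr)
  assume "wrap h ` tile_cell j m l u \<inter> drawing G S c s \<noteq> {}"
  then obtain z where "z \<in> tile_cell j m l u" "wrap h z \<in> drawing G S c s" by blast
  then show False
    using tile_cell_grid[OF assms] wrap_drawing_grid by blast
qed

lemma out_arc_in_drawing:
  assumes "i \<in> {1..n}" "adj (s j) (s i)"
    "z \<in> closed_segment (of_int (x (s j)) + 2 * real m, real j - 1) (of_int (x (s j)) + 2 * real m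
        + 1, height i)"
  shows "wrap h z \<in> drawing G S c s"
proof -
  have "z \<in> letter_segment G S c s (out_edge (s j) (s i) m)"
    using assms by (simp add: out_segment[OF assms(1) j_range(1) assms(2)] j_height)
  then show ?thesis
    using edge_arc_subset_drawing[OF out_edge_hasse[OF assms(2)]] by blast
qed

lemma in_arc_in_drawing:
  assumes "i \<in> {1..n}" "adj (s j) (s i)"
    "z \<in> closed_segment (of_int (x (s j)) + 2 * real m + 1, height i) (of_int (x (s j)) + 2 * real
        m + 2, real j - 1)"
  shows "wrap h z \<in> drawing G S c s"
proof -
  have "z \<in> letter_segment G S c s (in_edge (s j) (s i) m)"
    using assms by (simp add: in_segment[OF assms(1) j_range(1) assms(2)] j_height)
  then show ?thesis
    using edge_arc_subset_drawing[OF in_edge_hasse[OF assms(2)]] by blast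
qed

text \<open>The two edges at a copy of \<open>s n\<close> join consecutive copies of
  \<open>s b\<close>, so the level of the branch vertex is drawn without gaps.\<close>

lemma base_in_drawing:
  assumes "p < n" "j = b" "of_int (x (s j)) + 2 * real m \<le> \<xi>" "\<xi> \<le> of_int (x (s j)) + 2 * real m +
      2"
  shows "wrap h (\<xi>, real j - 1) \<in> drawing G S c s"
proof (cases "\<xi> \<le> of_int (x (s j)) + 2 * real m + 1")
  case True
  then show ?thesis
    using assms j_range j_adj(3) j_height(4)
    by (intro out_arc_in_drawing[of n _ m]) (auto simp: mem_unit_segment_iff)
next
  case False
  then show ?thesis
    using assms j_range j_adj(3) j_height(4)
    by (intro in_arc_in_drawing[of n _ m]) (auto simp: mem_unit_segment_iff)
qed

text \<open>The slanted sides are the edges joining two consecutive copies of \<open>s j\<close> to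
  the letters of \<open>s (j - 1)\<close> and \<open>s (Suc j)\<close> between them; a triangle is
  closed by the edges at \<open>s n\<close>.\<close>

lemma tile_cell_rim:
  assumes lu: "cell_type j l u"
  shows "wrap h ` (closed_tile_cell j m l u - tile_cell j m l u) \<subseteq> drawing G S c s"
proof
  fix w assume "w \<in> wrap h ` (closed_tile_cell j m l u - tile_cell j m l u)"
  then obtain z where z: "w = wrap h z" "z \<in> closed_tile_cell j m l u" "z \<notin> tile_cell j m l u"
    by auto
  let ?X = "of_int (x (s j)) + 2 * real m"
  have z': "\<bar>fst z - (?X + 1)\<bar> + \<bar>snd z - (real j - 1)\<bar> \<le> 1" "l \<le> snd z - (real j - 1)" "snd z -
      (real j - 1) \<le> u"
    "\<not> (\<bar>fst z - (?X + 1)\<bar> + \<bar>snd z - (real j - 1)\<bar> < 1 \<and> l < snd z - (real j - 1) \<and> snd z - (real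
        j - 1) < u)"
    using z by (auto simp: tile_cell_def closed_tile_cell_def cell_def closed_cell_def)
  show "w \<in> drawing G S c s"
  proof (cases "\<bar>fst z - (?X + 1)\<bar> + \<bar>snd z - (real j - 1)\<bar> = 1")
    case True
    consider "snd z \<ge> real j - 1" "fst z \<le> ?X + 1" | "snd z \<ge> real j - 1" "fst z \<ge> ?X + 1"
      | "snd z \<le> real j - 1" "fst z \<le> ?X + 1" | "snd z \<le> real j - 1" "fst z \<ge> ?X + 1"
      by linarith
    then show ?thesis
    proof cases
      case 1
      then show ?thesis
        unfolding z(1) using True
        by (intro out_arc_in_drawing[OF j_range(3) j_adj(2), of _ m]) (auto simp:
            mem_unit_segment_iff j_height)
    next
      case 2
      then show ?thesis
        unfolding z(1) using True
        by (intro in_arc_in_drawing[OF j_range(3) j_adj(2), of _ m]) (auto simp: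
            mem_unit_segment_iff j_height)
    next
      case 3
      then show ?thesis
        unfolding z(1) using True
        by (intro out_arc_in_drawing[OF j_range(2) j_adj(1), of _ m]) (auto simp:
            mem_unit_segment_iff j_height)
    next
      case 4
      then show ?thesis
        unfolding z(1) using True
        by (intro in_arc_in_drawing[OF j_range(2) j_adj(1), of _ m]) (auto simp:
            mem_unit_segment_iff j_height)
    qed
  next
    case False
    with z' have lt: "\<bar>fst z - (?X + 1)\<bar> + \<bar>snd z - (real j - 1)\<bar> < 1"
      and eq: "snd z - (real j - 1) = l \<or> snd z - (real j - 1) = u" by auto
    have b: "p < n" "j = b"
      using lt eq lu by (auto simp: cell_type_def split: if_splits)
    have "z = (fst z, real j - 1)"
      using lt eq lu b by (auto simp: cell_type_def prod_eq_iff)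
    then show ?thesis
      unfolding z(1) using base_in_drawing[OF b, of m "fst z"] lt by (smt (verit))
  qed
qed

lemma tile_cell_tile:
  assumes lu: "cell_type j l u"
  shows "tile G S c s (wrap h ` tile_cell j m l u)"
proof -
  from cell_type_bounds[OF lu] have "- 1 \<le> l" "l \<le> 0" "0 \<le> u" "u \<le> 1" "l < u" by auto
  note * = wrap_cell_tile[OF this h tile_cell_disjoint[OF lu, unfolded tile_cell_def]
      tile_cell_rim[OF lu, unfolded tile_cell_def closed_tile_cell_def]]
  show ?thesis
    unfolding tile_def tile_cell_def by (intro conjI *)
qed

lemma tile_cell_boundary:
  assumes lu: "cell_type j l u"
  shows "wrap h ` (closed_tile_cell j m l u - tile_cell j m l u) \<subseteq> tile_boundary (wrap h `
      tile_cell j m l u)"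
proof -
  from cell_type_bounds[OF lu] have "- 1 \<le> l" "l \<le> 0" "0 \<le> u" "u \<le> 1" "l < u" by auto
  from rim_subset_tile_boundary[OF this h] show ?thesis
    unfolding tile_cell_def closed_tile_cell_def .
qed

lemma closure_tile_cell:
  assumes lu: "cell_type j l u"
  shows "closure (wrap h ` tile_cell j m l u) = wrap h ` closed_tile_cell j m l u"
proof -
  from cell_type_bounds[OF lu] have "- 1 \<le> l" "l \<le> 0" "0 \<le> u" "u \<le> 1" "l < u" by auto
  from closure_wrap_cell[OF this] show ?thesis
    unfolding tile_cell_def closed_tile_cell_def .
qed

lemma tile_eqI:
  assumes "tile G S c s T" "cell_type j l u" "T \<inter> wrap h ` tile_cell j m l u \<noteq> {}"
  shows "T = wrap h ` tile_cell j m l u"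
proof -
  have "T \<in> components (cylinder - drawing G S c s)"
    "wrap h ` tile_cell j m l u \<in> components (cylinder - drawing G S c s)"
    using assms(1) tile_cell_tile[OF assms(2), of m] by (simp_all add: tile_def)
  then show ?thesis
    using assms(3) by (rule iffD2[OF components_eq])
qed

text \<open>A fundamental domain of width \<open>2 * h\<close> is cut into windows of width 2 at the
  copies of \<open>s j\<close>. The floor finds the window, and reducing its index modulo
  \<open>h\<close> is compensated by a translation.\<close>

lemma level_point:
  assumes "w \<in> cylinder"
  obtains m \<xi> where "m < h" "w = wrap h (\<xi>, snd w)" "of_int (x (s j)) + 2 * real m \<le> \<xi>"
    "\<xi> < of_int (x (s j)) + 2 * real m + 2"
proof -
  obtain z where z: "w = wrap h z" using wrap_surj[OF h assms] .
  define k where "k = \<lfloor>(fst z - of_int (x (s j))) / 2\<rfloor>"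
  have k: "of_int k \<le> (fst z - of_int (x (s j))) / 2" "(fst z - of_int (x (s j))) / 2 < of_int k +
      1"
    unfolding k_def by linarith+
  define m where "m = nat (k mod int h)"
  have m: "int m = k mod int h" using h by (simp add: m_def)
  have "m < h" using h by (simp add: m_def nat_less_iff)
  have "int m = k - int h * (k div int h)"
    using m by (simp add: minus_mult_div_eq_mod)
  then have "real m = of_int k - real h * of_int (k div int h)"
    by (metis of_int_diff of_int_mult of_int_of_nat_eq)
  moreover have "wrap h z = wrap h (fst z - 2 * real h * of_int (k div int h), snd z)"
    by (subst wrap_eq_iff[OF h]) auto
  ultimately show thesis
    using k z \<open>m < h\<close> by (intro that[of m "fst z - 2 * real h * of_int (k div int h)"]) auto
qed

text \<open>One formula for both halves of a block: the height departs from level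
  \<open>j - 1\<close> in proportion to \<open>1 - \<bar>X - q\<bar>\<close>. Which half was cut
  survives only in \<open>\<xi>\<close>.\<close>

lemma edge_arc_cut:
  assumes i: "i \<in> {1..n}" "adj (s j) (s i)"
    and \<epsilon>: "\<epsilon> = proj (out_edge (s j) (s i) m) \<or> \<epsilon> = proj (in_edge (s j) (s i) m)"
    and q: "q = of_int (x (s j)) + 2 * real m + 1"
  obtains \<xi> where "\<xi> = q - 1 \<or> \<xi> = q"
    "edge_arc G S c s \<epsilon> = wrap h ` {z. \<xi> \<le> fst z \<and> fst z \<le> \<xi> + 1 \<and>
        snd z = real j - 1 + (1 - \<bar>fst z - q\<bar>) * (height i - (real j - 1))}"
  using \<epsilon>
proof
  assume "\<epsilon> = proj (out_edge (s j) (s i) m)"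
  then have "edge_arc G S c s \<epsilon> = wrap h ` letter_segment G S c s (out_edge (s j) (s i) m)"
    using edge_arc_proj[OF out_edge_hasse[OF i(2)]] by simp
  also have "letter_segment G S c s (out_edge (s j) (s i) m) = {z. q - 1 \<le> fst z \<and> fst z \<le> (q - 1)
      + 1 \<and>
        snd z = real j - 1 + (1 - \<bar>fst z - q\<bar>) * (height i - (real j - 1))}"
    unfolding out_segment[OF i(1) j_range(1) i(2)] j_height by (auto simp: mem_unit_segment_iff q)
  finally show thesis by (rule that[OF disjI1[OF HOL.refl]])
next
  assume "\<epsilon> = proj (in_edge (s j) (s i) m)"
  then have "edge_arc G S c s \<epsilon> = wrap h ` letter_segment G S c s (in_edge (s j) (s i) m)"
    using edge_arc_proj[OF in_edge_hasse[OF i(2)]] by simp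
  also have "letter_segment G S c s (in_edge (s j) (s i) m) = {z. q \<le> fst z \<and> fst z \<le> q + 1 \<and>
        snd z = real j - 1 + (1 - \<bar>fst z - q\<bar>) * (height i - (real j - 1))}"
  proof (rule Set.set_eqI)
    fix z
    have "z \<in> closed_segment (q, height i) (q + 1, real j - 1) \<longleftrightarrow>
        q \<le> fst z \<and> fst z \<le> q + 1 \<and> snd z = height i + (fst z - q) * (real j - 1 - height i)"
      by (rule mem_unit_segment_iff) simp
    moreover have "height i + t * (real j - 1 - height i) = real j - 1 + (1 - t) * (height i -
        (real j - 1))" for t
      by (simp add: algebra_simps)
    moreover have "q + 1 = of_int (x (s j)) + 2 * real m + 2" by (simp add: q)
    ultimately show "z \<in> letter_segment G S c s (in_edge (s j) (s i) m) \<longleftrightarrow> z \<in> {z. q \<le> fst z \<and> fst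
        z \<le> q + 1 \<and>
        snd z = real j - 1 + (1 - \<bar>fst z - q\<bar>) * (height i - (real j - 1))}"
      unfolding in_segment[OF i(1) j_range(1) i(2)] j_height q[symmetric] by auto
  qed
  finally show thesis by (rule that[OF disjI2[OF HOL.refl]])
qed

text \<open>The midpoint lies off the level of \<open>j\<close> for a diagonal edge, and its
  distance 1/2 from the centre identifies the block.\<close>

lemma edge_arc_midpoint:
  assumes i: "i \<in> {1..n}" "adj (s j) (s i)"
    and \<epsilon>: "\<epsilon> = proj (out_edge (s j) (s i) m) \<or> \<epsilon> = proj (in_edge (s j) (s i) m)"
  obtains \<xi> where "\<bar>\<xi> - (of_int (x (s j)) + 2 * real m + 1)\<bar> = 1 / 2"
    "wrap h (\<xi>, (real j - 1 + height i) / 2) \<in> edge_arc G S c s \<epsilon>"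
proof -
  let ?c = "of_int (x (s j)) + 2 * real m + 1"
  obtain \<xi> where \<xi>: "\<xi> = ?c - 1 \<or> \<xi> = ?c" "edge_arc G S c s \<epsilon> = wrap h `
      {z. \<xi> \<le> fst z \<and> fst z \<le> \<xi> + 1 \<and>
        snd z = real j - 1 + (1 - \<bar>fst z - ?c\<bar>) * (height i - (real j - 1))}"
    using edge_arc_cut[OF assms HOL.refl] .
  then have "\<bar>(\<xi> + 1 / 2) - ?c\<bar> = 1 / 2" by auto
  moreover from this have "wrap h (\<xi> + 1 / 2, (real j - 1 + height i) / 2) \<in> edge_arc G S c s \<epsilon>"
    unfolding \<xi>(2) by (intro imageI) (simp add: field_simps)
  ultimately show thesis by (rule that)
qed

lemma edge_arc_subset_boundary:
  assumes i: "i \<in> {1..n}" "adj (s j) (s i)"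
    and \<epsilon>: "\<epsilon> = proj (out_edge (s j) (s i) m) \<or> \<epsilon> = proj (in_edge (s j) (s i) m)"
    and lu: "cell_type j l u"
    and side: "i = j - 1 \<and> l = - 1 \<or> i = Suc j \<and> u = 1 \<or> p < n \<and> j = b \<and> i = n"
  shows "edge_arc G S c s \<epsilon> \<subseteq> tile_boundary (wrap h ` tile_cell j m l u)"
proof -
  let ?c = "of_int (x (s j)) + 2 * real m + 1"
  obtain \<xi> where \<xi>: "\<xi> = ?c - 1 \<or> \<xi> = ?c" "edge_arc G S c s \<epsilon> = wrap h `
      {z. \<xi> \<le> fst z \<and> fst z \<le> \<xi> + 1 \<and>
        snd z = real j - 1 + (1 - \<bar>fst z - ?c\<bar>) * (height i - (real j - 1))}"
    using edge_arc_cut[OF i \<epsilon> HOL.refl] .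
  have "{z. \<xi> \<le> fst z \<and> fst z \<le> \<xi> + 1 \<and>
        snd z = real j - 1 + (1 - \<bar>fst z - ?c\<bar>) * (height i - (real j - 1))}
      \<subseteq> closed_tile_cell j m l u - tile_cell j m l u"
  proof
    fix z assume "z \<in> {z. \<xi> \<le> fst z \<and> fst z \<le> \<xi> + 1 \<and>
        snd z = real j - 1 + (1 - \<bar>fst z - ?c\<bar>) * (height i - (real j - 1))}"
    then have z: "\<bar>fst z - ?c\<bar> \<le> 1" "snd z - (real j - 1) = (1 - \<bar>fst z - ?c\<bar>) * (height i - (real
        j - 1))"
      using \<xi>(1) by auto
    note b = cell_type_bounds[OF lu]
    consider "snd z - (real j - 1) = - (1 - \<bar>fst z - ?c\<bar>)" "l = - 1"
      | "snd z - (real j - 1) = 1 - \<bar>fst z - ?c\<bar>" "u = 1"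
      | "snd z - (real j - 1) = 0" "l = 0 \<or> u = 0"
      using side z(2) lu j_height by (auto simp: cell_type_def)
    then show "z \<in> closed_tile_cell j m l u - tile_cell j m l u"
      unfolding tile_cell_def closed_tile_cell_def cell_def closed_cell_def
      using z(1) b by cases auto
  qed
  then have "edge_arc G S c s \<epsilon> \<subseteq> wrap h ` (closed_tile_cell j m l u - tile_cell j m l u)"
    unfolding \<xi>(2) by (rule image_mono)
  also have "\<dots> \<subseteq> tile_boundary (wrap h ` tile_cell j m l u)"
    using lu by (rule tile_cell_boundary)
  finally show ?thesis .
qed

end

end

section \<open>Uniqueness of the tiles\<close>

lemma closure_meets_open:
  assumes "w \<in> closure T" "open U" "w \<in> U"
  obtains v where "v \<in> T" "v \<in> U"
  using assms open_Int_closure_eq_empty[of U T] by blast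

lemma connected_level_crossing:
  fixes T :: "(complex \<times> real) set"
  assumes "connected T" "v \<in> T" "w \<in> T" "snd v \<le> y" "y \<le> snd w"
  shows "\<exists>z\<in>T. snd z = y"
proof -
  have "connected (snd ` T)"
    using assms(1) by (intro connected_continuous_image continuous_intros)
  then have "{snd v..snd w} \<subseteq> snd ` T"
    using assms by (intro connected_contains_Icc) auto
  then have "y \<in> snd ` T"
    using assms(4,5) by auto
  then show ?thesis by auto
qed

lemma tile_subset: "tile G S c s T \<Longrightarrow> T \<subseteq> cylinder - drawing G S c s" "tile G S c s T \<Longrightarrow> connected T"
  unfolding tile_def using in_components_subset in_components_connected by blast+

context coxeter_drawing
begin

text \<open>\<open>T\<close> has points below and above level \<open>j - 1\<close>, so by
  connectedness one on it. Off the drawing this point is no copy of \<open>s j\<close>, hence lies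
  in some diamond, and \<open>T\<close> is that diamond. The midpoint of the lower edge then
  determines which one.\<close>

lemma diamond_unique:
  assumes j: "2 \<le> j" "j < p" and nb: "\<not> (p < n \<and> j = b)" and m: "m < h" and T: "tile G S c s T"
    and \<xi>: "\<bar>\<xi> - (of_int (x (s j)) + 2 * real m + 1)\<bar> = 1 / 2"
    and below: "wrap h (\<xi>, real j - 3 / 2) \<in> closure T" and above: "wrap h (\<xi>', real j - 1 / 2) \<in>
        closure T"
  shows "T = wrap h ` tile_cell j m (- 1) 1"
proof -
  have lu: "cell_type j (- 1) 1" using nb by (simp add: cell_type_def)
  have op: "open {w :: complex \<times> real. snd w < real j - 1}" "open {w :: complex \<times> real. real j - 1
      < snd w}"
    by (intro open_Collect_less continuous_intros)+
  obtain v where v: "v \<in> T" "snd v < real j - 1"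
    using closure_meets_open[OF below op(1)] by auto
  obtain v' where v': "v' \<in> T" "real j - 1 < snd v'"
    using closure_meets_open[OF above op(2)] by auto
  obtain w where w: "w \<in> T" "snd w = real j - 1"
    using connected_level_crossing[OF tile_subset(2)[OF T] v(1) v'(1), of "real j - 1"] v v' by auto
  have wc: "w \<in> cylinder" "w \<notin> drawing G S c s"
    using w tile_subset(1)[OF T] by auto
  obtain m' \<zeta> where m': "m' < h" "w = wrap h (\<zeta>, snd w)" "of_int (x (s j)) + 2 * real m' \<le> \<zeta>"
      "\<zeta> < of_int (x (s j)) + 2 * real m' + 2"
    using level_point[OF j wc(1)] .
  have "\<zeta> \<noteq> of_int (x (s j)) + 2 * real m'"
  proof
    assume "\<zeta> = of_int (x (s j)) + 2 * real m'"
    then have "w = wrap h (letter_point G S c s (s j, m'))"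
      using m'(2) w(2) j_range(1)[OF j] j_height(1)[OF j] by (simp add: letter_point_s)
    then show False
      using wc(2) letter_in_drawing s_in[OF j_range(1)[OF j]] by simp
  qed
  then have "(\<zeta>, snd w) \<in> tile_cell j m' (- 1) 1"
    using m' w(2) by (auto simp: tile_cell_def cell_def abs_if)
  then have T': "T = wrap h ` tile_cell j m' (- 1) 1"
    using w(1) m'(2) by (intro tile_eqI[OF j T lu]) blast
  then obtain z where z: "z \<in> closed_tile_cell j m' (- 1) 1" "wrap h (\<xi>, real j - 3 / 2) = wrap h z"
    using below closure_tile_cell[OF j lu, of m'] by auto
  obtain k :: int where k: "\<xi> = fst z + 2 * real h * of_int k" "snd z = real j - 3 / 2"
    using z(2) by (auto simp: wrap_eq_iff[OF h])
  \<comment> \<open>Signed number of blocks between the diamond found and the expected one. At half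
    height the closed diamond reaches only 1/2 from its centre, so the two centres,
    \<open>2 * N\<close> apart, are at distance at most 1.\<close>
  define N where "N = int m' + int h * k - int m"
  have "\<bar>\<xi> - 2 * real h * of_int k - (of_int (x (s j)) + 2 * real m' + 1)\<bar> \<le> 1 / 2"
    using z(1) k by (auto simp: closed_tile_cell_def closed_cell_def)
  then have "\<bar>2 * real_of_int N\<bar> \<le> 1"
    using \<xi> by (auto simp: N_def abs_if split: if_splits)
  then have "\<bar>real_of_int N\<bar> < 1" by simp
  then have "N = 0" by linarith
  then have "int m = int m' + int h * k" by (simp add: N_def)
  then have "int m' mod int h = int m mod int h" by simp
  then have "m' = m" using m m'(1) by simp
  then show ?thesis using T' by simp
qed

text \<open>Here the whole level is drawn, so \<open>T\<close> stays on one side of it, and the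
  point of the slanted side tells which. Near the midpoint of a horizontal edge that side contains
  only the triangle.\<close>

lemma triangle_unique:
  assumes j: "2 \<le> j" "j < p" and b: "p < n" "j = b" and lu: "cell_type j l u" and T: "tile G S c s
      T"
    and \<xi>: "\<bar>\<xi> - (of_int (x (s j)) + 2 * real m + 1)\<bar> = 1 / 2"
    and side: "wrap h (\<xi>', real j - 1 + (l + u) / 2) \<in> closure T" and base: "wrap h (\<xi>, real j -
        1) \<in> closure T"
  shows "T = wrap h ` tile_cell j m l u"
proof -
  have lu': "l = - 1 \<and> u = 0 \<or> l = 0 \<and> u = 1"
    using lu b by (simp add: cell_type_def)
  have off_level: "snd w \<noteq> real j - 1" if w: "w \<in> T" for w
  proof
    assume y: "snd w = real j - 1"
    have wc: "w \<in> cylinder" "w \<notin> drawing G S c s"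
      using w tile_subset(1)[OF T] by auto
    obtain m' \<zeta> where m': "m' < h" "w = wrap h (\<zeta>, snd w)" "of_int (x (s j)) + 2 * real m' \<le> \<zeta>"
        "\<zeta> < of_int (x (s j)) + 2 * real m' + 2"
      using level_point[OF j wc(1)] .
    then show False
      using base_in_drawing[OF j b, of m' \<zeta>] wc(2) y by simp
  qed
  have op: "open {w :: complex \<times> real. l < snd w - (real j - 1) \<and> snd w - (real j - 1) < u}"
    by (intro open_Collect_conj open_Collect_less continuous_intros)
  obtain v where v: "v \<in> T" "l < snd v - (real j - 1)" "snd v - (real j - 1) < u"
  proof -
    have "wrap h (\<xi>', real j - 1 + (l + u) / 2) \<in>
        {w. l < snd w - (real j - 1) \<and> snd w - (real j - 1) < u}"
      using lu' by auto
    from closure_meets_open[OF side op this] show thesis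
      using that by blast
  qed
  have same_side: "l = - 1 \<and> snd w < real j - 1 \<or> u = 1 \<and> real j - 1 < snd w" if w: "w \<in> T" for w
  proof (rule ccontr)
    assume "\<not> ?thesis"
    then have "snd v \<le> real j - 1 \<and> real j - 1 \<le> snd w \<or> snd w \<le> real j - 1 \<and> real j - 1 \<le> snd v"
      using v lu' by auto
    then have "\<exists>z\<in>T. snd z = real j - 1"
      using connected_level_crossing[OF tile_subset(2)[OF T] v(1) w]
        connected_level_crossing[OF tile_subset(2)[OF T] w v(1)] by metis
    then show False using off_level by blast
  qed
  \<comment> \<open>With \<open>\<xi>\<close> at distance 1/2 from the centre, radius 1/4 keeps the
    box inside the open diamond: the coordinate distances stay below 3/4 and 1/4.\<close>
  define B where "B = {z :: real \<times> real. \<bar>fst z - \<xi>\<bar> < 1 / 4 \<and> \<bar>snd z - (real j - 1)\<bar> < 1 / 4}"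
  have "open B"
    unfolding B_def by (intro open_Collect_conj open_Collect_less continuous_intros)
  then obtain U where U: "open U" "wrap h ` B = cylinder \<inter> U"
    using openin_wrap[OF h] by (metis openin_open)
  have "(\<xi>, real j - 1) \<in> B" by (simp add: B_def)
  then have "wrap h (\<xi>, real j - 1) \<in> U" using U(2) by blast
  then obtain w where w: "w \<in> T" "w \<in> U"
    using closure_meets_open[OF base U(1)] by blast
  then have "w \<in> wrap h ` B"
    unfolding U(2) using tile_subset(1)[OF T] by blast
  then obtain z where z: "z \<in> B" "wrap h z \<in> T"
    using w(1) by blast
  have "\<bar>fst z - (of_int (x (s j)) + 2 * real m + 1)\<bar> < 3 / 4" "\<bar>snd z - (real j - 1)\<bar> < 1 / 4"
    using z(1) \<xi> by (auto simp: B_def abs_if split: if_splits)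
  then have "z \<in> tile_cell j m l u"
    using same_side[OF z(2)] lu' unfolding tile_cell_def cell_def by auto
  then show ?thesis
    using z(2) by (intro tile_eqI[OF j T lu]) blast
qed

lemma degree_two_tile:
  assumes j: "2 \<le> j" "j < p" and nb: "\<not> (p < n \<and> j = b)" and cut: "cut_path (two_cover G S c) \<kappa>"
  shows "\<exists>!T. tile G S c s T \<and>
    edge_arc G S c s (cut_edge \<kappa> {s j, s (j - 1)}) \<subseteq> tile_boundary T \<and>
    edge_arc G S c s (cut_edge \<kappa> {s j, s (Suc j)}) \<subseteq> tile_boundary T"
proof -
  obtain m where m: "m < h" and block: "\<And>d. adj (s j) d \<Longrightarrow>
      cut_edge \<kappa> {s j, d} = proj (out_edge (s j) d m) \<or> cut_edge \<kappa> {s j, d} = proj (in_edge (s j)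
          d m)"
    using cut_edges_same_block[OF j_adj(1)[OF j] cut] by blast
  note lower = j_range(2)[OF j] j_adj(1)[OF j] block[OF j_adj(1)[OF j]]
  note upper = j_range(3)[OF j] j_adj(2)[OF j] block[OF j_adj(2)[OF j]]
  have lu: "cell_type j (- 1) 1" using nb by (simp add: cell_type_def)
  show ?thesis
  proof (rule ex1I[of _ "wrap h ` tile_cell j m (- 1) 1"], intro conjI)
    show "tile G S c s (wrap h ` tile_cell j m (- 1) 1)"
      by (rule tile_cell_tile[OF j lu])
    show "edge_arc G S c s (cut_edge \<kappa> {s j, s (j - 1)}) \<subseteq> tile_boundary (wrap h ` tile_cell j m
        (- 1) 1)"
      by (rule edge_arc_subset_boundary[OF j lower lu]) simp
    show "edge_arc G S c s (cut_edge \<kappa> {s j, s (Suc j)}) \<subseteq> tile_boundary (wrap h ` tile_cell j m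
        (- 1) 1)"
      by (rule edge_arc_subset_boundary[OF j upper lu]) simp
  next
    fix T
    assume T: "tile G S c s T \<and>
      edge_arc G S c s (cut_edge \<kappa> {s j, s (j - 1)}) \<subseteq> tile_boundary T \<and>
      edge_arc G S c s (cut_edge \<kappa> {s j, s (Suc j)}) \<subseteq> tile_boundary T"
    obtain \<xi> where \<xi>: "\<bar>\<xi> - (of_int (x (s j)) + 2 * real m + 1)\<bar> = 1 / 2"
        "wrap h (\<xi>, (real j - 1 + height (j - 1)) / 2) \<in> edge_arc G S c s (cut_edge \<kappa> {s j, s (j -
            1)})"
      using edge_arc_midpoint[OF j lower] .
    obtain \<xi>' where \<xi>': "wrap h (\<xi>', (real j - 1 + height (Suc j)) / 2) \<in> edge_arc G S c s
        (cut_edge \<kappa> {s j, s (Suc j)})"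
      using edge_arc_midpoint[OF j upper] .
    have "(real j - 1 + height (j - 1)) / 2 = real j - 3 / 2" "(real j - 1 + height (Suc j)) / 2 =
        real j - 1 / 2"
      using j_height[OF j] by (simp_all add: field_simps)
    then have "wrap h (\<xi>, real j - 3 / 2) \<in> closure T" "wrap h (\<xi>', real j - 1 / 2) \<in> closure T"
      using \<xi>(2) \<xi>' T tile_boundary_subset_closure[of T] by (metis subsetD)+
    then show "T = wrap h ` tile_cell j m (- 1) 1"
      using T by (intro diamond_unique[OF j nb m _ \<xi>(1)]) auto
  qed
qed

text \<open>The block shared by the three cut edges is a diamond split by its horizontal diagonal.
  This diagonal consists of the two edges at one copy of \<open>s n\<close>, which form the common
  boundary; one of them is cut.\<close>

lemma branch_tiles:
  assumes b: "p < n" "j = b" and cut: "cut_path (two_cover G S c) \<kappa>"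
  shows "\<exists>!(T1, T2). tile G S c s T1 \<and> tile G S c s T2 \<and> T1 \<noteq> T2 \<and>
    edge_arc G S c s (cut_edge \<kappa> {s j, s (j - 1)}) \<subseteq> tile_boundary T1 \<and>
    edge_arc G S c s (cut_edge \<kappa> {s j, s n}) \<subseteq> tile_boundary T1 \<and>
    edge_arc G S c s (cut_edge \<kappa> {s j, s (Suc j)}) \<subseteq> tile_boundary T2 \<and>
    edge_arc G S c s (cut_edge \<kappa> {s j, s n}) \<subseteq> tile_boundary T2 \<and>
    (\<exists>\<epsilon>1\<in>snd (two_cover G S c). \<exists>\<epsilon>2\<in>snd (two_cover G S c). \<epsilon>1 \<noteq> \<epsilon>2 \<and>
       tile_boundary T1 \<inter> tile_boundary T2 = edge_arc G S c s \<epsilon>1 \<union> edge_arc G S c s \<epsilon>2)"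
    (is "\<exists>!(T1, T2). ?P T1 T2")
proof -
  have j: "2 \<le> j" "j < p" using b p_le by auto
  have n_range: "n \<in> {1..n}" using j_range(1)[OF j] by auto
  note adj_n = j_adj(3)[OF j b]
  obtain m where m: "m < h" and block: "\<And>d. adj (s j) d \<Longrightarrow>
      cut_edge \<kappa> {s j, d} = proj (out_edge (s j) d m) \<or> cut_edge \<kappa> {s j, d} = proj (in_edge (s j)
          d m)"
    using cut_edges_same_block[OF j_adj(1)[OF j] cut] by blast
  note lower = j_range(2)[OF j] j_adj(1)[OF j] block[OF j_adj(1)[OF j]]
  note upper = j_range(3)[OF j] j_adj(2)[OF j] block[OF j_adj(2)[OF j]]
  note middle = n_range adj_n block[OF adj_n]
  have lu: "cell_type j (- 1) 0" "cell_type j 0 1" using b by (auto simp: cell_type_def)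
  let ?L = "wrap h ` tile_cell j m (- 1) 0" and ?U = "wrap h ` tile_cell j m 0 1"
  let ?out = "proj (out_edge (s j) (s n) m)" and ?in = "proj (in_edge (s j) (s n) m)"
  have arcs: "edge_arc G S c s ?out = wrap h ` letter_segment G S c s (out_edge (s j) (s n) m)"
    "edge_arc G S c s ?in = wrap h ` letter_segment G S c s (in_edge (s j) (s n) m)"
    using adj_n by (auto intro!: edge_arc_proj out_edge_hasse in_edge_hasse)
  have meet: "tile_boundary ?L \<inter> tile_boundary ?U = edge_arc G S c s ?out \<union> edge_arc G S c s ?in"
  proof
    show "edge_arc G S c s ?out \<union> edge_arc G S c s ?in \<subseteq> tile_boundary ?L \<inter> tile_boundary ?U"
      using b by (intro Un_least Int_greatest edge_arc_subset_boundary[OF j n_range adj_n]) (auto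
          simp: cell_type_def)
    show "tile_boundary ?L \<inter> tile_boundary ?U \<subseteq> edge_arc G S c s ?out \<union> edge_arc G S c s ?in"
    proof
      fix w assume "w \<in> tile_boundary ?L \<inter> tile_boundary ?U"
      then have "w \<in> closure ?L" "w \<in> closure ?U"
        using tile_boundary_subset_closure by blast+
      then obtain z z' where z: "z \<in> closed_tile_cell j m (- 1) 0" "w = wrap h z"
          and z': "z' \<in> closed_tile_cell j m 0 1" "w = wrap h z'"
        unfolding closure_tile_cell[OF j lu(1)] closure_tile_cell[OF j lu(2)] by blast
      \<comment> \<open>\<open>wrap\<close> preserves heights, so a point common to the lower and
        the upper closed triangle is on the diagonal even if its two lifts differ.\<close>
      have "snd z = snd z'" using z z' by (metis snd_wrap)
      then have y: "snd z = real j - 1" and d: "\<bar>fst z - (of_int (x (s j)) + 2 * real m + 1)\<bar> \<le> 1"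
        using z(1) z'(1) by (auto simp: closed_tile_cell_def closed_cell_def)
      have "z \<in> letter_segment G S c s (out_edge (s j) (s n) m) \<or> z \<in> letter_segment G S c s
          (in_edge (s j) (s n) m)"
        unfolding out_segment[OF n_range j_range(1)[OF j] adj_n] in_segment[OF n_range
            j_range(1)[OF j] adj_n]
          j_height(1)[OF j] j_height(4)[OF j b]
        using y d by (auto simp: mem_unit_segment_iff)
      then show "w \<in> edge_arc G S c s ?out \<union> edge_arc G S c s ?in"
        unfolding arcs z(2) by blast
    qed
  qed
  have "?out \<noteq> ?in"
    using adj_irrefl[OF adj_n] by (simp add: proj_out_edge proj_in_edge)
  moreover have "?out \<in> snd (two_cover G S c)" "?in \<in> snd (two_cover G S c)"
    unfolding two_cover_edges using adj_n by (auto intro!: imageI out_edge_hasse in_edge_hasse)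
  ultimately have two_edges: "\<exists>\<epsilon>1\<in>snd (two_cover G S c). \<exists>\<epsilon>2\<in>snd (two_cover G S c). \<epsilon>1 \<noteq> \<epsilon>2 \<and>
       tile_boundary ?L \<inter> tile_boundary ?U = edge_arc G S c s \<epsilon>1 \<union> edge_arc G S c s \<epsilon>2"
    using meet by blast
  have ne: "?L \<noteq> ?U"
  proof
    assume eq: "?L = ?U"
    have "(of_int (x (s j)) + 2 * real m + 1, real j - 1 - 1 / 2) \<in> tile_cell j m (- 1) 0"
      by (simp add: tile_cell_def cell_def)
    then have "wrap h (of_int (x (s j)) + 2 * real m + 1, real j - 1 - 1 / 2) \<in> ?U"
      unfolding eq[symmetric] by (rule imageI)
    then obtain z where z: "z \<in> tile_cell j m 0 1"
        "wrap h (of_int (x (s j)) + 2 * real m + 1, real j - 1 - 1 / 2) = wrap h z"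
      by blast
    then have "snd z = real j - 1 - 1 / 2" by (metis snd_wrap snd_conv)
    then show False using z(1) by (simp add: tile_cell_def cell_def)
  qed
  have P: "?P ?L ?U"
    using b two_edges ne tile_cell_tile[OF j lu(1)] tile_cell_tile[OF j lu(2)]
      edge_arc_subset_boundary[OF j lower lu(1)] edge_arc_subset_boundary[OF j upper lu(2)]
      edge_arc_subset_boundary[OF j middle lu(1)] edge_arc_subset_boundary[OF j middle lu(2)]
    by blast
  have unique: "T1 = ?L \<and> T2 = ?U" if T: "?P T1 T2" for T1 T2
  proof -
    obtain \<xi>1 where \<xi>1: "wrap h (\<xi>1, (real j - 1 + height (j - 1)) / 2) \<in> edge_arc G S c s
        (cut_edge \<kappa> {s j, s (j - 1)})"
      using edge_arc_midpoint[OF j lower] .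
    obtain \<xi>2 where \<xi>2: "wrap h (\<xi>2, (real j - 1 + height (Suc j)) / 2) \<in> edge_arc G S c s
        (cut_edge \<kappa> {s j, s (Suc j)})"
      using edge_arc_midpoint[OF j upper] .
    obtain \<xi> where \<xi>: "\<bar>\<xi> - (of_int (x (s j)) + 2 * real m + 1)\<bar> = 1 / 2"
        "wrap h (\<xi>, (real j - 1 + height n) / 2) \<in> edge_arc G S c s (cut_edge \<kappa> {s j, s n})"
      using edge_arc_midpoint[OF j middle] .
    have hts: "(real j - 1 + height (j - 1)) / 2 = real j - 1 + (- 1 + 0) / 2"
      "(real j - 1 + height (Suc j)) / 2 = real j - 1 + (0 + 1) / 2" "(real j - 1 + height n) / 2
          = real j - 1"
      using j_height[OF j] b by (simp_all add: field_simps)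
    have cl: "w \<in> closure T" if "w \<in> A" "A \<subseteq> tile_boundary T" for w A T
      using that tile_boundary_subset_closure[of T] by blast
    have "T1 = ?L"
      using T cl[OF \<xi>1[unfolded hts], of T1] cl[OF \<xi>(2)[unfolded hts], of T1]
      by (intro triangle_unique[OF j b lu(1) _ \<xi>(1)]) blast+
    moreover have "T2 = ?U"
      using T cl[OF \<xi>2[unfolded hts], of T2] cl[OF \<xi>(2)[unfolded hts], of T2]
      by (intro triangle_unique[OF j b lu(2) _ \<xi>(1)]) blast+
    ultimately show ?thesis ..
  qed
  show ?thesis
  proof (rule ex1I[of _ "(?L, ?U)"])
    show "case (?L, ?U) of (T1, T2) \<Rightarrow> ?P T1 T2"
      unfolding prod.case by (rule P)
    fix T assume "case T of (T1, T2) \<Rightarrow> ?P T1 T2"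
    then have "?P (fst T) (snd T)"
      unfolding case_prod_beta .
    then show "T = (?L, ?U)"
      using unique[of "fst T" "snd T"] by (metis prod.collapse)
  qed
qed

section \<open>Degrees in the labelled Coxeter graph\<close>

lemma incident_edges_subset:
  "incident_edges G S (s j) \<subseteq> (\<lambda>i. {s j, s i}) ` {i \<in> {1..n}. adj (s j) (s i)}"
proof
  fix e assume "e \<in> incident_edges G S (s j)"
  then obtain a where a: "adj (s j) a" "e = {s j, a}"
    using adj_sym unfolding incident_edges_def coxeter_graph_def adj_def by blast
  then obtain i where "i \<in> {1..n}" "a = s i"
    using s_surj unfolding adj_def by blast
  with a show "e \<in> (\<lambda>i. {s j, s i}) ` {i \<in> {1..n}. adj (s j) (s i)}" by blast
qed

text \<open>The branch vertex has three neighbours, while the pendant vertex and the ends of the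
  path have at most one, so only the other interior vertices remain. The order of \<open>i\<close>
  and \<open>k\<close> stays open, as the edges form a set.\<close>

lemma degree_two_neighbours:
  assumes ijk: "i \<in> {1..n}" "j \<in> {1..n}" "k \<in> {1..n}"
    and deg: "vertex_degree G S (s j) = 2" and inc: "incident_edges G S (s j) = {{s i, s j}, {s j,
        s k}}"
  shows "2 \<le> j \<and> j < p \<and> \<not> (p < n \<and> j = b) \<and> (i = j - 1 \<and> k = Suc j \<or> i = Suc j \<and> k = j - 1)"
proof -
  have "{s i, s j} \<noteq> {s j, s k}"
    using deg inc unfolding vertex_degree_def by (metis card_1_singleton_iff insert_absorb2
        numeral_eq_one_iff
      One_nat_def semiring_norm(85))
  then have ik: "i \<noteq> k" by (auto simp: insert_commute)
  have adj: "adj (s j) (s i)" "adj (s j) (s k)"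
    using inc adj_sym unfolding incident_edges_def adj_coxeter_graph[symmetric]
    by (auto simp: insert_commute)
  have nb: "l = i \<or> l = k" if "l \<in> {1..n}" "adj (s j) (s l)" for l
  proof -
    have "{s j, s l} \<in> incident_edges G S (s j)"
      using that adj_coxeter_graph unfolding incident_edges_def by blast
    then have "s l = s i \<or> s l = s k"
      unfolding inc by (auto simp: doubleton_eq_iff)
    then show ?thesis
      using that(1) ijk by (simp add: s_inj)
  qed
  have not_b: "\<not> (p < n \<and> j = b)"
  proof
    assume b: "p < n \<and> j = b"
    then have j: "2 \<le> j" "j < p" using p_le by auto
    then show False
      using nb[OF j_range(2)[OF j] j_adj(1)[OF j]] nb[OF j_range(3)[OF j] j_adj(2)[OF j]]
        nb[of n] j_adj(3)[OF j] b p_le ijk by auto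
  qed
  have "j \<le> p"
  proof (rule ccontr)
    assume "\<not> j \<le> p"
    then have "i = b" "k = b"
      using adj ijk p_le unfolding adj_iff[OF ijk(1,2)] adj_iff[OF ijk(3,2)] by auto
    with ik show False by simp
  qed
  have "(i = Suc j \<and> i \<le> p) \<or> j = Suc i" "(k = Suc j \<and> k \<le> p) \<or> j = Suc k"
    using adj not_b \<open>j \<le> p\<close> unfolding adj_iff[OF ijk(1,2)] adj_iff[OF ijk(3,2)] by auto
  then show ?thesis
    using ik not_b ijk by auto
qed

text \<open>Any other vertex has its neighbours in a set of at most two indices: the adjacent ones
  on the path, or \<open>b\<close> alone for the pendant vertex.\<close>

lemma degree_three_branch:
  assumes r: "r \<in> {1..n}" and deg: "vertex_degree G S (s r) = 3"
  shows "p < n \<and> r = b"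
proof (rule ccontr)
  assume not_b: "\<not> (p < n \<and> r = b)"
  have "{i \<in> {1..n}. adj (s r) (s i)} \<subseteq> (if r = n \<and> p < n then {b} else {r - 1, Suc r})"
    using r not_b by (auto simp: adj_iff)
  then have "card {i \<in> {1..n}. adj (s r) (s i)} \<le> card (if r = n \<and> p < n then {b} else {r - 1, Suc
      r})"
    by (intro card_mono) auto
  also have "\<dots> \<le> 2" by (simp add: card_insert_if)
  finally have "card ((\<lambda>i. {s r, s i}) ` {i \<in> {1..n}. adj (s r) (s i)}) \<le> 2"
    by (intro order_trans[OF card_image_le]) auto
  moreover have "card (incident_edges G S (s r)) \<le> card ((\<lambda>i. {s r, s i}) ` {i \<in> {1..n}. adj (s r)
      (s i)})"
    by (intro card_mono incident_edges_subset) auto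
  ultimately show False
    using deg by (simp add: vertex_degree_def)
qed

end

section \<open>Coxeter triples\<close>

context finite_coxeter_system
begin

lemma labelled_path:
  assumes path: "graph_path G S (map s [1..<Suc p])" and "1 \<le> i" "i \<le> j" "j \<le> p"
  shows "graph_path G S (map s [i..<Suc j])"
proof -
  have split: "[1..<Suc p] = [1..<i] @ [i..<Suc j] @ [Suc j..<Suc p]"
    using assms upt_add_eq_append[of 1 i "Suc p - i"] upt_add_eq_append[of i "Suc j" "p - j"] by
        simp
  show ?thesis
    using path unfolding split map_append graph_path_def successively_append_iff by auto
qed

text \<open>A chord would close the segment of the path between its ends to a cycle.\<close>

lemma labelled_path_chord:
  assumes path: "graph_path G S (map s [1..<Suc p])" and ij: "1 \<le> i" "i < j" "j \<le> p"
  shows "noncomm G (s i) (s j) \<longleftrightarrow> j = Suc i"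
proof
  have sub: "graph_path G S (map s [i..<Suc j])"
    using labelled_path[OF path] ij by simp
  assume nc: "noncomm G (s i) (s j)"
  show "j = Suc i"
  proof (rule ccontr)
    assume "j \<noteq> Suc i"
    then have "length (map s [i..<Suc j]) \<ge> 3" using ij by simp
    then have "{hd (map s [i..<Suc j]), last (map s [i..<Suc j])} \<notin> coxeter_graph G S"
      by (rule coxeter_graph_acyclic[OF sub])
    moreover have "hd (map s [i..<Suc j]) = s i" "last (map s [i..<Suc j]) = s j"
      using ij by (simp_all add: hd_map last_map del: upt_Suc)
    moreover have "s i \<in> S" "s j \<in> S"
      using sub ij unfolding graph_path_def by auto
    ultimately show False using nc by (simp add: coxeter_graph_iff)
  qed
next
  assume j: "j = Suc i"
  have "graph_path G S (map s [i..<Suc j])"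
    using labelled_path[OF path] ij by simp
  then have "{s i, s j} \<in> coxeter_graph G S"
    using j by (simp add: graph_path_def)
  then show "noncomm G (s i) (s j)" by (simp add: coxeter_graph_iff)
qed

text \<open>Two neighbours of \<open>v\<close> on the path, the segment between them and
  \<open>v\<close> itself would form a cycle.\<close>

lemma pendant_vertex_neighbour:
  assumes path: "graph_path G S (map s [1..<Suc p])" and v: "v \<in> S" "v \<notin> s ` {1..p}"
    and i: "1 \<le> i" "i \<le> p" "noncomm G (s i) v" and j: "1 \<le> j" "j \<le> p" "noncomm G (s j) v"
  shows "i = j"
proof -
  have False if ij: "1 \<le> i" "i < j" "j \<le> p" "noncomm G (s i) v" "noncomm G (s j) v" for i j
  proof -
    let ?vs = "map s [i..<Suc j] @ [v]"
    have sub: "graph_path G S (map s [i..<Suc j])"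
      using labelled_path[OF path] ij by simp
    have inS: "s i \<in> S" "s j \<in> S"
      using sub ij unfolding graph_path_def by auto
    have lst: "last (map s [i..<Suc j]) = s j" and hd: "hd (map s [i..<Suc j]) = s i"
      using ij by (simp_all add: hd_map last_map del: upt_Suc)
    have "v \<notin> set (map s [i..<Suc j])"
      using v ij by auto
    then have "graph_path G S ?vs"
      using sub v inS ij lst unfolding graph_path_def successively_append_iff
      by (auto simp: coxeter_graph_iff simp del: upt_Suc)
    moreover have "length ?vs \<ge> 3" using ij by simp
    ultimately have "{hd ?vs, last ?vs} \<notin> coxeter_graph G S"
      by (rule coxeter_graph_acyclic)
    moreover have "hd ?vs = s i" "last ?vs = v"
      using hd ij by (simp_all add: hd_append del: upt_Suc)
    ultimately show False
      using inS v ij by (simp add: coxeter_graph_iff)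
  qed
  from this[of i j] this[of j i] i j show ?thesis
    by (metis linorder_neqE_nat)
qed

end

lemma coxeter_triple_drawing:
  assumes triple: "coxeter_triple G S c" and labelling: "coxeter_labelling G S s"
  shows "coxeter_drawing G S c s"
proof -
  interpret group G
    using triple by (simp add: coxeter_triple_def coxeter_system_def)
  interpret finite_coxeter_system G S
    using triple by unfold_locales (simp_all add: coxeter_triple_def)
  let ?n = "card S" and ?p = "path_length G S" and ?b = "branch_index G S"
  obtain w where w: "coxeter_element G S w" "reduced_expression G S w c"
    using triple by (auto simp: coxeter_triple_def)
  have bij: "bij_betw s {1..?n} S" and path: "graph_path G S (map s [1..<Suc ?p])"
    and pendant: "type_D G S \<or> type_E G S \<Longrightarrow> {s ?b, s ?n} \<in> coxeter_graph G S"
    using labelling by (auto simp: coxeter_labelling_def longest_path_def)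
  \<comment> \<open>In type D the branch index is \<open>card S - 2\<close> with
    \<open>card S \<ge> 4\<close>, in type E it is \<open>card S - 3\<close> with
    \<open>card S \<ge> 6\<close>; in both cases it is interior to a path with
    \<open>card S - 1\<close> vertices.\<close>
  have branch: "?p = ?n \<and> \<not> (type_D G S \<or> type_E G S) \<or>
      Suc ?p = ?n \<and> 2 \<le> ?b \<and> ?b < ?p \<and> (type_D G S \<or> type_E G S)"
    by (auto simp: path_length_def branch_index_def type_D_def type_E_def)
  show ?thesis
  proof
    show "distinct c" "set c = S"
      using coxeter_word[OF w] by auto
    show "S \<noteq> {}"
      using triple by (simp add: coxeter_triple_def irreducible_system_def)
    have "word_prod G c \<in> carrier G"
      using w(2) word_prod_closed unfolding reduced_expression_def by blast
    then show "coxeter_number G c > 0"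
      using ord_ge_1[OF fin_carrier, of "word_prod G c"] by (simp add: coxeter_number_def)
    show "bij_betw s {1..?n} S" by (rule bij)
    show "?p = ?n \<or> Suc ?p = ?n \<and> 2 \<le> ?b \<and> ?b < ?p"
      using branch by auto
    fix i j assume ij: "1 \<le> i" "i < j" "j \<le> ?n"
    show "noncomm G (s i) (s j) \<longleftrightarrow> (j = Suc i \<and> j \<le> ?p) \<or> (i = ?b \<and> j = ?n \<and> ?p < ?n)"
    proof (cases "j \<le> ?p")
      case True
      then have "noncomm G (s i) (s j) \<longleftrightarrow> j = Suc i"
        using ij by (intro labelled_path_chord[OF path]) auto
      then show ?thesis using True by auto
    next
      case False
      then have j: "j = ?n" "Suc ?p = ?n" "2 \<le> ?b" "?b < ?p" "type_D G S \<or> type_E G S"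
        using branch ij by auto
      have "noncomm G (s ?b) (s ?n)"
        using pendant[OF j(5)] by (simp add: coxeter_graph_iff)
      moreover have "s ?n \<in> S"
        using bij_betwE[OF bij] j(2) by simp
      moreover have "s ?n \<notin> s ` {1..?p}"
        using inj_on_image_mem_iff[OF bij_betw_imp_inj_on[OF bij], of ?n "{1..?p}"] j(2) by simp
      ultimately have "noncomm G (s i) (s ?n) \<longleftrightarrow> i = ?b"
        using pendant_vertex_neighbour[OF path, of "s ?n" i ?b] ij j by auto
      then show ?thesis using j False by auto
    qed
  qed
qed

theorem theorem3p23:
  fixes G :: "('a, 'b) monoid_scheme" and S :: "'a set" and c :: "'a list"
    and s :: "nat \<Rightarrow> 'a" and \<kappa> :: "('a letter \<times> 'a letter) set"
  assumes triple: "coxeter_triple G S c"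
    and labelling: "coxeter_labelling G S s"
    and cut: "cut_path (two_cover G S c) \<kappa>"
  shows
    "(\<forall>e\<in>coxeter_graph G S. \<exists>!\<epsilon>. \<epsilon> \<in> \<kappa> \<and> lies_over \<epsilon> e)
     \<and>
     (\<forall>i\<in>{1..card S}. \<forall>j\<in>{1..card S}. \<forall>k\<in>{1..card S}.
        vertex_degree G S (s j) = 2 \<and> incident_edges G S (s j) = {{s i, s j}, {s j, s k}} \<longrightarrow>
        (\<exists>!T. tile G S c s T \<and>
              edge_arc G S c s (cut_edge \<kappa> {s i, s j}) \<subseteq> tile_boundary T \<and>
              edge_arc G S c s (cut_edge \<kappa> {s j, s k}) \<subseteq> tile_boundary T))
     \<and>
     (\<forall>r\<in>{1..card S}.
        vertex_degree G S (s r) = 3 \<and>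
        incident_edges G S (s r) = {{s (r - 1), s r}, {s r, s (r + 1)}, {s r, s (card S)}} \<longrightarrow>
        (\<exists>!(T1, T2). tile G S c s T1 \<and> tile G S c s T2 \<and> T1 \<noteq> T2 \<and>
              edge_arc G S c s (cut_edge \<kappa> {s (r - 1), s r}) \<subseteq> tile_boundary T1 \<and>
              edge_arc G S c s (cut_edge \<kappa> {s r, s (card S)}) \<subseteq> tile_boundary T1 \<and>
              edge_arc G S c s (cut_edge \<kappa> {s r, s (r + 1)}) \<subseteq> tile_boundary T2 \<and>
              edge_arc G S c s (cut_edge \<kappa> {s r, s (card S)}) \<subseteq> tile_boundary T2 \<and>
              (\<exists>\<epsilon>1\<in>snd (two_cover G S c). \<exists>\<epsilon>2\<in>snd (two_cover G S c). \<epsilon>1 \<noteq> \<epsilon>2 \<and>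
                 tile_boundary T1 \<inter> tile_boundary T2 =
                   edge_arc G S c s \<epsilon>1 \<union> edge_arc G S c s \<epsilon>2)))"
proof -
  interpret coxeter_drawing G S c s
    using triple labelling by (rule coxeter_triple_drawing)
  show ?thesis
  proof (intro conjI ballI impI)
    fix e assume "e \<in> coxeter_graph G S"
    then obtain a d where "adj a d" "e = {a, d}"
      unfolding coxeter_graph_def adj_def by blast
    then show "\<exists>!\<epsilon>. \<epsilon> \<in> \<kappa> \<and> lies_over \<epsilon> e"
      using cut_edge_unique[OF _ cut] by simp
  next
    fix i j k
    assume "i \<in> {1..card S}" "j \<in> {1..card S}" "k \<in> {1..card S}"
      "vertex_degree G S (s j) = 2 \<and> incident_edges G S (s j) = {{s i, s j}, {s j, s k}}"
    then have j: "2 \<le> j" "j < path_length G S" "\<not> (path_length G S < card S \<and> j = branch_index G S)"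
      and ik: "i = j - 1 \<and> k = Suc j \<or> i = Suc j \<and> k = j - 1"
      using degree_two_neighbours[of i j k] by auto
    show "\<exists>!T. tile G S c s T \<and>
        edge_arc G S c s (cut_edge \<kappa> {s i, s j}) \<subseteq> tile_boundary T \<and>
        edge_arc G S c s (cut_edge \<kappa> {s j, s k}) \<subseteq> tile_boundary T"
      using ik
    proof
      assume "i = j - 1 \<and> k = Suc j"
      then show ?thesis
        using degree_two_tile[OF j cut] by (simp add: insert_commute)
    next
      assume "i = Suc j \<and> k = j - 1"
      then show ?thesis
        using degree_two_tile[OF j cut] by (simp add: insert_commute conj_commute)
    qed
  next
    fix r
    assume "r \<in> {1..card S}" "vertex_degree G S (s r) = 3 \<and>
      incident_edges G S (s r) = {{s (r - 1), s r}, {s r, s (r + 1)}, {s r, s (card S)}}"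
    then have r: "path_length G S < card S" "r = branch_index G S"
      using degree_three_branch[of r] by auto
    show "\<exists>!(T1, T2). tile G S c s T1 \<and> tile G S c s T2 \<and> T1 \<noteq> T2 \<and>
        edge_arc G S c s (cut_edge \<kappa> {s (r - 1), s r}) \<subseteq> tile_boundary T1 \<and>
        edge_arc G S c s (cut_edge \<kappa> {s r, s (card S)}) \<subseteq> tile_boundary T1 \<and>
        edge_arc G S c s (cut_edge \<kappa> {s r, s (r + 1)}) \<subseteq> tile_boundary T2 \<and>
        edge_arc G S c s (cut_edge \<kappa> {s r, s (card S)}) \<subseteq> tile_boundary T2 \<and>
        (\<exists>\<epsilon>1\<in>snd (two_cover G S c). \<exists>\<epsilon>2\<in>snd (two_cover G S c). \<epsilon>1 \<noteq> \<epsilon>2 \<and>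
           tile_boundary T1 \<inter> tile_boundary T2 =
             edge_arc G S c s \<epsilon>1 \<union> edge_arc G S c s \<epsilon>2)"
      using branch_tiles[OF r cut] unfolding insert_commute[of "s (r - 1)" "s r" "{}"] Suc_eq_plus1 .
  qed
qed

end
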